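(* Let $G$ be an infinite countable discrete amenable group and let $(X,G)$ be a $G$-topological dynamical system with the specification property. Then every $\mu\in\mathcal M(X,G)$ is almost entropy-approximable.
   Context: **Setting.** $G$ is an infinite countable discrete amenable group with identity $e$. $\mathcal F(G)$ is the collection of finite subsets of $G$, and $|\cdot|$ is cardinality. A Følner sequence is a sequence $\{F_n\}_{n\ge1}$ of nonempty finite subsets of $G$ with $\lim_n |gF_n\triangle F_n|/|F_n|=0$ for every $g\in G$. It is tempered if there is a constant $L$ with $|\bigcup_{k<n}F_k^{-1}F_n|\le L|F_n|$ for all $n$. A $G$-topological dynamical system $(X,G)$ is a (nonempty) compact metric space $X$ with metric $\rho$ and an action of $G$ on $X$ by homeomorphisms, $(g,x)\mapsto gx$. $\mathcal M(X)$ and $\mathcal M(X,G)$ are the sets of Borel probability measures and of $G$-invariant Borel probability measures on $X$, with the weak-$*$ topology. A subset $\Lambda\subset X$ is $G$-invariant if $g\Lambda=\Lambda$ for all $g\in G$; for compact $G$-invariant $\Lambda$, $\mathcal M(\Lambda,G)$ denotes the $G$-invariant Borel probability measures of the subsystem $(\Lambda,G)$, viewed as measures on $X$. All logarithms are natural. **Entropy.** A tempered Følner sequence $\{K_n\}_{n\ge1}$ is fixed; scale-dependent quantities are computed along it. For $F\in\mathcal F(G)$ and $\varepsilon>0$, a set $E\subset X$ is $(F,\varepsilon)$-separated if for all distinct $x,y\in E$ there is $g\in F$ with $\rho(gx,gy)>\varepsilon$. For $Y\subset X$, $s(Y,F,\varepsilon)$ is the maximal cardinality of an $(F,\varepsilon)$-separated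 subset of $Y$, and $h(Y,G,\varepsilon):=\limsup_{n\to\infty}\frac1{|K_n|}\log s(Y,K_n,\varepsilon)$. For compact $G$-invariant $Y$, $h(Y,G):=\lim_{\varepsilon\to0}h(Y,G,\varepsilon)$. For $\mu\in\mathcal M(X,G)$, $h_\mu(X,G)$ is the measure (Kolmogorov–Sinai) entropy: $h_\mu(X,G)=\sup_\alpha\lim_n\frac1{|K_n|}H_\mu(\bigvee_{g\in K_n}g^{-1}\alpha)$, the supremum over finite measurable partitions $\alpha$, where $H_\mu(\alpha)=-\sum_{A\in\alpha}\mu(A)\log\mu(A)$. **Almost entropy-approximable.** A measure $\mu\in\mathcal M(X,G)$ with $h_\mu(X,G)>0$ is almost entropy-approximable if for every neighborhood $U$ of $\mu$, every $h\in(0,h_\mu(X,G))$ and every $\varepsilon,\beta>0$ there exist a compact $G$-invariant set $\Lambda\subset X$ and $\gamma\in(0,\varepsilon)$ such that $\mathcal M(\Lambda,G)\subset U$, $h(\Lambda,G)>h$ and $h(\Lambda,G,\gamma)<h+\beta$. By convention, if $h_\mu(X,G)=0$, then $\mu$ is almost entropy-approximable if for every neighborhood $U$ of $\mu$ there is a nonempty compact $G$-invariant set $\Lambda\subset X$ with $\mathcal M(\Lambda,G)\subset U$. **Specification property.** $(X,G)$ has the specification property if for every $\varepsilon>0$ there is a nonempty finite $K\subset G$ such that for any finite subsets $F_1,\dots,F_m\subset G$ with $KF_i\cap F_j=\varnothing$ for all $1\le i\ne j\le m$, and any $x_1,\dots,x_m\in X$, there is $y\in X$ with $\rho(sx_i,sy)\le\varepsilon$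 for all $s\in F_i$, $1\le i\le m$. *)

theory Defs
  imports "HOL-Probability.Probability" "HOL-Algebra.Group_Action"
begin

section \<open>Amenable groups\<close>

text \<open>Sequences indexed by \<open>n \<ge> 1\<close> are re-indexed by \<open>nat\<close>, starting at \<open>0\<close>.\<close>

definition Folner_sequence :: "('g, 'b) monoid_scheme \<Rightarrow> (nat \<Rightarrow> 'g set) \<Rightarrow> bool" where
  "Folner_sequence G F \<longleftrightarrow>
     (\<forall>n. F n \<subseteq> carrier G \<and> finite (F n) \<and> F n \<noteq> {}) \<and>
     (\<forall>g\<in>carrier G. (\<lambda>n. real (card (sym_diff (g <#\<^bsub>G\<^esub> F n) (F n))) / real (card (F n))) \<longlonglongrightarrow> 0)"

definition tempered :: "('g, 'b) monoid_scheme \<Rightarrow> (nat \<Rightarrow> 'g set) \<Rightarrow> bool" where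
  "tempered G F \<longleftrightarrow>
     (\<exists>L::real. \<forall>n. real (card (\<Union>k<n. (set_inv\<^bsub>G\<^esub> (F k)) <#>\<^bsub>G\<^esub> F n)) \<le> L * real (card (F n)))"

definition infinite_countable_amenable_group :: "('g, 'b) monoid_scheme \<Rightarrow> bool" where
  "infinite_countable_amenable_group G \<longleftrightarrow>
     group G \<and> infinite (carrier G) \<and> countable (carrier G) \<and> (\<exists>F. Folner_sequence G F)"


section \<open>Topological dynamical systems\<close>

text \<open>The space \<open>X\<close> is a whole type of class \<open>metric_space\<close>, hence nonempty;
  \<open>\<phi> g x\<close> is the point \<open>gx\<close>.\<close>

definition G_tds :: "('g, 'b) monoid_scheme \<Rightarrow> ('g \<Rightarrow> 'x \<Rightarrow> 'x::metric_space) \<Rightarrow> bool" where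
  "G_tds G \<phi> \<longleftrightarrow>
     compact (UNIV :: 'x set) \<and>
     group_action G UNIV \<phi> \<and>
     (\<forall>g\<in>carrier G. homeomorphism UNIV UNIV (\<phi> g) (\<phi> (inv\<^bsub>G\<^esub> g)))"

definition G_invariant_set :: "('g, 'b) monoid_scheme \<Rightarrow> ('g \<Rightarrow> 'x \<Rightarrow> 'x) \<Rightarrow> 'x set \<Rightarrow> bool" where
  "G_invariant_set G \<phi> \<Lambda> \<longleftrightarrow> (\<forall>g\<in>carrier G. \<phi> g ` \<Lambda> = \<Lambda>)"

definition specification_property ::
    "('g, 'b) monoid_scheme \<Rightarrow> ('g \<Rightarrow> 'x \<Rightarrow> 'x::metric_space) \<Rightarrow> bool" where
  "specification_property G \<phi> \<longleftrightarrow>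
     (\<forall>\<epsilon>>0. \<exists>K. K \<subseteq> carrier G \<and> finite K \<and> K \<noteq> {} \<and>
        (\<forall>(m::nat) (F :: nat \<Rightarrow> 'g set) (x :: nat \<Rightarrow> 'x).
           (\<forall>i\<in>{1..m}. F i \<subseteq> carrier G \<and> finite (F i)) \<and>
           (\<forall>i\<in>{1..m}. \<forall>j\<in>{1..m}. i \<noteq> j \<longrightarrow> (K <#>\<^bsub>G\<^esub> F i) \<inter> F j = {}) \<longrightarrow>
           (\<exists>y. \<forall>i\<in>{1..m}. \<forall>s\<in>F i. dist (\<phi> s (x i)) (\<phi> s y) \<le> \<epsilon>)))"


section \<open>Invariant measures and the weak-* topology\<close>

definition Borel_probs :: "'x::topological_space measure set" where
  "Borel_probs = {\<mu>. sets \<mu> = sets borel \<and> prob_space \<mu>}"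

definition weak_star_topology :: "'x::topological_space measure topology" where
  "weak_star_topology = topology_generated_by
     {{\<mu> \<in> Borel_probs. (\<integral>x. f x \<partial>\<mu>) \<in> V} | (f :: 'x \<Rightarrow> real) V. continuous_on UNIV f \<and> open V}"

definition weak_star_nhd :: "'x::topological_space measure set \<Rightarrow> 'x measure \<Rightarrow> bool" where
  "weak_star_nhd U \<mu> \<longleftrightarrow> (\<exists>V. openin weak_star_topology V \<and> \<mu> \<in> V \<and> V \<subseteq> U)"

definition invariant_measure ::
    "('g, 'b) monoid_scheme \<Rightarrow> ('g \<Rightarrow> 'x \<Rightarrow> 'x) \<Rightarrow> 'x measure \<Rightarrow> bool" where
  "invariant_measure G \<phi> \<mu> \<longleftrightarrow> (\<forall>g\<in>carrier G. distr \<mu> \<mu> (\<phi> g) = \<mu>)"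

definition inv_probs ::
    "('g, 'b) monoid_scheme \<Rightarrow> ('g \<Rightarrow> 'x \<Rightarrow> 'x::topological_space) \<Rightarrow> 'x measure set" where
  "inv_probs G \<phi> = {\<mu> \<in> Borel_probs. invariant_measure G \<phi> \<mu>}"

text \<open>Invariant Borel probability measures of the subsystem \<open>(\<Lambda>,G)\<close>, pushed forward along the
  inclusion of \<open>\<Lambda>\<close> into the whole space; see lemma \<open>sub_inv_probs_eq\<close>.\<close>

definition sub_inv_probs ::
    "('g, 'b) monoid_scheme \<Rightarrow> ('g \<Rightarrow> 'x \<Rightarrow> 'x::topological_space) \<Rightarrow> 'x set \<Rightarrow> 'x measure set" where
  "sub_inv_probs G \<phi> \<Lambda> =
     {distr \<nu> borel (\<lambda>x. x) | \<nu>. sets \<nu> = sets (restrict_space borel \<Lambda>) \<and> prob_space \<nu> \<and>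
        invariant_measure G \<phi> \<nu>}"


section \<open>Topological entropy\<close>

definition separated ::
    "('g \<Rightarrow> 'x \<Rightarrow> 'x::metric_space) \<Rightarrow> 'g set \<Rightarrow> real \<Rightarrow> 'x set \<Rightarrow> bool" where
  "separated \<phi> F \<epsilon> E \<longleftrightarrow>
     (\<forall>x\<in>E. \<forall>y\<in>E. x \<noteq> y \<longrightarrow> (\<exists>g\<in>F. dist (\<phi> g x) (\<phi> g y) > \<epsilon>))"

text \<open>For finite \<open>F\<close> and \<open>\<epsilon> > 0\<close> the cardinalities below are bounded, by compactness, so the
  supremum is a maximum (lemma \<open>sep_card_attained\<close>).\<close>

definition sep_card ::
    "('g \<Rightarrow> 'x \<Rightarrow> 'x::metric_space) \<Rightarrow> 'x set \<Rightarrow> 'g set \<Rightarrow> real \<Rightarrow> nat" where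
  "sep_card \<phi> Y F \<epsilon> = Sup {card E | E. E \<subseteq> Y \<and> finite E \<and> separated \<phi> F \<epsilon> E}"

text \<open>Since \<open>ln 0 = 0\<close>, both entropies of the empty set are \<open>0\<close> here; the value makes no
  difference below, where an entropy of a possibly empty set is required to exceed some \<open>h > 0\<close>.\<close>

definition entropy_scale ::
    "(nat \<Rightarrow> 'g set) \<Rightarrow> ('g \<Rightarrow> 'x \<Rightarrow> 'x::metric_space) \<Rightarrow> 'x set \<Rightarrow> real \<Rightarrow> ereal" where
  "entropy_scale K \<phi> Y \<epsilon> =
     limsup (\<lambda>n. ereal (1 / real (card (K n)) * ln (real (sep_card \<phi> Y (K n) \<epsilon>))))"

definition top_entropy ::
    "(nat \<Rightarrow> 'g set) \<Rightarrow> ('g \<Rightarrow> 'x \<Rightarrow> 'x::metric_space) \<Rightarrow> 'x set \<Rightarrow> ereal" where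
  "top_entropy K \<phi> Y = Lim (at_right 0) (\<lambda>\<epsilon>. entropy_scale K \<phi> Y \<epsilon>)"


section \<open>Measure entropy\<close>

definition finite_Borel_partition :: "'x::topological_space set set \<Rightarrow> bool" where
  "finite_Borel_partition \<alpha> \<longleftrightarrow> finite \<alpha> \<and> \<alpha> \<subseteq> sets borel \<and> partition_on UNIV \<alpha>"

definition partition_entropy :: "'x measure \<Rightarrow> 'x set set \<Rightarrow> real" where
  "partition_entropy \<mu> \<alpha> = - (\<Sum>A\<in>\<alpha>. measure \<mu> A * ln (measure \<mu> A))"

text \<open>The join of the partitions \<open>g\<^sup>-\<^sup>1 \<alpha>\<close>, \<open>g \<in> F\<close>.\<close>

definition partition_join :: "('g \<Rightarrow> 'x \<Rightarrow> 'x) \<Rightarrow> 'g set \<Rightarrow> 'x set set \<Rightarrow> 'x set set" where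
  "partition_join \<phi> F \<alpha> = common_refinement ((\<lambda>g. (\<lambda>A. \<phi> g -` A) ` \<alpha>) ` F)"

definition measure_entropy ::
    "(nat \<Rightarrow> 'g set) \<Rightarrow> ('g \<Rightarrow> 'x \<Rightarrow> 'x::topological_space) \<Rightarrow> 'x measure \<Rightarrow> ereal" where
  "measure_entropy K \<phi> \<mu> =
     (SUP \<alpha>\<in>{\<alpha>. finite_Borel_partition \<alpha>}.
        lim (\<lambda>n. ereal (1 / real (card (K n)) * partition_entropy \<mu> (partition_join \<phi> (K n) \<alpha>))))"


section \<open>Almost entropy-approximable measures\<close>

definition almost_entropy_approximable ::
    "('g, 'b) monoid_scheme \<Rightarrow> (nat \<Rightarrow> 'g set) \<Rightarrow> ('g \<Rightarrow> 'x \<Rightarrow> 'x::metric_space) \<Rightarrow> 'x measure \<Rightarrow> bool" where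
  "almost_entropy_approximable G K \<phi> \<mu> \<longleftrightarrow>
     (if measure_entropy K \<phi> \<mu> > 0 then
        (\<forall>U (h::real) (\<epsilon>::real) (\<beta>::real).
           weak_star_nhd U \<mu> \<and> 0 < h \<and> ereal h < measure_entropy K \<phi> \<mu> \<and> 0 < \<epsilon> \<and> 0 < \<beta> \<longrightarrow>
           (\<exists>\<Lambda> \<gamma>. compact \<Lambda> \<and> G_invariant_set G \<phi> \<Lambda> \<and> 0 < \<gamma> \<and> \<gamma> < \<epsilon> \<and>
              sub_inv_probs G \<phi> \<Lambda> \<subseteq> U \<and>
              top_entropy K \<phi> \<Lambda> > ereal h \<and>
              entropy_scale K \<phi> \<Lambda> \<gamma> < ereal (h + \<beta>)))
      else
        (\<forall>U. weak_star_nhd U \<mu> \<longrightarrow>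
           (\<exists>\<Lambda>. \<Lambda> \<noteq> {} \<and> compact \<Lambda> \<and> G_invariant_set G \<phi> \<Lambda> \<and> sub_inv_probs G \<phi> \<Lambda> \<subseteq> U)))"


section \<open>Consistency of the encodings\<close>

lemma G_tds_continuous:
  assumes "G_tds G \<phi>" "g \<in> carrier G"
  shows "continuous_on UNIV (\<phi> g)"
  using assms by (auto simp: G_tds_def homeomorphism_def)

lemma topspace_weak_star: "topspace (weak_star_topology :: 'x::topological_space measure topology) = Borel_probs"
proof -
  let ?B = "{{\<mu> \<in> Borel_probs. (\<integral>x. f x \<partial>\<mu>) \<in> V} | (f :: 'x \<Rightarrow> real) V. continuous_on UNIV f \<and> open V}"
  have "Borel_probs = {\<mu> \<in> Borel_probs. (\<integral>x. (\<lambda>_::'x. 0::real) x \<partial>\<mu>) \<in> UNIV}" by simp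
  then have "Borel_probs \<in> ?B" using continuous_on_const open_UNIV by blast
  then have "\<Union>?B = Borel_probs" by blast
  then show ?thesis by (simp add: weak_star_topology_def topology_generated_by_topspace)
qed

lemma sub_inv_probs_eq:
  fixes \<phi> :: "'g \<Rightarrow> 'x \<Rightarrow> 'x::metric_space"
  assumes tds: "G_tds G \<phi>" and L: "compact \<Lambda>" "G_invariant_set G \<phi> \<Lambda>"
  shows "sub_inv_probs G \<phi> \<Lambda> = {\<mu> \<in> inv_probs G \<phi>. measure \<mu> \<Lambda> = 1}"
proof -
  have Lm: "\<Lambda> \<in> sets borel" using L(1) by (auto intro: borel_closed compact_imp_closed)
  have pm[measurable]: "\<phi> g \<in> borel_measurable borel" if "g \<in> carrier G" for g
    using G_tds_continuous[OF tds that] by (rule borel_measurable_continuous_onI)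
  have inL: "\<phi> g x \<in> \<Lambda>" if "g \<in> carrier G" "x \<in> \<Lambda>" for g x
    using L(2) that by (auto simp: G_invariant_set_def)
  have pmL: "\<phi> g \<in> measurable (restrict_space borel \<Lambda>) (restrict_space borel \<Lambda>)"
    if g: "g \<in> carrier G" for g
    by (intro measurable_restrict_space2 measurable_restrict_space1 pm[OF g])
      (auto simp: space_restrict_space intro: inL[OF g])
  have idL: "(\<lambda>x. x) \<in> measurable (restrict_space borel \<Lambda>) borel"
    by (intro measurable_restrict_space1) auto
  show ?thesis
  proof (intro equalityI subsetI)
    fix \<mu> assume "\<mu> \<in> sub_inv_probs G \<phi> \<Lambda>"
    then obtain \<nu> where \<mu>: "\<mu> = distr \<nu> borel (\<lambda>x. x)"
      and s: "sets \<nu> = sets (restrict_space borel \<Lambda>)" and p: "prob_space \<nu>"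
      and i: "invariant_measure G \<phi> \<nu>"
      by (auto simp: sub_inv_probs_def)
    interpret prob_space \<nu> by fact
    have sp: "space \<nu> = \<Lambda>" using sets_eq_imp_space_eq[OF s] by (simp add: space_restrict_space)
    have id: "(\<lambda>x. x) \<in> measurable \<nu> borel" using idL measurable_cong_sets[OF s refl] by blast
    have "distr \<mu> \<mu> (\<phi> g) = \<mu>" if g: "g \<in> carrier G" for g
    proof -
      have m1: "\<phi> g \<in> measurable \<nu> \<nu>" using pmL[OF g] measurable_cong_sets[OF s s] by blast
      have "distr \<mu> \<mu> (\<phi> g) = distr \<mu> borel (\<phi> g)" by (rule distr_cong) (auto simp: \<mu>)
      also have "\<dots> = distr \<nu> borel (\<lambda>x. \<phi> g x)"
        unfolding \<mu> by (subst distr_distr) (auto simp: id pm[OF g] comp_def)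
      also have "\<dots> = distr (distr \<nu> \<nu> (\<phi> g)) borel (\<lambda>x. x)"
        by (subst distr_distr) (auto simp: id m1 comp_def)
      also have "\<dots> = \<mu>" using i g by (simp add: invariant_measure_def \<mu>)
      finally show ?thesis .
    qed
    moreover have "prob_space \<mu>" unfolding \<mu> by (rule prob_space_distr[OF id])
    moreover have "measure \<mu> \<Lambda> = 1"
      unfolding \<mu> using prob_space sp by (subst measure_distr) (auto simp: id Lm)
    ultimately show "\<mu> \<in> {\<mu> \<in> inv_probs G \<phi>. measure \<mu> \<Lambda> = 1}"
      by (auto simp: inv_probs_def Borel_probs_def invariant_measure_def \<mu>)
  next
    fix \<mu> assume "\<mu> \<in> {\<mu> \<in> inv_probs G \<phi>. measure \<mu> \<Lambda> = 1}"
    then have s: "sets \<mu> = sets borel" and p: "prob_space \<mu>"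
      and i: "\<And>g. g \<in> carrier G \<Longrightarrow> distr \<mu> \<mu> (\<phi> g) = \<mu>" and one: "measure \<mu> \<Lambda> = 1"
      by (auto simp: inv_probs_def Borel_probs_def invariant_measure_def)
    interpret prob_space \<mu> by fact
    have sp: "space \<mu> = UNIV" using sets_eq_imp_space_eq[OF s] by simp
    have Lmu: "\<Lambda> \<in> sets \<mu>" using Lm s by simp
    define \<nu> where "\<nu> = restrict_space \<mu> \<Lambda>"
    have s\<nu>: "sets \<nu> = sets (restrict_space borel \<Lambda>)" by (simp add: \<nu>_def sets_restrict_space s)
    have sp\<nu>: "space \<nu> = \<Lambda>" using sets_eq_imp_space_eq[OF s\<nu>] by (simp add: space_restrict_space)
    have em: "emeasure \<nu> A = emeasure \<mu> A" if "A \<subseteq> \<Lambda>" for A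
      unfolding \<nu>_def using that Lmu by (intro emeasure_restrict_space) (auto simp: sp)
    have ae: "AE x in \<mu>. x \<in> \<Lambda>" using one Lmu by (simp add: prob_eq_1)
    have cap: "emeasure \<mu> (A \<inter> \<Lambda>) = emeasure \<mu> A" if "A \<in> sets \<mu>" for A
      using ae that Lmu by (intro emeasure_eq_AE) auto
    have p\<nu>: "prob_space \<nu>"
      by (rule prob_spaceI) (simp add: sp\<nu> em emeasure_eq_measure one)
    have inv: "distr \<nu> \<nu> (\<phi> g) = \<nu>" if g: "g \<in> carrier G" for g
    proof (rule measure_eqI)
      fix A assume "A \<in> sets (distr \<nu> \<nu> (\<phi> g))"
      then have A: "A \<in> sets \<nu>" by simp
      then have A2: "A \<subseteq> \<Lambda>" "A \<in> sets \<mu>"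
        using sets.sets_into_space[OF A] sp\<nu> Lm by (auto simp: s\<nu> s sets_restrict_space)
      have m1: "\<phi> g \<in> measurable \<nu> \<nu>" using pmL[OF g] measurable_cong_sets[OF s\<nu> s\<nu>] by blast
      have m2: "\<phi> g \<in> measurable \<mu> \<mu>" using pm[OF g] measurable_cong_sets[OF s s] by blast
      have "emeasure (distr \<nu> \<nu> (\<phi> g)) A = emeasure \<mu> (\<phi> g -` A \<inter> \<Lambda>)"
        by (subst emeasure_distr[OF m1 A]) (simp add: sp\<nu> em)
      also have "\<dots> = emeasure \<mu> (\<phi> g -` A \<inter> space \<mu>)"
        using cap[OF measurable_sets[OF m2 A2(2)]] by (simp add: sp)
      also have "\<dots> = emeasure (distr \<mu> \<mu> (\<phi> g)) A" by (rule emeasure_distr[OF m2 A2(2), symmetric])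
      finally show "emeasure (distr \<nu> \<nu> (\<phi> g)) A = emeasure \<nu> A" by (simp add: i[OF g] em A2)
    qed simp
    have id: "(\<lambda>x. x) \<in> measurable \<nu> borel" using idL measurable_cong_sets[OF s\<nu> refl] by blast
    have "\<mu> = distr \<nu> borel (\<lambda>x. x)"
    proof (rule measure_eqI)
      fix A assume A: "A \<in> sets \<mu>"
      then have "A \<in> sets borel" by (simp add: s)
      then show "emeasure \<mu> A = emeasure (distr \<nu> borel (\<lambda>x. x)) A"
        using cap[OF A] by (subst emeasure_distr[OF id]) (auto simp: sp\<nu> em)
    qed (simp add: s)
    then show "\<mu> \<in> sub_inv_probs G \<phi> \<Lambda>"
      unfolding sub_inv_probs_def using s\<nu> p\<nu> inv by (auto simp: invariant_measure_def)
  qed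
qed

lemma sep_card_attained:
  fixes \<phi> :: "'g \<Rightarrow> 'x \<Rightarrow> 'x::metric_space"
  assumes tds: "G_tds G \<phi>" and F: "finite F" "F \<subseteq> carrier G" and e: "\<epsilon> > 0"
  shows "\<exists>E\<subseteq>Y. finite E \<and> separated \<phi> F \<epsilon> E \<and> card E = sep_card \<phi> Y F \<epsilon>"
    and "E \<subseteq> Y \<Longrightarrow> separated \<phi> F \<epsilon> E \<Longrightarrow> finite E \<and> card E \<le> sep_card \<phi> Y F \<epsilon>"
proof -
  have compact_UNIV: "compact (UNIV :: 'x set)" using tds by (simp add: G_tds_def)
  have uc: "\<exists>d>0. \<forall>x y. dist x y < d \<longrightarrow> dist (\<phi> g x) (\<phi> g y) < \<epsilon>" if "g \<in> F" for g
  proof -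
    have "uniformly_continuous_on UNIV (\<phi> g)"
      using G_tds_continuous[OF tds] that F compact_UNIV
      by (intro compact_uniformly_continuous) auto
    then show ?thesis using e by (force simp: uniformly_continuous_on_def dist_commute)
  qed
  then obtain d where d: "\<And>g. g \<in> F \<Longrightarrow> d g > 0"
    "\<And>g x y. g \<in> F \<Longrightarrow> dist x y < d g \<Longrightarrow> dist (\<phi> g x) (\<phi> g y) < \<epsilon>" by metis
  define \<delta> where "\<delta> = Min (insert 1 (d ` F))"
  have \<delta>: "\<delta> > 0" "\<And>g. g \<in> F \<Longrightarrow> \<delta> \<le> d g" using F(1) d(1) by (auto simp: \<delta>_def)
  have "\<forall>e>0. \<exists>k. finite k \<and> (UNIV :: 'x set) \<subseteq> (\<Union>x\<in>k. ball x e)"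
    using compact_UNIV[unfolded compact_eq_totally_bounded] by (rule conjunct2)
  then obtain C where C: "finite C" "(UNIV :: 'x set) \<subseteq> (\<Union>c\<in>C. ball c (\<delta>/2))"
    using half_gt_zero[OF \<delta>(1)] by blast
  have "\<exists>c\<in>C. dist c x < \<delta>/2" for x using subsetD[OF C(2), of x] by simp
  then obtain c where c: "\<And>x. c x \<in> C" "\<And>x. dist (c x) x < \<delta>/2" by metis
  have bd: "finite E \<and> card E \<le> card C" if E: "separated \<phi> F \<epsilon> E" for E
  proof -
    have "inj_on c E"
    proof (rule inj_onI, rule ccontr)
      fix x y assume *: "x \<in> E" "y \<in> E" "c x = c y" "x \<noteq> y"
      then obtain g where g: "g \<in> F" "dist (\<phi> g x) (\<phi> g y) > \<epsilon>"
        using E by (auto simp: separated_def)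
      have "dist x y < \<delta>"
        by (rule dist_triangle_half_r[of "c x"]) (use c(2)[of x] c(2)[of y] *(3) in simp_all)
      then have "dist (\<phi> g x) (\<phi> g y) < \<epsilon>" using d(2)[OF g(1)] \<delta>(2)[OF g(1)] by auto
      with g show False by simp
    qed
    moreover have "c ` E \<subseteq> C" using c by auto
    ultimately show ?thesis using C(1) by (meson card_inj_on_le inj_on_finite)
  qed
  let ?S = "{card E | E. E \<subseteq> Y \<and> finite E \<and> separated \<phi> F \<epsilon> E}"
  have fin: "finite ?S" by (rule finite_subset[of _ "{..card C}"]) (auto dest: bd)
  have ne: "?S \<noteq> {}" by (auto intro!: exI[of _ "{}"] simp: separated_def)
  have eq: "sep_card \<phi> Y F \<epsilon> = Max ?S"
    unfolding sep_card_def by (rule cSup_eq_Max[OF fin ne])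
  show "\<exists>E\<subseteq>Y. finite E \<and> separated \<phi> F \<epsilon> E \<and> card E = sep_card \<phi> Y F \<epsilon>"
    using Max_in[OF fin ne] unfolding eq by auto
  show "finite E \<and> card E \<le> sep_card \<phi> Y F \<epsilon>" if "E \<subseteq> Y" "separated \<phi> F \<epsilon> E"
    unfolding eq using bd[OF that(2)] that by (auto intro!: Max_ge[OF fin])
qed

end

theory Submission
  imports Defs
begin

text \<open>
Three observations carry the proof.

\<^item> Entropy. If a partition has entropy rate \<open>a\<close>, then its join over any finite set \<open>J\<close> of group elements has
  entropy at least \<open>a |J|\<close>: by Shearer's inequality the limit along a Folner sequence is the infimum of the
  normalised entropies over all finite sets (\<open>fent_Shearer\<close>, \<open>entropy_rate\<close>). Hence at a small scale \<open>\<delta>\<close> the law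
  of the nearest point of a maximal \<open>(J, \<delta>)\<close>-separated set has entropy almost \<open>a |J|\<close>, while the
  mean of its orbit sums over \<open>J\<close> is almost \<open>|J|\<close> times the integral, whatever the shape of \<open>J\<close>
  (\<open>separated_distribution\<close>). The orbit segments themselves need not be typical for the measure.

\<^item> Carving. If the boundary of \<open>F\<close> is a small part of \<open>F\<close>, then averaging over all \<open>c\<close> shows that every nonempty
  finite set \<open>A\<close> meets some translate \<open>F c\<close> in a set with few points on the boundary of \<open>F c\<close>. Removing such sets
  greedily cuts any finite set into small separated pieces (\<open>finite_carving\<close>). The same greedy procedure on the
  whole group leaves a remainder which no translate meets thinly, and averaging again shows that this remainder is
  sparse in every sufficiently invariant window (\<open>infinite_carving\<close>, \<open>exists_spread_family\<close>). The pieces can be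
  taken connected with respect to the separating set, so that a family of pieces is determined by its union. As the
  complement of this union is sparse, the families themselves contribute almost no entropy.

\<^item> Independent labels. Cut a large finite set \<open>A\<close> into small pieces and draw on each piece, independently, a point from
  the law of the first step. By the weak law of large numbers more than \<open>exp (h |A|)\<close> of the resulting sequences have
  the right orbit averages, also when the measure is not ergodic, and specification glues each of them into one point
  (\<open>typical_sequences\<close>, \<open>typical_orbits\<close>).

The set \<open>\<Lambda>\<close> is the closure of the set of all points which, on every piece \<open>I\<close> of some family of connected pieces of the
group, follow one of about \<open>exp (h |I|)\<close> typical labels (\<open>exists_horseshoe\<close>). Its invariant measures are close
to \<open>\<mu>\<close> because the orbit averages over a large window are; its entropy at a small scale exceeds \<open>h\<close> because labels on
different pieces are independent; and at the given scale the labels together with the sparse complement determine the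
orbit segment, which bounds the entropy from above. A measure of zero entropy is treated in the same way with a single
label on each piece.
\<close>

section \<open>Carving a group into separated pieces\<close>

context group begin

text \<open>For symmetric \<open>K\<close> this is the usual two-sided \<open>K\<close>-boundary of \<open>F\<close>.\<close>

definition bdry :: "'a set \<Rightarrow> 'a set \<Rightarrow> 'a set" where
  "bdry K F = {f\<in>F. \<exists>k\<in>K. k \<otimes> f \<notin> F}"

lemma mem_r_coset: "x \<in> F #> c \<longleftrightarrow> (\<exists>f\<in>F. x = f \<otimes> c)"
  by (auto simp: r_coset_def)

lemma r_coset_memI: "f \<in> F \<Longrightarrow> f \<otimes> c \<in> F #> c"
  by (auto simp: r_coset_def)

lemma mem_set_mult: "x \<in> M <#> W \<longleftrightarrow> (\<exists>m\<in>M. \<exists>w\<in>W. x = m \<otimes> w)"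
  by (auto simp: set_mult_def)

lemma finite_setmult: "finite M \<Longrightarrow> finite W \<Longrightarrow> finite (M <#> W)"
  by (auto simp: set_mult_def)

lemma finite_r_coset: "finite F \<Longrightarrow> finite (F #> c)"
  by (auto simp: r_coset_def)

text \<open>The translates \<open>B c\<close> containing \<open>a\<close> are those with \<open>c = b\<^sup>-\<^sup>1 a\<close>; so a point is covered exactly \<open>|B|\<close> times
  by the family of all translates. This double counting is behind both carving lemmas and the cover in Shearer's inequality.\<close>

lemma card_translates_at:
  assumes "B \<subseteq> carrier G" "finite B" "a \<in> carrier G" "finite C" "C \<subseteq> carrier G"
  shows "card {c\<in>C. a \<in> B #> c} \<le> card B"
    and "(\<forall>b\<in>B. inv b \<otimes> a \<in> C) \<Longrightarrow> card {c\<in>C. a \<in> B #> c} = card B"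
proof -
  have inj: "inj_on (\<lambda>b. inv b \<otimes> a) B"
  proof (rule inj_onI)
    fix x y assume xy: "x \<in> B" "y \<in> B" "inv x \<otimes> a = inv y \<otimes> a"
    then have "x \<in> carrier G" "y \<in> carrier G" using assms(1) by auto
    then have "inv x = inv y" using xy(3) assms(3) by simp
    then show "x = y" using \<open>x \<in> carrier G\<close> \<open>y \<in> carrier G\<close> inv_inv by metis
  qed
  have sub: "{c\<in>C. a \<in> B #> c} \<subseteq> (\<lambda>b. inv b \<otimes> a) ` B"
  proof
    fix c assume "c \<in> {c\<in>C. a \<in> B #> c}"
    then obtain b where b: "b \<in> B" "a = b \<otimes> c" "c \<in> C" by (auto simp: mem_r_coset)
    then have "b \<in> carrier G" "c \<in> carrier G" using assms by auto
    then have "inv b \<otimes> a = c" using b by (simp add: m_assoc[symmetric])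
    then show "c \<in> (\<lambda>b. inv b \<otimes> a) ` B" using b by blast
  qed
  show "card {c\<in>C. a \<in> B #> c} \<le> card B"
    using card_mono[OF _ sub] card_image[OF inj] assms(2) by auto
  assume C: "\<forall>b\<in>B. inv b \<otimes> a \<in> C"
  have "(\<lambda>b. inv b \<otimes> a) ` B \<subseteq> {c\<in>C. a \<in> B #> c}"
  proof
    fix c assume "c \<in> (\<lambda>b. inv b \<otimes> a) ` B"
    then obtain b where b: "b \<in> B" "c = inv b \<otimes> a" by auto
    have bc: "b \<in> carrier G" using b assms by auto
    have "b \<otimes> c = a" using bc assms(3) b by (simp add: m_assoc[symmetric])
    then have "a \<in> B #> c" using r_coset_memI[OF b(1), of c] by simp
    then show "c \<in> {c\<in>C. a \<in> B #> c}" using C b by auto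
  qed
  then have "{c\<in>C. a \<in> B #> c} = (\<lambda>b. inv b \<otimes> a) ` B" using sub by blast
  then show "card {c\<in>C. a \<in> B #> c} = card B" by (simp add: card_image[OF inj])
qed

lemma sum_card_translates_swap:
  assumes "finite C" "finite A"
  shows "(\<Sum>c\<in>C. card ((B #> c) \<inter> A)) = (\<Sum>a\<in>A. card {c\<in>C. a \<in> B #> c})"
proof -
  have "(\<Sum>c\<in>C. card ((B #> c) \<inter> A)) = (\<Sum>c\<in>C. \<Sum>a\<in>A. if a \<in> B #> c then 1 else 0)"
    by (intro sum.cong refl) (simp add: sum.If_cases[OF assms(2)] Int_commute)
  also have "\<dots> = (\<Sum>a\<in>A. \<Sum>c\<in>C. if a \<in> B #> c then 1 else 0)" by (rule sum.swap)
  also have "\<dots> = (\<Sum>a\<in>A. card {c\<in>C. a \<in> B #> c})"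
  proof (intro sum.cong refl)
    fix a
    have "{c\<in>C. a \<in> B #> c} = C \<inter> {c. a \<in> B #> c}" by blast
    then show "(\<Sum>c\<in>C. if a \<in> B #> c then 1 else 0) = card {c\<in>C. a \<in> B #> c}"
      by (simp add: sum.If_cases[OF assms(1)])
  qed
  finally show ?thesis .
qed

lemma sum_card_translates_le:
  assumes "B \<subseteq> carrier G" "finite B" "A \<subseteq> carrier G" "finite A" "finite C" "C \<subseteq> carrier G"
  shows "(\<Sum>c\<in>C. card ((B #> c) \<inter> A)) \<le> card B * card A"
proof -
  have "(\<Sum>c\<in>C. card ((B #> c) \<inter> A)) \<le> (\<Sum>a\<in>A. card B)"
    unfolding sum_card_translates_swap[OF assms(5,4)] using assms
    by (intro sum_mono card_translates_at(1)) auto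
  then show ?thesis by (simp add: mult.commute)
qed

lemma sum_card_translates_eq:
  assumes "B \<subseteq> carrier G" "finite B" "A \<subseteq> carrier G" "finite A" "finite C" "C \<subseteq> carrier G"
    and "\<And>a b. a \<in> A \<Longrightarrow> b \<in> B \<Longrightarrow> inv b \<otimes> a \<in> C"
  shows "(\<Sum>c\<in>C. card ((B #> c) \<inter> A)) = card B * card A"
proof -
  have "(\<Sum>c\<in>C. card ((B #> c) \<inter> A)) = (\<Sum>a\<in>A. card B)"
    unfolding sum_card_translates_swap[OF assms(5,4)] using assms
    by (intro sum.cong card_translates_at(2) refl) auto
  then show ?thesis by (simp add: mult.commute)
qed

lemma bdry_subset: "bdry K F \<subseteq> F" by (auto simp: bdry_def)

text \<open>Averaged over all \<open>c\<close>, the part of \<open>A\<close> on the boundary of \<open>F c\<close> has size proportional to \<open>|bdry K F|\<close> and the part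
  in \<open>F c\<close> has size proportional to \<open>|F|\<close>, with the same factor \<open>|A|\<close>. So they cannot be in the wrong ratio for every \<open>c\<close>.\<close>

lemma exists_thin_translate:
  assumes F: "F \<subseteq> carrier G" "finite F" "F \<noteq> {}" and A: "A \<subseteq> carrier G" "finite A" "A \<noteq> {}"
    and thin: "real (card (bdry K F)) \<le> \<eta> * real (card F)"
  shows "\<exists>c\<in>carrier G. (F #> c) \<inter> A \<noteq> {} \<and>
    real (card ((bdry K F #> c) \<inter> A)) \<le> \<eta> * real (card ((F #> c) \<inter> A))"
proof (rule ccontr)
  assume neg: "\<not> ?thesis"
  define C where "C = (\<lambda>(b, a). inv b \<otimes> a) ` (F \<times> A)"
  have C: "finite C" "C \<subseteq> carrier G" "C \<noteq> {}"
    using F A by (auto simp: C_def)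
  have big: "\<eta> * real (card ((F #> c) \<inter> A)) < real (card ((bdry K F #> c) \<inter> A))" if "c \<in> C" for c
  proof -
    from that obtain b a where ba: "b \<in> F" "a \<in> A" "c = inv b \<otimes> a" by (auto simp: C_def)
    have "b \<in> carrier G" "a \<in> carrier G" using ba F A by auto
    then have "b \<otimes> c = a" using ba by (simp add: m_assoc[symmetric])
    then have "a \<in> F #> c" using r_coset_memI[OF ba(1), of c] by simp
    then have "(F #> c) \<inter> A \<noteq> {}" using ba by blast
    then show ?thesis using neg C(2) that by force
  qed
  have cov: "inv b \<otimes> a \<in> C" if "a \<in> A" "b \<in> F" for a b
    using that by (force simp: C_def)
  have b: "bdry K F \<subseteq> carrier G" "finite (bdry K F)"
    using F bdry_subset[of K F] finite_subset by blast+
  have eqb: "(\<Sum>c\<in>C. card ((bdry K F #> c) \<inter> A)) = card (bdry K F) * card A"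
    by (rule sum_card_translates_eq[OF b A(1,2) C(1,2)]) (use cov bdry_subset in blast)
  have eqF: "(\<Sum>c\<in>C. card ((F #> c) \<inter> A)) = card F * card A"
    by (rule sum_card_translates_eq[OF F(1,2) A(1,2) C(1,2)]) (use cov in blast)
  have "(\<Sum>c\<in>C. \<eta> * real (card ((F #> c) \<inter> A))) < (\<Sum>c\<in>C. real (card ((bdry K F #> c) \<inter> A)))"
    using big C by (intro sum_strict_mono) auto
  also have "\<dots> = real (card (bdry K F) * card A)"
    unfolding eqb[symmetric] by simp
  also have "\<dots> \<le> \<eta> * real (card F) * real (card A)"
    using mult_right_mono[OF thin, of "real (card A)"] by simp
  also have "\<dots> = \<eta> * real (card F * card A)" by simp
  also have "\<dots> = (\<Sum>c\<in>C. \<eta> * real (card ((F #> c) \<inter> A)))"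
    unfolding eqF[symmetric] by (simp add: sum_distrib_left)
  finally show False by simp
qed

lemma sep_commute:
  assumes "K \<subseteq> carrier G" "\<forall>k\<in>K. inv k \<in> K" "A \<subseteq> carrier G" "B \<subseteq> carrier G"
    and "(K <#> A) \<inter> B = {}"
  shows "(K <#> B) \<inter> A = {}"
proof (rule ccontr)
  assume "\<not> ?thesis"
  then obtain k b where kb: "k \<in> K" "b \<in> B" "k \<otimes> b \<in> A" by (auto simp: mem_set_mult)
  have "k \<in> carrier G" "b \<in> carrier G" using kb assms by auto
  then have "inv k \<otimes> (k \<otimes> b) = b" by (simp add: m_assoc[symmetric])
  moreover have "inv k \<otimes> (k \<otimes> b) \<in> K <#> A" using kb assms by (auto simp: mem_set_mult)
  ultimately show False using assms(5) kb by auto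
qed

lemma sep_mono: "(K <#> A) \<inter> B = {} \<Longrightarrow> A' \<subseteq> A \<Longrightarrow> B' \<subseteq> B \<Longrightarrow> (K <#> A') \<inter> B' = {}"
  by (auto simp: set_mult_def)

lemma sep_disjoint:
  assumes "\<one> \<in> K" "A \<subseteq> carrier G" "(K <#> A) \<inter> B = {}" shows "A \<inter> B = {}"
proof -
  have "A \<subseteq> K <#> A" using assms(1,2) by (force simp: set_mult_def)
  then show ?thesis using assms(3) by blast
qed

text \<open>Whatever remains after \<open>F c\<close> has been removed is separated from the interior of \<open>F c\<close>.\<close>

lemma interior_sep:
  assumes "K \<subseteq> carrier G" "F \<subseteq> carrier G" "c \<in> carrier G" "A \<inter> (F #> c) = {}"
  shows "(K <#> ((F #> c) - (bdry K F #> c))) \<inter> A = {}"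
proof -
  have "k \<otimes> x \<in> F #> c" if "k \<in> K" "x \<in> (F #> c) - (bdry K F #> c)" for k x
  proof -
    from that obtain f where f: "f \<in> F" "x = f \<otimes> c" "f \<notin> bdry K F" by (auto simp: mem_r_coset)
    then have "k \<otimes> f \<in> F" using that by (auto simp: bdry_def)
    moreover have "k \<otimes> x = (k \<otimes> f) \<otimes> c"
      using f(2) subsetD[OF assms(1) that(1)] subsetD[OF assms(2) f(1)] assms(3) by (simp add: m_assoc)
    ultimately show ?thesis by (auto simp: mem_r_coset)
  qed
  then show ?thesis using assms(4) by (auto simp: set_mult_def)
qed

lemma card_interior_ge: "card ((F #> c) \<inter> A - (B #> c)) \<ge> card ((F #> c) \<inter> A) - card ((B #> c) \<inter> A)"
  if "finite F" "B \<subseteq> F"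
proof -
  have "(F #> c) \<inter> A - (B #> c) = (F #> c) \<inter> A - (B #> c) \<inter> A" by blast
  moreover have "finite ((B #> c) \<inter> A)"
    using finite_r_coset[OF finite_subset[OF that(2,1)]] by blast
  ultimately show ?thesis using diff_card_le_card_Diff by metis
qed

text \<open>Greedy removal of thin translates: each step loses at most the fraction \<open>\<eta>\<close> of the points that it removes.\<close>

lemma finite_carving:
  assumes K: "K \<subseteq> carrier G" "\<forall>k\<in>K. inv k \<in> K" "\<one> \<in> K"
    and F: "F \<subseteq> carrier G" "finite F" "F \<noteq> {}"
    and thin: "real (card (bdry K F)) \<le> \<eta> * real (card F)"
    and A: "A \<subseteq> carrier G" "finite A"
  shows "\<exists>P. finite P \<and> (\<forall>I\<in>P. I \<subseteq> A \<and> I \<noteq> {} \<and> (\<exists>c\<in>carrier G. I \<subseteq> F #> c)) \<and>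
     (\<forall>I\<in>P. \<forall>J\<in>P. I \<noteq> J \<longrightarrow> (K <#> I) \<inter> J = {}) \<and> (1 - \<eta>) * real (card A) \<le> real (card (\<Union>P))"
  using A
proof (induction "card A" arbitrary: A rule: less_induct)
  case less
  show ?case
  proof (cases "A = {}")
    case True
    then show ?thesis by (intro exI[of _ "{}"]) auto
  next
    case False
    obtain c where c: "c \<in> carrier G" "(F #> c) \<inter> A \<noteq> {}"
      and le: "real (card ((bdry K F #> c) \<inter> A)) \<le> \<eta> * real (card ((F #> c) \<inter> A))"
      using exists_thin_translate[OF F less.prems False thin] by blast
    define A' where "A' = A - (F #> c)"
    have A': "A' \<subseteq> carrier G" "finite A'" using less.prems by (auto simp: A'_def)
    have "A' \<subset> A" using c by (auto simp: A'_def)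
    then have "card A' < card A" using less.prems by (intro psubset_card_mono) auto
    from less.hyps[OF this A'] obtain P where P: "finite P"
      "\<forall>I\<in>P. I \<subseteq> A' \<and> I \<noteq> {} \<and> (\<exists>c\<in>carrier G. I \<subseteq> F #> c)"
      "\<forall>I\<in>P. \<forall>J\<in>P. I \<noteq> J \<longrightarrow> (K <#> I) \<inter> J = {}"
      "(1 - \<eta>) * real (card A') \<le> real (card (\<Union>P))" by (elim exE conjE) (rule that)
    define I0 where "I0 = (F #> c) \<inter> A - (bdry K F #> c)"
    have s1: "(K <#> I0) \<inter> A' = {}"
      by (rule sep_mono[OF interior_sep[OF K(1) F(1) c(1), of A']]) (auto simp: A'_def I0_def)
    have s2: "(K <#> A') \<inter> I0 = {}"
      by (rule sep_commute[OF K(1,2) _ A'(1) s1]) (use less.prems in \<open>auto simp: I0_def\<close>)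
    define P' where "P' = (if I0 = {} then P else insert I0 P)"
    have U: "\<Union>P' = I0 \<union> \<Union>P" by (auto simp: P'_def)
    have PA: "\<Union>P \<subseteq> A'" using P(2) by blast
    have disj: "I0 \<inter> \<Union>P = {}" using PA by (auto simp: I0_def A'_def)
    have fin: "finite I0" "finite (\<Union>P)"
      using less.prems PA finite_subset[OF PA A'(2)] by (auto simp: I0_def)
    have "card A = card ((F #> c) \<inter> A) + card A'"
      unfolding A'_def using less.prems(2) by (metis card_Int_Diff Int_commute)
    moreover have "real (card I0) \<ge> (1 - \<eta>) * real (card ((F #> c) \<inter> A))"
    proof -
      have "card ((F #> c) \<inter> A) - card ((bdry K F #> c) \<inter> A) \<le> card I0"
        unfolding I0_def by (rule card_interior_ge[OF F(2) bdry_subset])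
      then have "real (card ((F #> c) \<inter> A)) - real (card ((bdry K F #> c) \<inter> A)) \<le> real (card I0)"
        by linarith
      then show ?thesis using le by (simp add: algebra_simps)
    qed
    ultimately have "(1 - \<eta>) * real (card A) \<le> real (card I0) + real (card (\<Union>P))"
      using P(4) by (simp add: algebra_simps)
    then have "(1 - \<eta>) * real (card A) \<le> real (card (\<Union>P'))"
      unfolding U card_Un_disjoint[OF fin disj] by simp
    moreover have fP: "finite P'" using P(1) by (simp add: P'_def)
    moreover have iP: "I \<subseteq> A \<and> I \<noteq> {} \<and> (\<exists>c\<in>carrier G. I \<subseteq> F #> c)" if I: "I \<in> P'" for I
    proof (cases "I \<in> P")
      case True
      then show ?thesis using bspec[OF P(2) True] by (auto simp: A'_def)
    next
      case False
      then have "I = I0" "I0 \<noteq> {}" using I by (auto simp: P'_def split: if_splits)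
      then show ?thesis using c(1) by (auto simp: I0_def)
    qed
    moreover have sP: "(K <#> I) \<inter> J = {}" if ij: "I \<in> P'" "J \<in> P'" "I \<noteq> J" for I J
    proof -
      consider "I \<in> P" "J \<in> P" | "I = I0" "J \<in> P" | "J = I0" "I \<in> P"
        using ij by (auto simp: P'_def split: if_splits)
      then show ?thesis
      proof cases
        case 1 then show ?thesis using P(3) ij by blast
      next
        case 2 then show ?thesis using sep_mono[OF s1] P(2) by blast
      next
        case 3 then show ?thesis using sep_mono[OF s2] P(2) by blast
      qed
    qed
    ultimately show ?thesis
    proof (intro exI[of _ P'] conjI)
      show "\<forall>I\<in>P'. I \<subseteq> A \<and> I \<noteq> {} \<and> (\<exists>c\<in>carrier G. I \<subseteq> F #> c)" by (intro ballI iP)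
      show "\<forall>I\<in>P'. \<forall>J\<in>P'. I \<noteq> J \<longrightarrow> (K <#> I) \<inter> J = {}" by (intro ballI impI sP)
    qed
  qed
qed

definition thin_part :: "'a set \<Rightarrow> 'a set \<Rightarrow> real \<Rightarrow> 'a set \<Rightarrow> 'a \<Rightarrow> 'a set" where
  "thin_part K F \<eta> A c =
     (if real (card ((bdry K F #> c) \<inter> A)) \<le> \<eta> * real (card ((F #> c) \<inter> A)) then (F #> c) \<inter> A else {})"

primrec uncarved :: "'a set \<Rightarrow> 'a set \<Rightarrow> real \<Rightarrow> (nat \<Rightarrow> 'a) \<Rightarrow> nat \<Rightarrow> 'a set" where
  "uncarved K F \<eta> e 0 = carrier G"
| "uncarved K F \<eta> e (Suc n) = uncarved K F \<eta> e n - thin_part K F \<eta> (uncarved K F \<eta> e n) (e n)"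

text \<open>A translate that is not thin may become thin after other sets have been carved out, so every centre has to be tried
  infinitely often.\<close>

lemma recurrent_enumeration:
  assumes "countable (carrier G)"
  shows "\<exists>e::nat \<Rightarrow> 'a. range e \<subseteq> carrier G \<and> (\<forall>c\<in>carrier G. \<forall>N. \<exists>n\<ge>N. e n = c)"
proof -
  have ne: "carrier G \<noteq> {}" by blast
  define e where "e n = from_nat_into (carrier G) (fst (prod_decode n))" for n
  have "range e \<subseteq> carrier G" using from_nat_into[OF ne] by (auto simp: e_def)
  moreover have "\<exists>n\<ge>N. e n = c" if c: "c \<in> carrier G" for c N
  proof -
    have "e (prod_encode (to_nat_on (carrier G) c, N)) = c"
      using c assms by (simp add: e_def)
    then show ?thesis using le_prod_encode_2 by blast
  qed
  ultimately show ?thesis by blast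
qed

text \<open>Greedy carving of the whole group. The remainder \<open>Z\<close> need not be empty, but no translate meets it thinly: the trace of
  the finite set \<open>F c\<close> on the decreasing remainders becomes constant, and a thin nonempty trace would be carved out at the
  next visit of \<open>c\<close>.\<close>

lemma infinite_carving:
  assumes cnt: "countable (carrier G)"
    and K: "K \<subseteq> carrier G" "\<forall>k\<in>K. inv k \<in> K" "\<one> \<in> K"
    and F: "F \<subseteq> carrier G" "finite F"
  obtains D :: "nat \<Rightarrow> 'a set" and e :: "nat \<Rightarrow> 'a" and Z :: "'a set"
  where "range e \<subseteq> carrier G" "\<And>n. D n \<subseteq> F #> e n" "\<And>m n. m \<noteq> n \<Longrightarrow> D m \<inter> D n = {}"
    "\<And>n. real (card ((bdry K F #> e n) \<inter> D n)) \<le> \<eta> * real (card (D n))"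
    "\<And>m n. m \<noteq> n \<Longrightarrow> (K <#> (D m - (bdry K F #> e m))) \<inter> (D n - (bdry K F #> e n)) = {}"
    "carrier G = Z \<union> (\<Union>n. D n)"
    "\<And>c. c \<in> carrier G \<Longrightarrow> \<eta> * real (card ((F #> c) \<inter> Z)) \<le> real (card ((bdry K F #> c) \<inter> Z))"
proof -
  obtain e :: "nat \<Rightarrow> 'a" where e: "range e \<subseteq> carrier G" "\<And>c N. c \<in> carrier G \<Longrightarrow> \<exists>n\<ge>N. e n = c"
    using recurrent_enumeration[OF cnt] by blast
  define A where "A = uncarved K F \<eta> e"
  define D where "D n = thin_part K F \<eta> (A n) (e n)" for n
  define Z where "Z = (\<Inter>n. A n)"
  have A0: "A 0 = carrier G" and AS: "A (Suc n) = A n - D n" for n by (simp_all add: A_def D_def)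
  have ec: "e n \<in> carrier G" for n using e(1) by auto
  have DA: "D n \<subseteq> A n" for n by (auto simp: D_def thin_part_def)
  have dec: "A n \<subseteq> A m" if "m \<le> n" for m n
    using that by (induction rule: dec_induct) (auto simp: AS)
  have AG: "A n \<subseteq> carrier G" for n using dec[of 0 n] A0 by simp
  have later: "D n \<subseteq> A m - D m" if "m < n" for m n
    using dec[of "Suc m" n] DA[of n] that AS by auto
  have lsep: "(D m \<inter> D n = {})" if "m < n" for m n using later[OF that] by blast
  have full: "A m \<inter> (F #> e m) \<subseteq> D m" if "D m \<noteq> {}" for m
    using that by (auto simp: D_def thin_part_def split: if_splits)
  have DF: "D n \<subseteq> F #> e n" for n by (auto simp: D_def thin_part_def)
  have sep1: "(K <#> (D m - (bdry K F #> e m))) \<inter> (D n - (bdry K F #> e n)) = {}" if "m < n" for m n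
  proof (cases "D m = {}")
    case True then show ?thesis by (auto simp: set_mult_def)
  next
    case False
    have "D n \<inter> (F #> e m) = {}" using full[OF False] later[OF that] by blast
    from interior_sep[OF K(1) F(1) ec this] show ?thesis
      by (rule sep_mono) (use DF in auto)
  qed
  have DG: "D n \<subseteq> carrier G" for n using DA AG by blast
  have sep: "(K <#> (D m - (bdry K F #> e m))) \<inter> (D n - (bdry K F #> e n)) = {}" if "m \<noteq> n" for m n
  proof (cases "m < n")
    case True then show ?thesis by (rule sep1)
  next
    case False
    then have "n < m" using that by simp
    from sep1[OF this] show ?thesis
      by (rule sep_commute[OF K(1,2), rotated -1]) (use DG in auto)
  qed
  have "carrier G = Z \<union> (\<Union>n. D n)"
  proof
    have "Z \<subseteq> carrier G" using AG[of 0] by (auto simp: Z_def)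
    then show "Z \<union> (\<Union>n. D n) \<subseteq> carrier G" using DG by blast
    show "carrier G \<subseteq> Z \<union> (\<Union>n. D n)"
    proof
      fix x assume x: "x \<in> carrier G"
      have "x \<in> A n" if "x \<notin> (\<Union>n. D n)" for n
        using that x by (induction n) (auto simp: A0 AS)
      then show "x \<in> Z \<union> (\<Union>n. D n)" by (auto simp: Z_def)
    qed
  qed
  moreover have "\<eta> * real (card ((F #> c) \<inter> Z)) \<le> real (card ((bdry K F #> c) \<inter> Z))"
    if c: "c \<in> carrier G" for c
  proof (rule ccontr)
    assume neg: "\<not> ?thesis"
    have fin: "finite (F #> c)" by (rule finite_r_coset[OF F(2)])
    have "\<exists>N. \<forall>n\<ge>N. (F #> c) \<inter> A n = (F #> c) \<inter> Z"
    proof -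
      have "\<forall>x\<in>(F #> c) - Z. \<exists>N. x \<notin> A N" by (auto simp: Z_def)
      then obtain N where N: "\<And>x. x \<in> (F #> c) - Z \<Longrightarrow> x \<notin> A (N x)" by metis
      define M where "M = Max (insert 0 (N ` ((F #> c) - Z)))"
      have "N x \<le> M" if "x \<in> (F #> c) - Z" for x
        using that fin by (auto simp: M_def)
      then have "x \<notin> A n" if "x \<in> (F #> c) - Z" "n \<ge> M" for x n
        using N[OF that(1)] dec[of "N x" n] that by (meson order_trans subsetD)
      then show ?thesis by (intro exI[of _ M]) (auto simp: Z_def)
    qed
    then obtain N where N: "\<And>n. n \<ge> N \<Longrightarrow> (F #> c) \<inter> A n = (F #> c) \<inter> Z" by blast
    obtain n where n: "n \<ge> N" "e n = c" using e(2)[OF c] by blast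
    have bs: "bdry K F #> c \<subseteq> F #> c" using bdry_subset[of K F] by (auto simp: r_coset_def)
    then have "(bdry K F #> c) \<inter> A n = (bdry K F #> c) \<inter> Z" using N[OF n(1)] by blast
    then have "D n = (F #> c) \<inter> Z"
      using neg N[OF n(1)] n(2) by (simp add: D_def thin_part_def)
    moreover have "D n \<inter> Z = {}"
      using AS[of n] by (auto simp: Z_def)
    ultimately have "(F #> c) \<inter> Z = {}" by blast
    moreover from this have "(bdry K F #> c) \<inter> Z = {}" using bs by blast
    ultimately show False using neg by simp
  qed
  moreover have "real (card ((bdry K F #> e n) \<inter> D n)) \<le> \<eta> * real (card (D n))" for n
  proof (cases "D n = {}")
    case False
    have bs: "bdry K F #> e n \<subseteq> F #> e n" using bdry_subset[of K F] by (auto simp: r_coset_def)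
    have "D n = (F #> e n) \<inter> A n"
      "real (card ((bdry K F #> e n) \<inter> A n)) \<le> \<eta> * real (card ((F #> e n) \<inter> A n))"
      using False by (auto simp: D_def thin_part_def split: if_splits)
    moreover from this(1) have "(bdry K F #> e n) \<inter> D n = (bdry K F #> e n) \<inter> A n" using bs by blast
    ultimately show ?thesis by simp
  qed simp
  moreover have "D m \<inter> D n = {}" if "m \<noteq> n" for m n
    using lsep[of m n] lsep[of n m] that by (cases "m < n") auto
  ultimately show thesis using e(1) DF sep by (intro that[of e D Z]) auto
qed

text \<open>Connectedness in the graph joining \<open>x\<close> to \<open>k x\<close> for \<open>k \<in> K\<close>, stated without paths.\<close>

definition K_connected :: "'a set \<Rightarrow> 'a set \<Rightarrow> bool" where
  "K_connected K I \<longleftrightarrow> I \<noteq> {} \<and> (\<forall>A B. I = A \<union> B \<and> A \<noteq> {} \<and> B \<noteq> {} \<longrightarrow> (K <#> A) \<inter> B \<noteq> {})"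

definition K_separated :: "'a set \<Rightarrow> 'a set set \<Rightarrow> bool" where
  "K_separated K P \<longleftrightarrow> (\<forall>I\<in>P. \<forall>J\<in>P. I \<noteq> J \<longrightarrow> (K <#> I) \<inter> J = {})"

lemma connected_pieces:
  assumes K: "K \<subseteq> carrier G" "\<forall>k\<in>K. inv k \<in> K" "\<one> \<in> K"
    and S: "finite S" "S \<subseteq> carrier G"
  shows "\<exists>P. \<Union>P = S \<and> K_separated K P \<and> (\<forall>I\<in>P. K_connected K I)"
  using S
proof (induction "card S" arbitrary: S rule: less_induct)
  case less
  consider "S = {}" | "K_connected K S" | A B where "S = A \<union> B" "A \<noteq> {}" "B \<noteq> {}" "(K <#> A) \<inter> B = {}"
    by (auto simp: K_connected_def)
  then show ?case
  proof cases
    case 1 then show ?thesis by (intro exI[of _ "{}"]) (simp add: K_separated_def)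
  next
    case 2 then show ?thesis by (intro exI[of _ "{S}"]) (simp add: K_separated_def)
  next
    case (3 A B)
    note AB4 = 3(4)
    have AB: "finite A" "finite B" "A \<subseteq> carrier G" "B \<subseteq> carrier G" using less.prems 3(1) by auto
    have "A \<inter> B = {}" using sep_disjoint[OF K(3) AB(3) 3(4)] .
    then have "A \<subset> S" "B \<subset> S" using 3 by auto
    then have "card A < card S" "card B < card S" using less.prems psubset_card_mono by blast+
    from less.hyps[OF this(1) AB(1,3)] less.hyps[OF this(2) AB(2,4)]
    obtain P Q where P: "\<Union>P = A" "K_separated K P" "\<forall>I\<in>P. K_connected K I"
      and Q: "\<Union>Q = B" "K_separated K Q" "\<forall>I\<in>Q. K_connected K I" by (elim exE conjE)
    have s: "(K <#> B) \<inter> A = {}" by (rule sep_commute[OF K(1,2) AB(3,4) 3(4)])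
    have "(K <#> I) \<inter> J = {}" if ij: "I \<in> P \<union> Q" "J \<in> P \<union> Q" "I \<noteq> J" for I J
    proof -
      consider "I \<in> P" "J \<in> P" | "I \<in> Q" "J \<in> Q" | "I \<in> P" "J \<in> Q" | "I \<in> Q" "J \<in> P"
        using ij(1,2) by (metis UnE)
      then show ?thesis
      proof cases
        case 1 then show ?thesis using P(2) ij(3) by (simp add: K_separated_def)
      next
        case 2 then show ?thesis using Q(2) ij(3) by (simp add: K_separated_def)
      next
        case 3
        show ?thesis by (rule sep_mono[OF AB4]) (use 3 P(1) Q(1) in blast)+
      next
        case 4
        show ?thesis by (rule sep_mono[OF s]) (use 4 P(1) Q(1) in blast)+
      qed
    qed
    then have "K_separated K (P \<union> Q)" by (simp add: K_separated_def)
    then show ?thesis using P Q 3(1) by (intro exI[of _ "P \<union> Q"]) auto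
  qed
qed

text \<open>A connected set cannot be split by the members of a separated family: if \<open>I\<close> meets \<open>J\<close> but is not contained in it, then
  \<open>K\<close> leads from \<open>I \<inter> J\<close> to a point of \<open>I - J\<close>, which lies in another member of the family of \<open>J\<close>.\<close>

lemma connected_family_subset:
  assumes K: "K \<subseteq> carrier G" "\<forall>k\<in>K. inv k \<in> K"
    and P: "K_separated K P" "\<forall>I\<in>P. K_connected K I"
    and Q: "K_separated K Q" "\<forall>I\<in>Q. K_connected K I"
    and U: "\<Union>P = \<Union>Q" "\<Union>P \<subseteq> carrier G"
  shows "P \<subseteq> Q"
proof -
  have step: "I \<subseteq> J" if "I \<in> P" "J \<in> Q" "I \<inter> J \<noteq> {}" and c: "K_connected K I"
    and sQ: "K_separated K Q" and U: "\<Union>P = \<Union>Q" for I J P Q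
  proof (rule ccontr)
    assume "\<not> I \<subseteq> J"
    then have "(K <#> (I \<inter> J)) \<inter> (I - J) \<noteq> {}"
      using c that(3) by (simp add: K_connected_def) (metis Diff_eq_empty_iff Int_Diff_Un)
    then obtain z where z: "z \<in> K <#> (I \<inter> J)" "z \<in> I - J" by blast
    then obtain k x where x: "k \<in> K" "x \<in> I \<inter> J" "z = k \<otimes> x" unfolding mem_set_mult by blast
    then have x3: "k \<otimes> x \<in> I - J" using z by simp
    then have "k \<otimes> x \<in> \<Union>P" using that(1) by blast
    then obtain J' where "J' \<in> Q" "k \<otimes> x \<in> J'" unfolding U by blast
    then have "(K <#> J) \<inter> J' \<noteq> {}" "J \<noteq> J'"
      using x x3 unfolding disjoint_iff mem_set_mult by blast+
    then show False using sQ \<open>J' \<in> Q\<close> that(2) by (auto simp: K_separated_def)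
  qed
  show ?thesis
  proof
    fix I assume I: "I \<in> P"
    then have "I \<noteq> {}" using P(2) by (simp add: K_connected_def)
    then obtain x where x: "x \<in> I" by blast
    then have "x \<in> \<Union>Q" unfolding U(1)[symmetric] using I by blast
    then obtain J where J: "J \<in> Q" "x \<in> J" by blast
    have ne: "I \<inter> J \<noteq> {}" "J \<inter> I \<noteq> {}" using x J(2) by auto
    have "I \<subseteq> J" by (rule step[OF I J(1) ne(1) bspec[OF P(2) I] Q(1) U(1)])
    moreover have "J \<subseteq> I" by (rule step[OF J(1) I ne(2) bspec[OF Q(2) J(1)] P(1) U(1)[symmetric]])
    ultimately show "I \<in> Q" using J(1) by simp
  qed
qed

text \<open>Such families are the families of connected components of their unions.\<close>

lemma connected_family_unique:
  assumes K: "K \<subseteq> carrier G" "\<forall>k\<in>K. inv k \<in> K"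
    and P: "K_separated K P" "\<forall>I\<in>P. K_connected K I"
    and Q: "K_separated K Q" "\<forall>I\<in>Q. K_connected K I"
    and U: "\<Union>P = \<Union>Q" "\<Union>P \<subseteq> carrier G"
  shows "P = Q"
  using connected_family_subset[OF K P Q U] connected_family_subset[OF K Q P] U by (metis subset_antisym)

lemma card_r_coset: "W \<subseteq> carrier G \<Longrightarrow> h \<in> carrier G \<Longrightarrow> card (W #> h) = card W"
proof -
  assume W: "W \<subseteq> carrier G" and h: "h \<in> carrier G"
  have "W #> h = (\<lambda>w. w \<otimes> h) ` W" by (auto simp: r_coset_def)
  moreover have "inj_on (\<lambda>w. w \<otimes> h) W"
    using W h by (intro inj_onI) (simp add: subset_iff)
  ultimately show ?thesis by (simp add: card_image)
qed

lemma r_coset_cancel: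
  assumes "W \<subseteq> carrier G" "h \<in> carrier G"
  shows "(W #> h) #> inv h = W" "(W #> inv h) #> h = W"
  using assms by (simp_all add: coset_mult_assoc)

lemma r_coset_carrier: "W \<subseteq> carrier G \<Longrightarrow> h \<in> carrier G \<Longrightarrow> W #> h \<subseteq> carrier G"
  by (rule r_coset_subset_G)

lemma r_coset_Diff:
  assumes "A \<subseteq> carrier G" "B \<subseteq> carrier G" "h \<in> carrier G"
  shows "(A - B) #> h = (A #> h) - (B #> h)"
  using assms by (auto simp: r_coset_def subset_iff)

lemma r_coset_Int:
  assumes "A \<subseteq> carrier G" "B \<subseteq> carrier G" "h \<in> carrier G"
  shows "(A \<inter> B) #> h = (A #> h) \<inter> (B #> h)"
  using assms by (auto simp: r_coset_def subset_iff)

lemma r_coset_Un: "(A \<union> B) #> h = (A #> h) \<union> (B #> h)"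
  by (auto simp: r_coset_def)

lemma r_coset_Union: "(\<Union>P) #> h = (\<Union>A\<in>P. A #> h)"
  by (auto simp: r_coset_def)

lemma r_coset_empty_iff: "A #> h = {} \<longleftrightarrow> A = {}"
  by (auto simp: r_coset_def)

lemma r_coset_mono: "A \<subseteq> B \<Longrightarrow> A #> h \<subseteq> B #> h"
  by (auto simp: r_coset_def)

text \<open>A separated family of large connected pieces which nearly exhausts every window that is nearly invariant under \<open>M\<close>. The
  condition concerns all windows, not those of one Folner sequence, which makes it invariant under right translations.\<close>

definition spread_family :: "'a set \<Rightarrow> nat \<Rightarrow> 'a set \<Rightarrow> real \<Rightarrow> real \<Rightarrow> 'a set set \<Rightarrow> bool" where
  "spread_family K M0 M \<tau> \<kappa> P \<longleftrightarrow>
     K_separated K P \<and> (\<forall>I\<in>P. K_connected K I \<and> finite I \<and> I \<subseteq> carrier G \<and> M0 \<le> card I) \<and>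
     (\<forall>W. finite W \<and> W \<subseteq> carrier G \<and> real (card ((M <#> W) - W)) \<le> \<tau> * real (card W) \<longrightarrow>
        real (card (W - \<Union>{I\<in>P. I \<subseteq> W})) \<le> \<kappa> * real (card W))"

lemma K_connected_r_coset:
  assumes "K \<subseteq> carrier G" "I \<subseteq> carrier G" "h \<in> carrier G" "K_connected K I"
  shows "K_connected K (I #> h)"
  unfolding K_connected_def
proof (intro conjI allI impI)
  show "I #> h \<noteq> {}" using assms(4) by (simp add: K_connected_def r_coset_empty_iff)
  fix A B assume AB: "I #> h = A \<union> B \<and> A \<noteq> {} \<and> B \<noteq> {}"
  have c: "A \<subseteq> carrier G" "B \<subseteq> carrier G" using AB r_coset_carrier[OF assms(2,3)] by auto
  have "I = (A #> inv h) \<union> (B #> inv h)"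
    using r_coset_cancel(1)[OF assms(2,3)] AB by (simp add: r_coset_Un)
  then have "(K <#> (A #> inv h)) \<inter> (B #> inv h) \<noteq> {}"
    using assms(4) AB by (simp add: K_connected_def r_coset_empty_iff)
  moreover have "(K <#> (A #> inv h)) \<inter> (B #> inv h) = ((K <#> A) \<inter> B) #> inv h"
    using assms c by (simp add: setmult_rcos_assoc r_coset_Int set_mult_closed)
  ultimately show "(K <#> A) \<inter> B \<noteq> {}" by (simp add: r_coset_empty_iff)
qed

lemma spread_family_r_coset:
  assumes K: "K \<subseteq> carrier G" and M: "M \<subseteq> carrier G" and h: "h \<in> carrier G"
    and P: "spread_family K M0 M \<tau> \<kappa> P"
  shows "spread_family K M0 M \<tau> \<kappa> ((\<lambda>I. I #> h) ` P)"
  unfolding spread_family_def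
proof (intro conjI ballI allI impI)
  have Pc: "I \<subseteq> carrier G" if "I \<in> P" for I using P that by (auto simp: spread_family_def)
  show "K_separated K ((\<lambda>I. I #> h) ` P)"
    unfolding K_separated_def
  proof (clarify)
    fix I J assume IJ: "I \<in> P" "J \<in> P" "I #> h \<noteq> J #> h"
    have "K_separated K P" using P by (simp add: spread_family_def)
    moreover have "I \<noteq> J" using IJ(3) by auto
    ultimately have "(K <#> I) \<inter> J = {}" using IJ(1,2) by (simp add: K_separated_def)
    moreover have "(K <#> (I #> h)) \<inter> (J #> h) = ((K <#> I) \<inter> J) #> h"
      using K Pc[OF IJ(1)] Pc[OF IJ(2)] h by (simp add: setmult_rcos_assoc r_coset_Int set_mult_closed)
    ultimately show "(K <#> (I #> h)) \<inter> (J #> h) = {}" by (simp add: r_coset_empty_iff)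
  qed
  fix I' assume "I' \<in> (\<lambda>I. I #> h) ` P"
  then obtain I where I: "I \<in> P" "I' = I #> h" by blast
  show "K_connected K I'" "finite I'" "I' \<subseteq> carrier G" "M0 \<le> card I'"
    using P I K_connected_r_coset[OF K Pc[OF I(1)] h] r_coset_carrier[OF Pc[OF I(1)] h]
      card_r_coset[OF Pc[OF I(1)] h] finite_r_coset by (auto simp: spread_family_def)
next
  have Pc: "I \<subseteq> carrier G" if "I \<in> P" for I using P that by (auto simp: spread_family_def)
  fix W assume W: "finite W \<and> W \<subseteq> carrier G \<and> real (card ((M <#> W) - W)) \<le> \<tau> * real (card W)"
  then have Wc: "W \<subseteq> carrier G" by simp
  have ih: "inv h \<in> carrier G" using h by simp
  let ?W = "W #> inv h"
  have "(M <#> ?W) - ?W = ((M <#> W) - W) #> inv h"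
    using M Wc h by (simp add: setmult_rcos_assoc r_coset_Diff set_mult_closed)
  then have "card ((M <#> ?W) - ?W) = card ((M <#> W) - W)"
    using card_r_coset[of "(M <#> W) - W" "inv h"] h set_mult_closed[OF M Wc] by auto
  moreover have cW: "card ?W = card W" by (rule card_r_coset[OF Wc ih])
  moreover have "finite ?W" using W by (auto intro: finite_r_coset)
  moreover have "?W \<subseteq> carrier G" by (rule r_coset_carrier[OF Wc ih])
  ultimately have le: "real (card (?W - \<Union>{I\<in>P. I \<subseteq> ?W})) \<le> \<kappa> * real (card W)"
    using P W unfolding spread_family_def by (elim conjE allE[of _ ?W]) simp
  have "I \<subseteq> ?W \<longleftrightarrow> I #> h \<subseteq> W" if "I \<in> P" for I
    using r_coset_mono[of I ?W h] r_coset_mono[of "I #> h" W "inv h"]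
      r_coset_cancel[OF Pc[OF that] h] r_coset_cancel[OF Wc h] by auto
  then have "{I' \<in> (\<lambda>I. I #> h) ` P. I' \<subseteq> W} = (\<lambda>I. I #> h) ` {I\<in>P. I \<subseteq> ?W}" by auto
  then have "\<Union>{I' \<in> (\<lambda>I. I #> h) ` P. I' \<subseteq> W} = (\<Union>{I\<in>P. I \<subseteq> ?W}) #> h"
    by (simp add: r_coset_Union)
  moreover have Uc: "\<Union>{I\<in>P. I \<subseteq> ?W} \<subseteq> carrier G" using Pc by auto
  ultimately have "W - \<Union>{I' \<in> (\<lambda>I. I #> h) ` P. I' \<subseteq> W} = (?W - \<Union>{I\<in>P. I \<subseteq> ?W}) #> h"
    using r_coset_Diff[OF r_coset_carrier[OF Wc ih] Uc h] r_coset_cancel(2)[OF Wc h] by simp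
  moreover have "card ((?W - \<Union>{I\<in>P. I \<subseteq> ?W}) #> h) = card (?W - \<Union>{I\<in>P. I \<subseteq> ?W})"
    by (rule card_r_coset[OF _ h]) (use r_coset_carrier[OF Wc ih] in auto)
  ultimately show "real (card (W - \<Union>{I' \<in> (\<lambda>I. I #> h) ` P. I' \<subseteq> W})) \<le> \<kappa> * real (card W)"
    using le by simp
qed

text \<open>A boundary point \<open>w\<close> is \<open>m\<^sup>-\<^sup>1 x\<close> for some \<open>x\<close> outside \<open>W\<close> that is reached from \<open>W\<close> by \<open>m\<close>.\<close>

lemma card_bdry_le:
  assumes M: "M \<subseteq> carrier G" "finite M" and W: "W \<subseteq> carrier G" "finite W"
  shows "card (bdry M W) \<le> card M * card ((M <#> W) - W)"
proof -
  have "bdry M W \<subseteq> (\<lambda>(m, x). inv m \<otimes> x) ` (M \<times> ((M <#> W) - W))"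
  proof
    fix w assume "w \<in> bdry M W"
    then obtain m where m: "w \<in> W" "m \<in> M" "m \<otimes> w \<notin> W" by (auto simp: bdry_def)
    then have "m \<in> carrier G" "w \<in> carrier G" using M W by auto
    then have "inv m \<otimes> (m \<otimes> w) = w" by (simp add: m_assoc[symmetric])
    moreover have "m \<otimes> w \<in> (M <#> W) - W" using m by (auto simp: set_mult_def)
    ultimately show "w \<in> (\<lambda>(m, x). inv m \<otimes> x) ` (M \<times> ((M <#> W) - W))"
      using m(2) by (intro image_eqI[of _ _ "(m, m \<otimes> w)"]) auto
  qed
  then have "card (bdry M W) \<le> card ((\<lambda>(m, x). inv m \<otimes> x) ` (M \<times> ((M <#> W) - W)))"
    using M W by (intro card_mono finite_imageI finite_cartesian_product finite_Diff finite_setmult) auto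
  also have "\<dots> \<le> card (M \<times> ((M <#> W) - W))"
    using M W by (intro card_image_le finite_cartesian_product finite_Diff finite_setmult) auto
  finally show ?thesis by (simp add: card_cartesian_product)
qed

lemma Folner_invariance:
  assumes F: "Folner_sequence G F" and M: "finite M" "M \<subseteq> carrier G" and \<tau>: "\<tau> > 0"
  shows "\<forall>\<^sub>F n in sequentially. real (card ((M <#> F n) - F n)) \<le> \<tau> * real (card (F n))"
proof -
  have "(\<lambda>n. \<Sum>g\<in>M. real (card (sym_diff (g <# F n) (F n))) / real (card (F n))) \<longlonglongrightarrow> (\<Sum>g\<in>M. 0)"
    using F M by (intro tendsto_sum) (auto simp: Folner_sequence_def)
  then have "\<forall>\<^sub>F n in sequentially. (\<Sum>g\<in>M. real (card (sym_diff (g <# F n) (F n))) / real (card (F n))) < \<tau>"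
    using \<tau> by (intro order_tendstoD(2)) auto
  then show ?thesis
  proof eventually_elim
    case (elim n)
    have fin: "finite (F n)" and pos: "card (F n) > 0"
      using F by (auto simp: Folner_sequence_def card_gt_0_iff)
    have f: "finite (g <# F n)" for g using fin by (auto simp: l_coset_def)
    have "(M <#> F n) - F n \<subseteq> (\<Union>g\<in>M. sym_diff (g <# F n) (F n))"
      by (auto simp: set_mult_def l_coset_def)
    then have "card ((M <#> F n) - F n) \<le> card (\<Union>g\<in>M. sym_diff (g <# F n) (F n))"
      using M fin f by (intro card_mono) auto
    also have "\<dots> \<le> (\<Sum>g\<in>M. card (sym_diff (g <# F n) (F n)))"
      by (rule card_UN_le[OF M(1)])
    finally have "real (card ((M <#> F n) - F n)) \<le> (\<Sum>g\<in>M. real (card (sym_diff (g <# F n) (F n))))"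
      by (simp only: of_nat_sum[symmetric] of_nat_le_iff)
    also have "\<dots> = (\<Sum>g\<in>M. real (card (sym_diff (g <# F n) (F n))) / real (card (F n))) * real (card (F n))"
      using pos by (simp add: sum_divide_distrib[symmetric])
    also have "\<dots> \<le> \<tau> * real (card (F n))" using elim by (intro mult_right_mono) auto
    finally show ?case .
  qed
qed

lemma Folner_thin:
  assumes F: "Folner_sequence G Fo" and K: "finite K" "K \<subseteq> carrier G" and \<eta>: "\<eta> > 0"
  shows "\<exists>F. finite F \<and> F \<noteq> {} \<and> F \<subseteq> carrier G \<and> real (card (bdry K F)) \<le> \<eta> * real (card F)"
proof -
  have pos: "\<eta> / (real (card K) + 1) > 0" using \<eta> by simp
  obtain n where n: "real (card ((K <#> Fo n) - Fo n)) \<le> \<eta> / (real (card K) + 1) * real (card (Fo n))"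
    using eventually_happens[OF Folner_invariance[OF F K pos]] by auto
  have Fn: "finite (Fo n)" "Fo n \<noteq> {}" "Fo n \<subseteq> carrier G" using F by (auto simp: Folner_sequence_def)
  have "real (card (bdry K (Fo n))) \<le> real (card K) * real (card ((K <#> Fo n) - Fo n))"
    using card_bdry_le[OF K(2,1) Fn(3,1)] by (simp only: of_nat_mult[symmetric] of_nat_le_iff)
  also have "\<dots> \<le> (real (card K) + 1) * (\<eta> / (real (card K) + 1) * real (card (Fo n)))"
    using n by (intro mult_mono) auto
  also have "\<dots> = \<eta> * real (card (Fo n))" by (simp add: field_simps)
  finally show ?thesis using Fn by blast
qed

lemma card_Un_le_real: "real (card (A \<union> B)) \<le> real (card A) + real (card B)"
  using card_Un_le[of A B] by linarith

text \<open>A set that no translate of \<open>F\<close> meets thinly is sparse. Summing the hypothesis over the translates that meet \<open>W\<close>, the left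
  side counts each point of \<open>Z \<inter> W\<close> with weight \<open>\<eta> |F|\<close> and the right side with weight at most \<open>\<eta> |F| / 2\<close>, up to the
  points that the translates have outside \<open>W\<close>.\<close>

lemma uncovered_small:
  assumes F: "F \<subseteq> carrier G" "finite F" "F \<noteq> {}" and \<eta>: "\<eta> > 0"
    and thin: "real (card (bdry K F)) \<le> \<eta> / 2 * real (card F)"
    and Z: "Z \<subseteq> carrier G"
      "\<And>c. c \<in> carrier G \<Longrightarrow> \<eta> * real (card ((F #> c) \<inter> Z)) \<le> real (card ((bdry K F #> c) \<inter> Z))"
    and W: "finite W" "W \<subseteq> carrier G" and M: "M = (\<lambda>(f, g). f \<otimes> inv g) ` (F \<times> F)"
  shows "real (card (Z \<inter> W)) \<le> 2 / \<eta> * real (card ((M <#> W) - W))"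
proof -
  define C where "C = (\<lambda>(f, w). inv f \<otimes> w) ` (F \<times> W)"
  have C: "finite C" "C \<subseteq> carrier G" using F W by (auto simp: C_def)
  have b: "bdry K F \<subseteq> carrier G" "finite (bdry K F)"
    using F bdry_subset[of K F] finite_subset by blast+
  define V where "V = (M <#> W) - W"
  have Mc: "M \<subseteq> carrier G" using F by (auto simp: M)
  have V: "finite V" "V \<subseteq> carrier G"
    using F W Mc set_mult_closed[OF Mc W(2)] by (auto simp: V_def M intro!: finite_setmult)
  have FC: "F #> c \<subseteq> V \<union> W" if c: "c \<in> C" for c
  proof
    fix x assume "x \<in> F #> c"
    then obtain f g w where x: "x = f \<otimes> (inv g \<otimes> w)" "f \<in> F" "g \<in> F" "w \<in> W"
      using c by (auto simp: C_def mem_r_coset)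
    then have "x = (f \<otimes> inv g) \<otimes> w" using F(1) W(2) by (simp add: m_assoc subset_iff)
    then have "x \<in> M <#> W" using x by (auto simp: M set_mult_def)
    then show "x \<in> V \<union> W" by (auto simp: V_def)
  qed
  have ZW: "Z \<inter> W \<subseteq> carrier G" "finite (Z \<inter> W)" using W by auto
  have cov: "inv f \<otimes> a \<in> C" if "a \<in> Z \<inter> W" "f \<in> F" for a f
    using that by (force simp: C_def)
  have eqF: "(\<Sum>c\<in>C. card ((F #> c) \<inter> (Z \<inter> W))) = card F * card (Z \<inter> W)"
    by (rule sum_card_translates_eq[OF F(1,2) ZW C cov])
  have "\<eta> * (real (card F) * real (card (Z \<inter> W))) = \<eta> * real (\<Sum>c\<in>C. card ((F #> c) \<inter> (Z \<inter> W)))"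
    unfolding eqF by simp
  also have "\<dots> = (\<Sum>c\<in>C. \<eta> * real (card ((F #> c) \<inter> (Z \<inter> W))))"
    by (simp add: sum_distrib_left)
  also have "\<dots> \<le> (\<Sum>c\<in>C. real (card ((bdry K F #> c) \<inter> (Z \<inter> W))) + real (card ((F #> c) \<inter> V)))"
  proof (rule sum_mono)
    fix c assume c: "c \<in> C"
    have cc: "c \<in> carrier G" using c C by auto
    have fF: "finite (F #> c)" by (rule finite_r_coset[OF F(2)])
    have bs: "bdry K F #> c \<subseteq> F #> c" by (rule r_coset_mono[OF bdry_subset])
    have "\<eta> * real (card ((F #> c) \<inter> (Z \<inter> W))) \<le> \<eta> * real (card ((F #> c) \<inter> Z))"
      using \<eta> fF by (intro mult_left_mono) (auto intro!: card_mono)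
    also have "\<dots> \<le> real (card ((bdry K F #> c) \<inter> Z))" by (rule Z(2)[OF cc])
    also have "\<dots> \<le> real (card ((bdry K F #> c) \<inter> (Z \<inter> W) \<union> (F #> c) \<inter> V))"
      using fF bs FC[OF c] W(1) by (intro of_nat_mono card_mono) auto
    also have "\<dots> \<le> real (card ((bdry K F #> c) \<inter> (Z \<inter> W))) + real (card ((F #> c) \<inter> V))"
      by (rule card_Un_le_real)
    finally show "\<eta> * real (card ((F #> c) \<inter> (Z \<inter> W))) \<le>
      real (card ((bdry K F #> c) \<inter> (Z \<inter> W))) + real (card ((F #> c) \<inter> V))" .
  qed
  also have "\<dots> = real (\<Sum>c\<in>C. card ((bdry K F #> c) \<inter> (Z \<inter> W))) + real (\<Sum>c\<in>C. card ((F #> c) \<inter> V))"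
    by (simp add: sum.distrib)
  also have "\<dots> \<le> real (card (bdry K F) * card (Z \<inter> W)) + real (card F * card V)"
    using sum_card_translates_le[OF b ZW C] sum_card_translates_le[OF F(1,2) V(2,1) C]
    by (intro add_mono of_nat_mono)
  also have "\<dots> \<le> \<eta> / 2 * real (card F) * real (card (Z \<inter> W)) + real (card F) * real (card V)"
    using mult_right_mono[OF thin, of "real (card (Z \<inter> W))"] by simp
  finally have "real (card F) * (\<eta> / 2 * real (card (Z \<inter> W))) \<le> real (card F) * real (card V)"
    by (simp add: algebra_simps)
  moreover have "real (card F) > 0" using F by (simp add: card_gt_0_iff)
  ultimately have "\<eta> / 2 * real (card (Z \<inter> W)) \<le> real (card V)" by simp
  then show ?thesis using \<eta> by (simp add: V_def field_simps)
qed

text \<open>Carve the group, take interiors of the carved cells, split them into connected pieces and discard the small pieces. What is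
  lost in a window consists of the remainder of the carving, the boundary layers of the cells, the pieces that stick out of the
  window and the small pieces. The latter are few since \<open>K\<close> is large: a point \<open>w\<close> of a small piece has at least half of
  \<open>K w\<close> in the complement of all pieces.\<close>

lemma exists_spread_family:
  assumes cnt: "countable (carrier G)" and Fo: "Folner_sequence G Fo"
    and K: "finite K" "K \<subseteq> carrier G" "\<forall>k\<in>K. inv k \<in> K" "\<one> \<in> K"
    and M0: "2 * M0 \<le> card K" and \<kappa>: "\<kappa> > 0"
  shows "\<exists>M \<tau> P. finite M \<and> M \<subseteq> carrier G \<and> \<tau> > 0 \<and> spread_family K M0 M \<tau> \<kappa> P"
proof -
  \<comment> \<open>three parts go to the complement of the pieces, which enters three times, and one to the invariance defect of the window\<close>
  define \<eta> where "\<eta> = \<kappa> / 4"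
  have \<eta>: "\<eta> > 0" using \<kappa> by (simp add: \<eta>_def)
  obtain F where F: "finite F" "F \<noteq> {}" "F \<subseteq> carrier G"
    and thin: "real (card (bdry K F)) \<le> \<eta> / 2 * real (card F)"
    using Folner_thin[OF Fo K(1,2), of "\<eta> / 2"] \<eta> by auto
  show ?thesis
  proof (rule infinite_carving[OF cnt K(2-4) F(3,1), of \<eta>])
    fix D :: "nat \<Rightarrow> 'a set" and e :: "nat \<Rightarrow> 'a" and Z
    assume e: "range e \<subseteq> carrier G" and DF: "\<And>n. D n \<subseteq> F #> e n"
      and disj: "\<And>m n. m \<noteq> n \<Longrightarrow> D m \<inter> D n = {}"
      and Db: "\<And>n. real (card ((bdry K F #> e n) \<inter> D n)) \<le> \<eta> * real (card (D n))"
      and Dsep: "\<And>m n. m \<noteq> n \<Longrightarrow> (K <#> (D m - (bdry K F #> e m))) \<inter> (D n - (bdry K F #> e n)) = {}"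
      and U: "carrier G = Z \<union> (\<Union>n. D n)"
      and Z: "\<And>c. c \<in> carrier G \<Longrightarrow> \<eta> * real (card ((F #> c) \<inter> Z)) \<le> real (card ((bdry K F #> c) \<inter> Z))"
  define I where "I n = D n - (bdry K F #> e n)" for n
  have ec: "e n \<in> carrier G" for n using e by auto
  have DG: "D n \<subseteq> carrier G" for n by (subst U) blast
  have Dfin: "finite (D n)" for n by (rule finite_subset[OF DF finite_r_coset[OF F(1)]])
  have "\<forall>n. \<exists>Q. \<Union>Q = I n \<and> K_separated K Q \<and> (\<forall>J\<in>Q. K_connected K J)"
  proof
    fix n
    have "finite (I n)" "I n \<subseteq> carrier G" using Dfin[of n] DG[of n] unfolding I_def by blast+
    then show "\<exists>Q. \<Union>Q = I n \<and> K_separated K Q \<and> (\<forall>J\<in>Q. K_connected K J)"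
      by (rule connected_pieces[OF K(2-4)])
  qed
  then obtain Q where Q: "\<And>n. \<Union>(Q n) = I n" "\<And>n. K_separated K (Q n)"
    "\<And>n J. J \<in> Q n \<Longrightarrow> K_connected K J" by metis
  define A where "A = (\<Union>n. Q n)"
  define R where "R = carrier G - \<Union>A"
  define P where "P = {J\<in>A. M0 \<le> card J}"
  have "\<Union>A = (\<Union>n. \<Union>(Q n))" unfolding A_def by blast
  then have UA: "\<Union>A = (\<Union>n. I n)" unfolding Q(1) .
  have AI: "\<exists>n. J \<in> Q n \<and> J \<subseteq> I n" if "J \<in> A" for J using that Q(1) by (auto simp: A_def)
  have AF: "\<exists>n. J \<subseteq> F #> e n" if "J \<in> A" for J using AI[OF that] DF by (force simp: I_def)
  have Ac: "J \<subseteq> carrier G" "finite J" if "J \<in> A" for J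
    using AI[OF that] Dfin DG by (auto simp: I_def dest: finite_subset intro: finite_subset)
  have Asep: "K_separated K A"
    unfolding K_separated_def
  proof (intro ballI impI)
    fix J J' assume J: "J \<in> A" "J' \<in> A" "J \<noteq> J'"
    obtain n n' where n: "J \<in> Q n" "J \<subseteq> I n" "J' \<in> Q n'" "J' \<subseteq> I n'" using AI[OF J(1)] AI[OF J(2)] by blast
    show "(K <#> J) \<inter> J' = {}"
    proof (cases "n = n'")
      case True then show ?thesis using n Q(2)[of n] J(3) by (auto simp: K_separated_def)
    next
      case False
      show ?thesis by (rule sep_mono[OF Dsep[OF False]]) (use n in \<open>auto simp: I_def\<close>)
    qed
  qed
  define M1 where "M1 = (\<lambda>(f, g). f \<otimes> inv g) ` (F \<times> F)"
  define M where "M = M1 \<union> K"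
  have M1: "finite M1" "M1 \<subseteq> carrier G" using F by (auto simp: M1_def)
  have M: "finite M" "M \<subseteq> carrier G" using M1 K by (auto simp: M_def)
  \<comment> \<open>collects all terms proportional to the invariance defect \<open>card V\<close> of the window\<close>
  define c where "c = 4 * real (card M) + 6 / \<eta> + 2"
  have c: "c > 0" using \<eta> by (auto simp: c_def intro!: add_nonneg_pos)
  have "spread_family K M0 M (\<eta> / c) \<kappa> P"
    unfolding spread_family_def
  proof (intro conjI ballI allI impI)
    show "K_separated K P" using Asep by (auto simp: P_def K_separated_def)
    fix J assume "J \<in> P"
    then show "K_connected K J" "finite J" "J \<subseteq> carrier G" "M0 \<le> card J"
      using Q(3) Ac by (auto simp: P_def A_def)
  next
    fix W assume "finite W \<and> W \<subseteq> carrier G \<and> real (card ((M <#> W) - W)) \<le> \<eta> / c * real (card W)"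
    then have W: "finite W" "W \<subseteq> carrier G"
      and inv: "real (card ((M <#> W) - W)) \<le> \<eta> / c * real (card W)" by auto
    define V where "V = (M <#> W) - W"
    have Vf: "finite V" using M W by (auto simp: V_def intro!: finite_setmult)
    have sub: "card ((M' <#> W) - W) \<le> card V" if "M' \<subseteq> M" for M'
      using that by (intro card_mono[OF Vf]) (auto simp: V_def set_mult_def)
    have bW: "real (card (bdry M W)) \<le> real (card M) * real (card V)"
      using card_bdry_le[OF M(2,1) W(2,1)] by (simp only: V_def of_nat_mult[symmetric] of_nat_le_iff)
    have bWf: "finite (bdry M W)" using W(1) bdry_subset finite_subset by blast
    have inside: "J \<subseteq> W" if J: "J \<subseteq> F #> e n" "w \<in> J" "w \<in> W" "w \<notin> bdry M W" for J n w
    proof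
      fix x assume "x \<in> J"
      then obtain f g where fg: "f \<in> F" "g \<in> F" "x = f \<otimes> e n" "w = g \<otimes> e n"
        using J by (auto simp: mem_r_coset subset_iff) (metis)
      then have c: "f \<in> carrier G" "g \<in> carrier G" using F by auto
      have "x = (f \<otimes> inv g) \<otimes> w" using fg c ec[of n]
        by (simp add: m_assoc) (simp add: m_assoc[symmetric])
      moreover have "f \<otimes> inv g \<in> M" using fg by (auto simp: M_def M1_def)
      ultimately show "x \<in> W" using J by (auto simp: bdry_def)
    qed
    \<comment> \<open>a cell that meets \<open>W\<close> outside \<open>bdry M W\<close> lies inside \<open>W\<close>, so only such cells have to be summed\<close>
    have layer: "real (card (W \<inter> (\<Union>n. D n - I n))) \<le> \<eta> * real (card W) + real (card (bdry M W))"
    proof -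
      define N where "N = {n. D n \<noteq> {} \<and> D n \<subseteq> W}"
      have Nf: "finite N"
      proof (rule inj_on_finite[of D N "Pow W"])
        show "inj_on D N"
        proof (rule inj_onI, rule ccontr)
          fix m n assume "m \<in> N" "n \<in> N" "D m = D n" "m \<noteq> n"
          then show False using disj[of m n] by (simp add: N_def)
        qed
      qed (use W in \<open>auto simp: N_def\<close>)
      have "W \<inter> (\<Union>n. D n - I n) \<subseteq> (\<Union>n\<in>N. (bdry K F #> e n) \<inter> D n) \<union> bdry M W"
      proof
        fix w assume "w \<in> W \<inter> (\<Union>n. D n - I n)"
        then obtain n where n: "w \<in> W" "w \<in> D n" "w \<in> bdry K F #> e n" by (auto simp: I_def)
        show "w \<in> (\<Union>n\<in>N. (bdry K F #> e n) \<inter> D n) \<union> bdry M W"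
        proof (cases "w \<in> bdry M W")
          case False
          then have "D n \<subseteq> W" using inside[OF DF n(2,1)] by simp
          then have "n \<in> N" using n(2) by (auto simp: N_def)
          then show ?thesis using n by blast
        qed simp
      qed
      then have "card (W \<inter> (\<Union>n. D n - I n)) \<le> card ((\<Union>n\<in>N. (bdry K F #> e n) \<inter> D n) \<union> bdry M W)"
        using Nf Dfin bWf by (intro card_mono) auto
      then have "real (card (W \<inter> (\<Union>n. D n - I n))) \<le> real (card (\<Union>n\<in>N. (bdry K F #> e n) \<inter> D n)) + real (card (bdry M W))"
        using card_Un_le_real[of "\<Union>n\<in>N. (bdry K F #> e n) \<inter> D n" "bdry M W"] by linarith
      moreover have "real (card (\<Union>n\<in>N. (bdry K F #> e n) \<inter> D n)) \<le> (\<Sum>n\<in>N. real (card ((bdry K F #> e n) \<inter> D n)))"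
        using card_UN_le[OF Nf, of "\<lambda>n. (bdry K F #> e n) \<inter> D n"] by (simp only: of_nat_sum[symmetric] of_nat_le_iff)
      moreover have "\<dots> \<le> (\<Sum>n\<in>N. \<eta> * real (card (D n)))" by (intro sum_mono Db)
      moreover have "\<dots> = \<eta> * real (card (\<Union>n\<in>N. D n))"
        using Nf Dfin disj by (subst card_UN_disjoint) (auto simp: sum_distrib_left)
      moreover have "\<dots> \<le> \<eta> * real (card W)"
        using W(1) \<eta> by (intro mult_left_mono of_nat_mono card_mono) (auto simp: N_def)
      ultimately show ?thesis by linarith
    qed
    have RW: "real (card (R \<inter> W)) \<le> \<eta> * real (card W) + real (card (bdry M W)) + 2 / \<eta> * real (card V)"
    proof -
      have "R \<inter> W \<subseteq> W \<inter> (\<Union>n. D n - I n) \<union> Z \<inter> W"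
      proof
        fix x assume x: "x \<in> R \<inter> W"
        then have "x \<in> carrier G" "x \<notin> (\<Union>n. I n)" using UA by (auto simp: R_def)
        then show "x \<in> W \<inter> (\<Union>n. D n - I n) \<union> Z \<inter> W" using x unfolding U by blast
      qed
      then have "card (R \<inter> W) \<le> card (W \<inter> (\<Union>n. D n - I n) \<union> Z \<inter> W)"
        using W(1) by (intro card_mono) auto
      then have "real (card (R \<inter> W)) \<le> real (card (W \<inter> (\<Union>n. D n - I n))) + real (card (Z \<inter> W))"
        using card_Un_le_real[of "W \<inter> (\<Union>n. D n - I n)" "Z \<inter> W"] by linarith
      moreover have "real (card (Z \<inter> W)) \<le> 2 / \<eta> * real (card ((M1 <#> W) - W))"
        using U by (intro uncovered_small[OF F(3,1,2) \<eta> thin _ Z W M1_def]) auto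
      moreover have "2 / \<eta> * real (card ((M1 <#> W) - W)) \<le> 2 / \<eta> * real (card V)"
        using \<eta> sub[of M1] by (intro mult_left_mono) (auto simp: M_def)
      ultimately show ?thesis using layer by linarith
    qed
    \<comment> \<open>points of discarded pieces, each with many neighbours in the complement \<open>R\<close> of all pieces\<close>
    define L where "L = {w\<in>W. \<exists>J\<in>A. w \<in> J \<and> card J < M0}"
    have Lf: "finite L" "L \<subseteq> carrier G" using W by (auto simp: L_def)
    define R' where "R' = R \<inter> (K <#> W)"
    have R': "finite R'" "R' \<subseteq> carrier G"
      using K W by (auto simp: R'_def R_def intro!: finite_Int finite_setmult)
    have K0: "card K > 0" using K(1,4) by (auto simp: card_gt_0_iff)
    have Lsmall: "real (card L) \<le> 2 * real (card R')"
    proof -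
      have "card K \<le> 2 * card ((K #> w) \<inter> R')" if "w \<in> L" for w
      proof -
        from that obtain J where J: "w \<in> W" "J \<in> A" "w \<in> J" "card J < M0" by (auto simp: L_def)
        have wc: "w \<in> carrier G" using J(1) W by auto
        have "(K #> w) - J \<subseteq> (K #> w) \<inter> R'"
        proof
          fix x assume x: "x \<in> (K #> w) - J"
          then obtain k where k: "k \<in> K" "x = k \<otimes> w" by (auto simp: mem_r_coset)
          then have "x \<in> K <#> J" using J by (auto simp: mem_set_mult)
          then have "x \<notin> \<Union>A" using Asep J(2) x by (auto simp: K_separated_def)
          moreover have "x \<in> carrier G" using k wc K by auto
          moreover have "x \<in> K <#> W" using k J by (auto simp: mem_set_mult)
          ultimately show "x \<in> (K #> w) \<inter> R'" using x by (auto simp: R'_def R_def)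
        qed
        then have "card ((K #> w) - J) \<le> card ((K #> w) \<inter> R')"
          using R' by (intro card_mono) auto
        moreover have "card (K #> w) - card J \<le> card ((K #> w) - J)"
          by (rule diff_card_le_card_Diff[OF Ac(2)[OF J(2)]])
        ultimately show ?thesis using card_r_coset[OF K(2) wc] J(4) M0 by linarith
      qed
      then have "(\<Sum>w\<in>L. card K) \<le> (\<Sum>w\<in>L. 2 * card ((K #> w) \<inter> R'))" by (rule sum_mono)
      also have "\<dots> = 2 * (\<Sum>w\<in>L. card ((K #> w) \<inter> R'))" by (simp add: sum_distrib_left)
      also have "\<dots> \<le> 2 * (card K * card R')"
        using sum_card_translates_le[OF K(2,1) R'(2,1) Lf] by simp
      finally have "card K * card L \<le> card K * (2 * card R')" by (simp add: mult.commute mult.left_commute)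
      then have "card L \<le> 2 * card R'" using K0 by simp
      then show ?thesis by linarith
    qed
    have R'le: "real (card R') \<le> real (card (R \<inter> W)) + real (card V)"
    proof -
      have "R' \<subseteq> (R \<inter> W) \<union> ((K <#> W) - W)" by (auto simp: R'_def)
      then have "card R' \<le> card ((R \<inter> W) \<union> ((K <#> W) - W))"
        using W K by (intro card_mono) (auto intro!: finite_setmult)
      then show ?thesis
        using card_Un_le_real[of "R \<inter> W" "(K <#> W) - W"] sub[of K] by (auto simp: M_def)
    qed
    have "W - \<Union>{J\<in>P. J \<subseteq> W} \<subseteq> (R \<inter> W) \<union> L \<union> bdry M W"
    proof
      fix w assume w: "w \<in> W - \<Union>{J\<in>P. J \<subseteq> W}"
      show "w \<in> (R \<inter> W) \<union> L \<union> bdry M W"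
      proof (rule ccontr)
        assume n: "w \<notin> (R \<inter> W) \<union> L \<union> bdry M W"
        then obtain J where J: "J \<in> A" "w \<in> J" using w W by (auto simp: R_def)
        then have "M0 \<le> card J" using n w by (auto simp: L_def)
        then have "J \<in> P" using J by (simp add: P_def)
        moreover obtain i where "J \<subseteq> F #> e i" using AF[OF J(1)] by blast
        then have "J \<subseteq> W" using inside J(2) w n by blast
        ultimately show False using w J by blast
      qed
    qed
    then have "card (W - \<Union>{J\<in>P. J \<subseteq> W}) \<le> card ((R \<inter> W) \<union> L \<union> bdry M W)"
      using W Lf bWf by (intro card_mono) auto
    then have "real (card (W - \<Union>{J\<in>P. J \<subseteq> W})) \<le> real (card (R \<inter> W)) + real (card L) + real (card (bdry M W))"
      using card_Un_le_real[of "(R \<inter> W) \<union> L" "bdry M W"] card_Un_le_real[of "R \<inter> W" L] by linarith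
    also have "\<dots> \<le> 3 * \<eta> * real (card W) + 4 * real (card (bdry M W)) + (6 / \<eta> + 2) * real (card V)"
    proof -
      have "(6 / \<eta> + 2) * real (card V) = 3 * (2 / \<eta> * real (card V)) + 2 * real (card V)"
        by (simp add: algebra_simps)
      then show ?thesis using RW R'le Lsmall by linarith
    qed
    also have "\<dots> \<le> 3 * \<eta> * real (card W) + c * real (card V)"
      using bW by (simp add: c_def algebra_simps)
    also have "c * real (card V) \<le> c * (\<eta> / c * real (card W))"
      using inv c by (intro mult_left_mono) (auto simp: V_def)
    also have "c * (\<eta> / c * real (card W)) = \<eta> * real (card W)" using c by simp
    finally show "real (card (W - \<Union>{J\<in>P. J \<subseteq> W})) \<le> \<kappa> * real (card W)"
      by (simp add: \<eta>_def algebra_simps)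
  qed
  moreover have "\<eta> / c > 0" using \<eta> c by simp
  ultimately show ?thesis using M by blast
  qed
qed

end

section \<open>Entropy of finitely valued maps\<close>

text \<open>Entropy of the partition into the fibres of \<open>f\<close>; the values of \<open>f\<close> serve only to name the fibres.\<close>

definition fent :: "'x measure \<Rightarrow> ('x \<Rightarrow> 'v) \<Rightarrow> real" where
  "fent M f = partition_entropy M (range (\<lambda>x. f -` {f x}))"

definition finite_valued :: "'x measure \<Rightarrow> ('x \<Rightarrow> 'v) \<Rightarrow> bool" where
  "finite_valued M f \<longleftrightarrow> finite (range f) \<and> (\<forall>v. f -` {v} \<in> sets M)"

text \<open>The \<open>J\<close>-name of \<open>x\<close>. It is restricted to \<open>J\<close>, so that equal names mean equal values exactly on \<open>J\<close>.\<close>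

definition names :: "('i \<Rightarrow> 'x \<Rightarrow> 'v) \<Rightarrow> 'i set \<Rightarrow> 'x \<Rightarrow> 'i \<Rightarrow> 'v" where
  "names X J x = restrict (\<lambda>i. X i x) J"

lemma names_eq_iff: "names X J x = names X J y \<longleftrightarrow> (\<forall>i\<in>J. X i x = X i y)"
  by (auto simp: names_def restrict_def fun_eq_iff)

lemma fent_cong_kernel:
  assumes "\<And>x y. f x = f y \<longleftrightarrow> g x = g y"
  shows "fent M f = fent M g"
proof -
  have "f -` {f x} = g -` {g x}" for x using assms by auto
  then show ?thesis by (simp add: fent_def)
qed

lemma fent_sum:
  assumes "finite S" "range f \<subseteq> S"
  shows "fent M f = - (\<Sum>v\<in>S. measure M (f -` {v}) * ln (measure M (f -` {v})))"
proof -
  have "range (\<lambda>x. f -` {f x}) = (\<lambda>v. f -` {v}) ` range f" by auto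
  moreover have "inj_on (\<lambda>v. f -` {v}) (range f)" by (auto simp: inj_on_def)
  ultimately have "fent M f = - (\<Sum>v\<in>range f. measure M (f -` {v}) * ln (measure M (f -` {v})))"
    by (simp add: fent_def partition_entropy_def sum.reindex)
  also have "(\<Sum>v\<in>range f. measure M (f -` {v}) * ln (measure M (f -` {v}))) =
      (\<Sum>v\<in>S. measure M (f -` {v}) * ln (measure M (f -` {v})))"
  proof (rule sum.mono_neutral_left[OF assms], rule ballI)
    fix v assume "v \<in> S - range f"
    then have "f -` {v} = {}" by auto
    then show "measure M (f -` {v}) * ln (measure M (f -` {v})) = 0" by simp
  qed
  finally show ?thesis .
qed

lemma finite_valued_pair:
  assumes "finite_valued M f" "finite_valued M g"
  shows "finite_valued M (\<lambda>x. (f x, g x))"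
proof -
  have "range (\<lambda>x. (f x, g x)) \<subseteq> range f \<times> range g" by auto
  then have "finite (range (\<lambda>x. (f x, g x)))"
    by (rule finite_subset) (use assms in \<open>simp add: finite_valued_def\<close>)
  moreover have "(\<lambda>x. (f x, g x)) -` {v} = f -` {fst v} \<inter> g -` {snd v}" for v by (cases v) auto
  ultimately show ?thesis using assms by (auto simp: finite_valued_def)
qed

lemma finite_valued_names:
  assumes "finite J" "\<And>i. i \<in> J \<Longrightarrow> finite_valued M (X i)" "space M = UNIV"
  shows "finite_valued M (names X J)"
proof -
  have "range (names X J) \<subseteq> PiE J (\<lambda>i. range (X i))" by (auto simp: names_def)
  moreover have "finite (PiE J (\<lambda>i. range (X i)))"
    using assms by (intro finite_PiE) (auto simp: finite_valued_def)
  ultimately have "finite (range (names X J))" by (rule finite_subset)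
  moreover have "names X J -` {v} \<in> sets M" for v
  proof (cases "v \<in> extensional J")
    case False
    then have "names X J -` {v} = {}" by (auto simp: names_def)
    then show ?thesis by simp
  next
    case True
    then have "names X J -` {v} = (\<Inter>i\<in>J. X i -` {v i}) \<inter> space M"
      using assms(3) by (fastforce simp: names_def extensionalityI[of _ J] intro!: extensionalityI[of _ J])
    also have "\<dots> \<in> sets M"
    proof (cases "J = {}")
      case False
      then have "(\<Inter>i\<in>J. X i -` {v i}) \<in> sets M"
        using assms by (intro sets.finite_INT) (auto simp: finite_valued_def)
      then show ?thesis by (simp add: sets.Int_space_eq2)
    qed simp
    finally show ?thesis .
  qed
  ultimately show ?thesis by (simp add: finite_valued_def)
qed

text \<open>Strong subadditivity of Shannon entropy for a weight \<open>q\<close> with marginals \<open>a\<close>, \<open>b\<close>, \<open>c\<close>: apply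
  \<open>ln t \<le> t - 1\<close> to \<open>t = a b / (q c)\<close> and sum with weights \<open>q\<close>.\<close>

lemma finite_submodularity:
  fixes q :: "'u \<Rightarrow> 'v \<Rightarrow> 'w \<Rightarrow> real"
  assumes fin: "finite U" "finite V" "finite W"
    and q: "\<And>u v w. q u v w \<ge> 0"
  defines "a \<equiv> \<lambda>u w. \<Sum>v\<in>V. q u v w" and "b \<equiv> \<lambda>v w. \<Sum>u\<in>U. q u v w"
    and "c \<equiv> \<lambda>w. \<Sum>u\<in>U. \<Sum>v\<in>V. q u v w"
  shows "(\<Sum>w\<in>W. \<Sum>u\<in>U. a u w * ln (a u w)) + (\<Sum>w\<in>W. \<Sum>v\<in>V. b v w * ln (b v w)) \<le>
     (\<Sum>w\<in>W. \<Sum>u\<in>U. \<Sum>v\<in>V. q u v w * ln (q u v w)) + (\<Sum>w\<in>W. c w * ln (c w))"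
proof -
  have "(\<Sum>u\<in>U. a u w * ln (a u w)) + (\<Sum>v\<in>V. b v w * ln (b v w)) \<le>
     (\<Sum>u\<in>U. \<Sum>v\<in>V. q u v w * ln (q u v w)) + c w * ln (c w)" if "w \<in> W" for w
  proof -
    have ca: "c w = (\<Sum>u\<in>U. a u w)" by (simp add: c_def a_def)
    have cb: "c w = (\<Sum>v\<in>V. b v w)" unfolding c_def b_def by (rule sum.swap)
    have a0: "a u w \<ge> 0" for u by (auto simp: a_def q intro: sum_nonneg)
    have b0: "b v w \<ge> 0" for v by (auto simp: b_def q intro: sum_nonneg)
    have c0: "c w \<ge> 0" by (auto simp: ca a0 intro: sum_nonneg)
    have tm: "q u v w * (ln (a u w) + ln (b v w) - ln (q u v w) - ln (c w)) \<le> a u w * b v w / c w - q u v w"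
      if uv: "u \<in> U" "v \<in> V" for u v
    proof (cases "q u v w = 0")
      case True then show ?thesis using a0[of u] b0[of v] c0 by simp
    next
      case False
      then have qp: "q u v w > 0" using q[of u v w] by simp
      have "q u v w \<le> a u w" unfolding a_def using fin(2) uv q by (intro member_le_sum) auto
      then have ap: "a u w > 0" using qp by simp
      have "q u v w \<le> b v w" unfolding b_def using fin(1) uv q by (intro member_le_sum[of u U "\<lambda>u. q u v w"]) auto
      then have bp: "b v w > 0" using qp by simp
      have "a u w \<le> c w" unfolding ca using fin(1) uv a0 by (intro member_le_sum[of u U "\<lambda>u. a u w"]) auto
      then have cp: "c w > 0" using ap by simp
      have "ln (a u w) + ln (b v w) - ln (q u v w) - ln (c w) = ln (a u w * b v w / (q u v w * c w))"
        using ap bp cp qp by (simp add: ln_mult ln_div)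
      also have "\<dots> \<le> a u w * b v w / (q u v w * c w) - 1"
        using ap bp cp qp by (intro ln_le_minus_one) simp
      finally have "q u v w * (ln (a u w) + ln (b v w) - ln (q u v w) - ln (c w)) \<le>
          q u v w * (a u w * b v w / (q u v w * c w) - 1)" using qp by (intro mult_left_mono) auto
      also have "\<dots> = a u w * b v w / c w - q u v w" using qp by (simp add: algebra_simps)
      finally show ?thesis .
    qed
    have "(\<Sum>u\<in>U. \<Sum>v\<in>V. q u v w * (ln (a u w) + ln (b v w) - ln (q u v w) - ln (c w))) \<le>
       (\<Sum>u\<in>U. \<Sum>v\<in>V. a u w * b v w / c w - q u v w)"
      by (intro sum_mono tm)
    also have "\<dots> = (\<Sum>u\<in>U. \<Sum>v\<in>V. a u w * b v w / c w) - c w"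
      by (simp add: c_def sum_subtractf)
    also have "(\<Sum>u\<in>U. \<Sum>v\<in>V. a u w * b v w / c w) = (\<Sum>u\<in>U. a u w) * (\<Sum>v\<in>V. b v w) / c w"
      by (simp add: sum_product sum_divide_distrib)
    also have "\<dots> = c w" unfolding ca[symmetric] cb[symmetric] by simp
    finally have le: "(\<Sum>u\<in>U. \<Sum>v\<in>V. q u v w * (ln (a u w) + ln (b v w) - ln (q u v w) - ln (c w))) \<le> 0" by simp
    have e1: "(\<Sum>u\<in>U. \<Sum>v\<in>V. q u v w * ln (a u w)) = (\<Sum>u\<in>U. a u w * ln (a u w))"
      by (simp add: a_def sum_distrib_right)
    have e2: "(\<Sum>u\<in>U. \<Sum>v\<in>V. q u v w * ln (b v w)) = (\<Sum>v\<in>V. b v w * ln (b v w))"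
      by (subst sum.swap) (simp add: b_def sum_distrib_right)
    have e3: "(\<Sum>u\<in>U. \<Sum>v\<in>V. q u v w * ln (c w)) = c w * ln (c w)"
      by (simp add: c_def sum_distrib_right)
    have "(\<Sum>u\<in>U. \<Sum>v\<in>V. q u v w * (ln (a u w) + ln (b v w) - ln (q u v w) - ln (c w))) =
        (\<Sum>u\<in>U. \<Sum>v\<in>V. q u v w * ln (a u w)) + (\<Sum>u\<in>U. \<Sum>v\<in>V. q u v w * ln (b v w))
        - (\<Sum>u\<in>U. \<Sum>v\<in>V. q u v w * ln (q u v w)) - (\<Sum>u\<in>U. \<Sum>v\<in>V. q u v w * ln (c w))"
      by (simp only: right_diff_distrib distrib_left sum.distrib sum_subtractf)
    then show ?thesis using le unfolding e1 e2 e3 by linarith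
  qed
  then have "(\<Sum>w\<in>W. (\<Sum>u\<in>U. a u w * ln (a u w)) + (\<Sum>v\<in>V. b v w * ln (b v w))) \<le>
     (\<Sum>w\<in>W. (\<Sum>u\<in>U. \<Sum>v\<in>V. q u v w * ln (q u v w)) + c w * ln (c w))"
    by (rule sum_mono)
  then show ?thesis by (simp add: sum.distrib)
qed

context prob_space begin

lemma sum_fibres:
  assumes "finite_valued M g" "finite S" "range g \<subseteq> S" "A \<in> events"
  shows "(\<Sum>w\<in>S. prob (A \<inter> g -` {w})) = prob A"
proof -
  have "(\<Sum>w\<in>S. prob (A \<inter> g -` {w})) = prob (\<Union>w\<in>S. A \<inter> g -` {w})"
    using assms by (intro finite_measure_finite_Union[symmetric]) (auto simp: finite_valued_def disjoint_family_on_def)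
  also have "(\<Union>w\<in>S. A \<inter> g -` {w}) = A" using assms(3) by auto
  finally show ?thesis .
qed

lemma fent_submodular:
  assumes sp: "space M = UNIV" and f: "finite_valued M f" and g: "finite_valued M g" and h: "finite_valued M h"
  shows "fent M (\<lambda>x. (f x, g x, h x)) + fent M h \<le> fent M (\<lambda>x. (f x, h x)) + fent M (\<lambda>x. (g x, h x))"
proof -
  let ?U = "range f" and ?V = "range g" and ?W = "range h"
  have fin: "finite ?U" "finite ?V" "finite ?W" using f g h by (auto simp: finite_valued_def)
  define q where "q u v w = prob (f -` {u} \<inter> g -` {v} \<inter> h -` {w})" for u v w
  have ev: "f -` {u} \<in> events" "g -` {v} \<in> events" "h -` {w} \<in> events" for u v w
    using f g h by (auto simp: finite_valued_def)
  have a: "(\<Sum>v\<in>?V. q u v w) = prob (f -` {u} \<inter> h -` {w})" for u w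
    using sum_fibres[OF g fin(2), of "f -` {u} \<inter> h -` {w}"] ev by (simp add: q_def Int_ac)
  have b: "(\<Sum>u\<in>?U. q u v w) = prob (g -` {v} \<inter> h -` {w})" for v w
    using sum_fibres[OF f fin(1), of "g -` {v} \<inter> h -` {w}"] ev by (simp add: q_def Int_ac)
  have c: "(\<Sum>u\<in>?U. prob (f -` {u} \<inter> h -` {w})) = prob (h -` {w})" for w
    using sum_fibres[OF f fin(1), of "h -` {w}"] ev by (simp add: Int_ac)
  have 1: "fent M (\<lambda>x. (f x, g x, h x)) = - (\<Sum>w\<in>?W. \<Sum>u\<in>?U. \<Sum>v\<in>?V. q u v w * ln (q u v w))"
  proof -
    have fib: "(\<lambda>x. (f x, g x, h x)) -` {z} = f -` {fst z} \<inter> g -` {fst (snd z)} \<inter> h -` {snd (snd z)}" for z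
      by (cases z) auto
    have "fent M (\<lambda>x. (f x, g x, h x)) = - (\<Sum>z\<in>?U \<times> ?V \<times> ?W. q (fst z) (fst (snd z)) (snd (snd z)) *
        ln (q (fst z) (fst (snd z)) (snd (snd z))))"
      using fin by (subst fent_sum[of "?U \<times> ?V \<times> ?W"]) (auto simp: fib q_def)
    also have "\<dots> = - (\<Sum>u\<in>?U. \<Sum>v\<in>?V. \<Sum>w\<in>?W. q u v w * ln (q u v w))"
      by (simp add: sum.cartesian_product case_prod_unfold)
    also have "(\<Sum>u\<in>?U. \<Sum>v\<in>?V. \<Sum>w\<in>?W. q u v w * ln (q u v w)) =
        (\<Sum>u\<in>?U. \<Sum>w\<in>?W. \<Sum>v\<in>?V. q u v w * ln (q u v w))"
      by (intro sum.cong refl sum.swap)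
    also have "\<dots> = (\<Sum>w\<in>?W. \<Sum>u\<in>?U. \<Sum>v\<in>?V. q u v w * ln (q u v w))" by (rule sum.swap)
    finally show ?thesis .
  qed
  have pair: "fent M (\<lambda>x. (f' x, h x)) = - (\<Sum>w\<in>?W. \<Sum>u\<in>range f'.
      prob (f' -` {u} \<inter> h -` {w}) * ln (prob (f' -` {u} \<inter> h -` {w})))" if "finite (range f')" for f' :: "'a \<Rightarrow> 'z"
  proof -
    have fib: "(\<lambda>x. (f' x, h x)) -` {z} = f' -` {fst z} \<inter> h -` {snd z}" for z
      by (cases z) auto
    have "fent M (\<lambda>x. (f' x, h x)) = - (\<Sum>z\<in>range f' \<times> ?W. prob (f' -` {fst z} \<inter> h -` {snd z}) *
        ln (prob (f' -` {fst z} \<inter> h -` {snd z})))"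
      using fin that by (subst fent_sum[of "range f' \<times> ?W"]) (auto simp: fib)
    also have "\<dots> = - (\<Sum>u\<in>range f'. \<Sum>w\<in>?W. prob (f' -` {u} \<inter> h -` {w}) * ln (prob (f' -` {u} \<inter> h -` {w})))"
      by (simp add: sum.cartesian_product case_prod_unfold)
    also have "\<dots> = - (\<Sum>w\<in>?W. \<Sum>u\<in>range f'. prob (f' -` {u} \<inter> h -` {w}) * ln (prob (f' -` {u} \<inter> h -` {w})))"
      by (subst sum.swap) simp
    finally show ?thesis .
  qed
  have 4: "fent M h = - (\<Sum>w\<in>?W. prob (h -` {w}) * ln (prob (h -` {w})))"
    by (rule fent_sum[OF fin(3)]) simp
  have q0: "(\<And>u v w. 0 \<le> q u v w)" by (simp add: q_def)
  show ?thesis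
    using finite_submodularity[OF fin, of q, OF q0]
    unfolding 1 4 pair[OF fin(1)] pair[OF fin(2)] a b c by linarith
qed

lemma fent_const: "space M = UNIV \<Longrightarrow> fent M (\<lambda>_. c) = 0"
  using prob_space by (subst fent_sum[of "{c}"]) auto

lemma finite_valued_const: "space M = UNIV \<Longrightarrow> finite_valued M (\<lambda>_. c)"
  by (auto simp: finite_valued_def vimage_def)  (metis sets.top)

lemma fent_pair_le:
  assumes sp: "space M = UNIV" and f: "finite_valued M f" and g: "finite_valued M g"
  shows "fent M (\<lambda>x. (f x, g x)) \<le> fent M f + fent M g"
proof -
  have "fent M (\<lambda>x. (f x, g x, ())) + fent M (\<lambda>x. ()) \<le> fent M (\<lambda>x. (f x, ())) + fent M (\<lambda>x. (g x, ()))"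
    by (rule fent_submodular[OF sp f g finite_valued_const[OF sp]])
  moreover have "fent M (\<lambda>x. (f x, g x, ())) = fent M (\<lambda>x. (f x, g x))" by (rule fent_cong_kernel) auto
  moreover have "fent M (\<lambda>x. (f x, ())) = fent M f" by (rule fent_cong_kernel) auto
  moreover have "fent M (\<lambda>x. (g x, ())) = fent M g" by (rule fent_cong_kernel) auto
  ultimately show ?thesis using fent_const[OF sp, of "()"] by simp
qed

text \<open>A map determined by \<open>g\<close> has at most the entropy of \<open>g\<close>, because the joint probabilities are at most the probabilities
  of the values of \<open>f\<close>.\<close>

lemma fent_mono_kernel:
  assumes sp: "space M = UNIV" and f: "finite_valued M f" and g: "finite_valued M g"
    and det: "\<And>x y. g x = g y \<Longrightarrow> f x = f y"
  shows "fent M f \<le> fent M g"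
proof -
  let ?U = "range f" and ?V = "range g"
  have fin: "finite ?U" "finite ?V" using f g by (auto simp: finite_valued_def)
  have ev: "f -` {u} \<in> events" "g -` {v} \<in> events" for u v
    using f g by (auto simp: finite_valued_def)
  define q where "q u v = prob (f -` {u} \<inter> g -` {v})" for u v
  have fib: "(\<lambda>x. (f x, g x)) -` {z} = f -` {fst z} \<inter> g -` {snd z}" for z
    by (cases z) auto
  have "(\<Sum>u\<in>?U. \<Sum>v\<in>?V. q u v * ln (q u v)) \<le> (\<Sum>u\<in>?U. \<Sum>v\<in>?V. q u v * ln (prob (f -` {u})))"
  proof (intro sum_mono)
    fix u v
    show "q u v * ln (q u v) \<le> q u v * ln (prob (f -` {u}))"
    proof (cases "q u v = 0")
      case False
      then have "q u v > 0" by (simp add: q_def zero_less_measure_iff)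
      moreover have "q u v \<le> prob (f -` {u})" unfolding q_def using ev by (intro finite_measure_mono) auto
      ultimately show ?thesis by (intro mult_left_mono) auto
    qed simp
  qed
  also have "\<dots> = (\<Sum>u\<in>?U. prob (f -` {u}) * ln (prob (f -` {u})))"
    using sum_fibres[OF g fin(2)] ev by (simp add: q_def sum_distrib_right[symmetric])
  also have "\<dots> = - fent M f" by (subst fent_sum[OF fin(1)]) auto
  finally have "fent M f \<le> - (\<Sum>u\<in>?U. \<Sum>v\<in>?V. q u v * ln (q u v))" by simp
  also have "\<dots> = fent M (\<lambda>x. (f x, g x))"
    using fin by (subst fent_sum[of "?U \<times> ?V"]) (auto simp: fib q_def sum.cartesian_product case_prod_unfold)
  also have "\<dots> = fent M g" by (rule fent_cong_kernel) (auto dest: det)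
  finally show ?thesis .
qed

lemma fent_nonneg:
  assumes sp: "space M = UNIV" and f: "finite_valued M f" shows "fent M f \<ge> 0"
  using fent_mono_kernel[OF sp finite_valued_const[OF sp, of "()"] f] fent_const[OF sp, of "()"] by simp

lemma fent_names_le:
  assumes sp: "space M = UNIV" and J: "finite J" and X: "\<And>i. i \<in> J \<Longrightarrow> finite_valued M (X i)"
  shows "fent M (names X J) \<le> (\<Sum>i\<in>J. fent M (X i))"
  using J X
proof (induction J rule: finite_induct)
  case empty
  have "names X {} = (\<lambda>_. \<lambda>_. undefined)" by (auto simp: names_def fun_eq_iff)
  then show ?case by (simp add: fent_const[OF sp])
next
  case (insert i J)
  have "fent M (names X (insert i J)) = fent M (\<lambda>x. (X i x, names X J x))"
    by (rule fent_cong_kernel) (auto simp: names_eq_iff)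
  also have "\<dots> \<le> fent M (X i) + fent M (names X J)"
    using insert sp by (intro fent_pair_le finite_valued_names) auto
  also have "\<dots> \<le> fent M (X i) + (\<Sum>i\<in>J. fent M (X i))" using insert by simp
  finally show ?case using insert by simp
qed

text \<open>Shearer's inequality for a cover of \<open>W\<close> in which every point has multiplicity exactly \<open>k\<close>. When a point \<open>w\<close> is added to
  \<open>W\<close>, submodularity bounds the gain \<open>d\<close> of the whole set by the gain of each of the \<open>k\<close> members that contain \<open>w\<close>.\<close>

lemma fent_Shearer:
  assumes sp: "space M = UNIV" and C: "finite C"
    and W: "finite W" "\<And>i. i \<in> W \<Longrightarrow> finite_valued M (X i)"
    and S: "\<And>c. c \<in> C \<Longrightarrow> S c \<subseteq> W" "\<And>w. w \<in> W \<Longrightarrow> card {c\<in>C. w \<in> S c} = k"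
  shows "real k * fent M (names X W) \<le> (\<Sum>c\<in>C. fent M (names X (S c)))"
  using W S
proof (induction W arbitrary: S rule: finite_induct)
  case empty
  have "names X {} = (\<lambda>_. \<lambda>_. undefined)" by (auto simp: names_def fun_eq_iff)
  moreover have "S c = {}" if "c \<in> C" for c using empty that by blast
  ultimately show ?case by (simp add: fent_const[OF sp])
next
  case (insert w W)
  define d where "d = fent M (names X (insert w W)) - fent M (names X W)"
  have "real k * fent M (names X W) \<le> (\<Sum>c\<in>C. fent M (names X (S c - {w})))"
  proof (rule insert.IH)
    fix v assume v: "v \<in> W"
    then have "{c\<in>C. v \<in> S c - {w}} = {c\<in>C. v \<in> S c}" using insert.hyps(2) by auto
    then show "card {c\<in>C. v \<in> S c - {w}} = k" using insert.prems(3)[of v] v by simp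
  qed (use insert.prems in auto)
  moreover have "(\<Sum>c\<in>C. fent M (names X (S c - {w}))) + real k * d \<le> (\<Sum>c\<in>C. fent M (names X (S c)))"
  proof -
    have "fent M (names X (S c - {w})) + (if w \<in> S c then d else 0) \<le> fent M (names X (S c))" if c: "c \<in> C" for c
    proof (cases "w \<in> S c")
      case False then show ?thesis by simp
    next
      case True
      let ?S = "S c - {w}"
      have sub: "?S \<subseteq> W" "S c = insert w ?S" using insert.prems(2)[OF c] True by auto
      have finS: "finite ?S" using sub(1) insert.hyps(1) finite_subset by blast
      have "fent M (\<lambda>x. (names X W x, X w x, names X ?S x)) + fent M (names X ?S) \<le>
          fent M (\<lambda>x. (names X W x, names X ?S x)) + fent M (\<lambda>x. (X w x, names X ?S x))"
        using insert sub finS by (intro fent_submodular[OF sp] finite_valued_names[OF _ _ sp]) auto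
      moreover have "fent M (\<lambda>x. (names X W x, X w x, names X ?S x)) = fent M (names X (insert w W))"
        by (rule fent_cong_kernel) (use sub in \<open>auto simp: names_eq_iff\<close>)
      moreover have "fent M (\<lambda>x. (names X W x, names X ?S x)) = fent M (names X W)"
        by (rule fent_cong_kernel) (use sub in \<open>auto simp: names_eq_iff\<close>)
      moreover have "fent M (\<lambda>x. (X w x, names X ?S x)) = fent M (names X (S c))"
        by (rule fent_cong_kernel) (use sub True in \<open>auto simp: names_eq_iff\<close>)
      ultimately show ?thesis using True by (simp add: d_def)
    qed
    then have "(\<Sum>c\<in>C. fent M (names X (S c - {w})) + (if w \<in> S c then d else 0)) \<le> (\<Sum>c\<in>C. fent M (names X (S c)))"
      by (rule sum_mono)
    moreover have "(\<Sum>c\<in>C. if w \<in> S c then d else 0) = real k * d"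
    proof -
      have "{c\<in>C. w \<in> S c} = C \<inter> {c. w \<in> S c}" by blast
      then show ?thesis using insert.prems(3)[of w] C by (simp add: sum.If_cases)
    qed
    ultimately show ?thesis by (simp add: sum.distrib)
  qed
  ultimately show ?case by (simp add: d_def algebra_simps)
qed

end

section \<open>The entropy rate bounds the entropy over every finite set\<close>

locale G_system = group G for G :: "('g, 'b) monoid_scheme" (structure) +
  fixes \<phi> :: "'g \<Rightarrow> 'x \<Rightarrow> 'x::metric_space"
  assumes tds: "G_tds G \<phi>"
begin

sublocale act: group_action G UNIV \<phi>
  using tds by (simp add: G_tds_def)

lemma act_mult: "g \<in> carrier G \<Longrightarrow> h \<in> carrier G \<Longrightarrow> \<phi> (g \<otimes> h) x = \<phi> g (\<phi> h x)"
  using act.composition_rule[of x g h] by simp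

lemma act_inv: "g \<in> carrier G \<Longrightarrow> \<phi> (inv g) (\<phi> g x) = x" "g \<in> carrier G \<Longrightarrow> \<phi> g (\<phi> (inv g) x) = x"
  using act_mult[of "inv g" g x] act_mult[of g "inv g" x] fun_cong[OF act.id_eq_one, of x] by auto

lemma continuous_act: "g \<in> carrier G \<Longrightarrow> continuous_on S (\<phi> g)"
  using G_tds_continuous[OF tds] continuous_on_subset by blast

lemma measurable_act: "g \<in> carrier G \<Longrightarrow> \<phi> g \<in> borel_measurable borel"
  by (rule borel_measurable_continuous_onI) (rule continuous_act)

lemma compact_space: "compact (UNIV :: 'x set)" using tds by (simp add: G_tds_def)

end

definition cell :: "'x set set \<Rightarrow> 'x \<Rightarrow> 'x set" where
  "cell \<alpha> x = (THE A. A \<in> \<alpha> \<and> x \<in> A)"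

lemma cell_eq:
  assumes "partition_on UNIV \<alpha>" "A \<in> \<alpha>" "x \<in> A" shows "cell \<alpha> x = A"
  unfolding cell_def
proof (rule the_equality)
  show "A \<in> \<alpha> \<and> x \<in> A" using assms by blast
  fix B assume "B \<in> \<alpha> \<and> x \<in> B"
  then show "B = A" using assms by (auto simp: partition_on_def disjoint_def)
qed

lemma cell_in:
  assumes "partition_on UNIV \<alpha>" shows "cell \<alpha> x \<in> \<alpha>" "x \<in> cell \<alpha> x"
proof -
  obtain A where "A \<in> \<alpha>" "x \<in> A" using assms by (auto simp: partition_on_def)
  then show "cell \<alpha> x \<in> \<alpha>" "x \<in> cell \<alpha> x" using cell_eq[OF assms] by auto
qed

text \<open>The join consists of the nonempty intersections of preimages of cells, and these are the classes of points with the same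
  name. This connects the entropy of partitions with that of maps.\<close>

lemma partition_join_eq_fibres:
  assumes \<alpha>: "partition_on UNIV \<alpha>" and J: "J \<noteq> {}"
  shows "partition_join \<phi> J \<alpha> =
    range (\<lambda>x. names (\<lambda>g x. cell \<alpha> (\<phi> g x)) J -` {names (\<lambda>g x. cell \<alpha> (\<phi> g x)) J x})"
    (is "_ = range ?fib")
proof -
  let ?P = "\<lambda>g. (\<lambda>A. \<phi> g -` A) ` \<alpha>"
  have fib: "?fib x = (\<Inter>g\<in>J. \<phi> g -` cell \<alpha> (\<phi> g x))" for x
  proof -
    have "cell \<alpha> (\<phi> g y) = cell \<alpha> (\<phi> g x) \<longleftrightarrow> \<phi> g y \<in> cell \<alpha> (\<phi> g x)" for g y
      using cell_in[OF \<alpha>, of "\<phi> g y"] cell_eq[OF \<alpha> cell_in(1)[OF \<alpha>, of "\<phi> g x"], of "\<phi> g y"] by auto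
    then show ?thesis by (auto simp: names_eq_iff)
  qed
  show ?thesis
  proof (intro equalityI subsetI)
    fix B assume "B \<in> partition_join \<phi> J \<alpha>"
    then obtain f where f: "\<And>P. P \<in> ?P ` J \<Longrightarrow> f P \<in> P" "B = \<Inter> (f ` (?P ` J))" "B \<noteq> {}"
      unfolding partition_join_def common_refinement by auto
    then obtain x where x: "x \<in> B" by blast
    have "f (?P g) = \<phi> g -` cell \<alpha> (\<phi> g x)" if g: "g \<in> J" for g
    proof -
      obtain A where A: "A \<in> \<alpha>" "f (?P g) = \<phi> g -` A" using f(1)[of "?P g"] g by auto
      have "x \<in> f (?P g)" using x f(2) g by auto
      then have "cell \<alpha> (\<phi> g x) = A" using A by (intro cell_eq[OF \<alpha>]) auto
      then show ?thesis using A by simp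
    qed
    then have "B = (\<Inter>g\<in>J. \<phi> g -` cell \<alpha> (\<phi> g x))" unfolding f(2) by simp
    then show "B \<in> range ?fib" unfolding fib by blast
  next
    fix B assume "B \<in> range ?fib"
    then obtain x where B: "B = (\<Inter>g\<in>J. \<phi> g -` cell \<alpha> (\<phi> g x))" unfolding fib by blast
    define f where "f P = (THE C. C \<in> P \<and> x \<in> C)" for P
    have fP: "f (?P g) = \<phi> g -` cell \<alpha> (\<phi> g x)" if "g \<in> J" for g
      unfolding f_def
    proof (rule the_equality)
      show "\<phi> g -` cell \<alpha> (\<phi> g x) \<in> ?P g \<and> x \<in> \<phi> g -` cell \<alpha> (\<phi> g x)"
        using cell_in[OF \<alpha>] by auto
      fix C assume "C \<in> ?P g \<and> x \<in> C"
      then obtain A where "A \<in> \<alpha>" "C = \<phi> g -` A" "\<phi> g x \<in> A" by auto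
      then show "C = \<phi> g -` cell \<alpha> (\<phi> g x)" using cell_eq[OF \<alpha>] by auto
    qed
    have "B = \<Inter> (f ` (?P ` J))" unfolding B using fP by simp
    moreover have "f \<in> (\<Pi> P\<in>?P ` J. P)" using fP cell_in(1)[OF \<alpha>] by auto
    moreover have "x \<in> B" unfolding B using cell_in(2)[OF \<alpha>] by auto
    ultimately show "B \<in> partition_join \<phi> J \<alpha>"
      unfolding partition_join_def common_refinement by blast
  qed
qed

context G_system begin

definition pname :: "'x set set \<Rightarrow> 'g set \<Rightarrow> 'x \<Rightarrow> 'g \<Rightarrow> 'x set" where
  "pname \<alpha> = names (\<lambda>g x. cell \<alpha> (\<phi> g x))"

lemma partition_entropy_join:
  assumes "partition_on UNIV \<alpha>" "J \<noteq> {}"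
  shows "partition_entropy M (partition_join \<phi> J \<alpha>) = fent M (pname \<alpha> J)"
  unfolding partition_join_eq_fibres[OF assms] fent_def pname_def ..

lemma inv_probsD:
  assumes "\<mu> \<in> inv_probs G \<phi>"
  shows "sets \<mu> = sets borel" "prob_space \<mu>" "space \<mu> = UNIV"
    and "\<And>g. g \<in> carrier G \<Longrightarrow> distr \<mu> \<mu> (\<phi> g) = \<mu>"
    and "\<And>g. g \<in> carrier G \<Longrightarrow> \<phi> g \<in> measurable \<mu> \<mu>"
proof -
  show 1: "sets \<mu> = sets borel" "prob_space \<mu>" and "\<And>g. g \<in> carrier G \<Longrightarrow> distr \<mu> \<mu> (\<phi> g) = \<mu>"
    using assms by (auto simp: inv_probs_def Borel_probs_def invariant_measure_def)
  show "space \<mu> = UNIV" using sets_eq_imp_space_eq[OF 1(1)] by simp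
  show "\<And>g. g \<in> carrier G \<Longrightarrow> \<phi> g \<in> measurable \<mu> \<mu>"
    using measurable_act measurable_cong_sets[OF 1(1) 1(1)] by blast
qed

lemma measure_vimage_act:
  assumes "\<mu> \<in> inv_probs G \<phi>" "g \<in> carrier G" "A \<in> sets \<mu>"
  shows "measure \<mu> (\<phi> g -` A) = measure \<mu> A"
proof -
  have "measure \<mu> A = measure (distr \<mu> \<mu> (\<phi> g)) A" using inv_probsD(4)[OF assms(1,2)] by simp
  also have "\<dots> = measure \<mu> (\<phi> g -` A \<inter> space \<mu>)"
    by (rule measure_distr[OF inv_probsD(5)[OF assms(1,2)] assms(3)])
  finally show ?thesis using inv_probsD(3)[OF assms(1)] by simp
qed

lemma finite_valued_act:
  assumes \<mu>: "\<mu> \<in> inv_probs G \<phi>" and g: "g \<in> carrier G" and f: "finite_valued \<mu> f"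
  shows "finite_valued \<mu> (\<lambda>x. f (\<phi> g x))" "fent \<mu> (\<lambda>x. f (\<phi> g x)) = fent \<mu> f"
proof -
  have sub: "range (\<lambda>x. f (\<phi> g x)) \<subseteq> range f" by auto
  have fin: "finite (range f)" and fm: "f -` {v} \<in> sets \<mu>" for v using f by (auto simp: finite_valued_def)
  have vim: "(\<lambda>x. f (\<phi> g x)) -` {v} = \<phi> g -` (f -` {v})" for v by auto
  have "\<phi> g -` (f -` {v}) \<in> sets \<mu>" for v
    using measurable_sets[OF inv_probsD(5)[OF \<mu> g] fm] inv_probsD(3)[OF \<mu>] by simp
  then show "finite_valued \<mu> (\<lambda>x. f (\<phi> g x))"
    using finite_subset[OF sub fin] by (simp add: finite_valued_def vim)
  show "fent \<mu> (\<lambda>x. f (\<phi> g x)) = fent \<mu> f"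
    by (simp add: fent_sum[OF fin sub] fent_sum[OF fin subset_refl] vim measure_vimage_act[OF \<mu> g fm])
qed

lemma finite_valued_cell:
  assumes "sets \<mu> = sets borel" and \<alpha>: "finite_Borel_partition \<alpha>"
  shows "finite_valued \<mu> (cell \<alpha>)"
proof -
  have p: "partition_on UNIV \<alpha>" "finite \<alpha>" "\<alpha> \<subseteq> sets borel" using \<alpha> by (auto simp: finite_Borel_partition_def)
  have "range (cell \<alpha>) \<subseteq> \<alpha>" using cell_in(1)[OF p(1)] by auto
  then have "finite (range (cell \<alpha>))" using p(2) finite_subset by blast
  moreover have "cell \<alpha> -` {v} \<in> sets \<mu>" for v
  proof (cases "v \<in> \<alpha>")
    case True
    then have "cell \<alpha> -` {v} = v" using cell_in[OF p(1)] cell_eq[OF p(1) True] by auto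
    then show ?thesis using True p(3) assms(1) by auto
  next
    case False
    then have "cell \<alpha> -` {v} = {}" using cell_in(1)[OF p(1)] by auto
    then show ?thesis by simp
  qed
  ultimately show ?thesis by (simp add: finite_valued_def)
qed

lemma finite_valued_pname:
  assumes \<mu>: "\<mu> \<in> inv_probs G \<phi>" and \<alpha>: "finite_Borel_partition \<alpha>" and J: "finite J" "J \<subseteq> carrier G"
  shows "finite_valued \<mu> (pname \<alpha> J)"
  unfolding pname_def using J
  by (intro finite_valued_names finite_valued_act[OF \<mu>] finite_valued_cell[OF inv_probsD(1)[OF \<mu>] \<alpha>]
      inv_probsD(3)[OF \<mu>]) auto

text \<open>The name of \<open>x\<close> over \<open>J h\<close> is the name of \<open>h x\<close> over \<open>J\<close>, and the measure is invariant.\<close>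

lemma fent_pname_r_coset:
  assumes \<mu>: "\<mu> \<in> inv_probs G \<phi>" and \<alpha>: "finite_Borel_partition \<alpha>" and J: "finite J" "J \<subseteq> carrier G"
    and h: "h \<in> carrier G"
  shows "fent \<mu> (pname \<alpha> (J #> h)) = fent \<mu> (pname \<alpha> J)"
proof -
  have "fent \<mu> (pname \<alpha> (J #> h)) = fent \<mu> (\<lambda>x. pname \<alpha> J (\<phi> h x))"
  proof (rule fent_cong_kernel)
    fix x y
    show "pname \<alpha> (J #> h) x = pname \<alpha> (J #> h) y \<longleftrightarrow> pname \<alpha> J (\<phi> h x) = pname \<alpha> J (\<phi> h y)"
      using J h by (auto simp: pname_def names_eq_iff r_coset_def act_mult subset_iff)
  qed
  then show ?thesis using finite_valued_act(2)[OF \<mu> h finite_valued_pname[OF \<mu> \<alpha> J]] by simp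
qed

text \<open>Shearer's inequality for the translates of \<open>F\<close> cut off at \<open>W\<close>, each point of \<open>W\<close> being covered \<open>|F|\<close> times.\<close>

lemma entropy_cover_bound:
  assumes \<mu>: "\<mu> \<in> inv_probs G \<phi>" and \<alpha>: "finite_Borel_partition \<alpha>"
    and F: "finite F" "F \<subseteq> carrier G" and W: "finite W" "W \<subseteq> carrier G"
  shows "real (card F) * fent \<mu> (pname \<alpha> W) \<le>
    (real (card W) + real (card ((m_inv G ` F <#> W) - W))) * fent \<mu> (pname \<alpha> F)"
proof -
  interpret prob_space \<mu> by (rule inv_probsD(2)[OF \<mu>])
  have sp: "space \<mu> = UNIV" by (rule inv_probsD(3)[OF \<mu>])
  define C where "C = m_inv G ` F <#> W"
  have iF: "m_inv G ` F \<subseteq> carrier G" using F by auto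
  have C: "finite C" "C \<subseteq> carrier G"
    using F W set_mult_closed[OF iF W(2)] by (auto simp: C_def intro!: finite_setmult)
  have cov: "card {c\<in>C. w \<in> (F #> c) \<inter> W} = card F" if w: "w \<in> W" for w
  proof -
    have "{c\<in>C. w \<in> (F #> c) \<inter> W} = {c\<in>C. w \<in> F #> c}" using w by auto
    also have "card \<dots> = card F"
      by (rule card_translates_at(2)[OF F(2,1) _ C]) (use w W in \<open>auto simp: C_def mem_set_mult\<close>)
    finally show ?thesis .
  qed
  have "real (card F) * fent \<mu> (pname \<alpha> W) \<le> (\<Sum>c\<in>C. fent \<mu> (pname \<alpha> ((F #> c) \<inter> W)))"
    unfolding pname_def
    by (rule fent_Shearer[OF sp C(1) W(1)])
      (use cov W in \<open>auto intro!: finite_valued_act[OF \<mu>] finite_valued_cell[OF inv_probsD(1)[OF \<mu>] \<alpha>]\<close>)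
  also have "\<dots> \<le> (\<Sum>c\<in>C. fent \<mu> (pname \<alpha> F))"
  proof (rule sum_mono)
    fix c assume "c \<in> C"
    then have c: "c \<in> carrier G" using C by auto
    have Fc: "finite (F #> c)" "F #> c \<subseteq> carrier G"
      using F c finite_r_coset r_coset_carrier by auto
    have "fent \<mu> (pname \<alpha> ((F #> c) \<inter> W)) \<le> fent \<mu> (pname \<alpha> (F #> c))"
      using Fc W by (intro fent_mono_kernel[OF sp] finite_valued_pname[OF \<mu> \<alpha>])
        (auto simp: pname_def names_eq_iff)
    then show "fent \<mu> (pname \<alpha> ((F #> c) \<inter> W)) \<le> fent \<mu> (pname \<alpha> F)"
      by (simp add: fent_pname_r_coset[OF \<mu> \<alpha> F c])
  qed
  also have "\<dots> = real (card C) * fent \<mu> (pname \<alpha> F)" by simp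
  also have "\<dots> \<le> (real (card W) + real (card (C - W))) * fent \<mu> (pname \<alpha> F)"
  proof (rule mult_right_mono)
    have "card C \<le> card (W \<union> (C - W))" using W C by (intro card_mono) auto
    then show "real (card C) \<le> real (card W) + real (card (C - W))"
      using card_Un_le_real[of W "C - W"] by linarith
    show "0 \<le> fent \<mu> (pname \<alpha> F)" by (rule fent_nonneg[OF sp finite_valued_pname[OF \<mu> \<alpha> F]])
  qed
  finally show ?thesis by (simp add: C_def)
qed

text \<open>The infimum rule. By the preceding bound the limit superior along a Folner sequence is at most the normalised
  entropy over any finite \<open>F\<close>. So the limit exists, and it bounds the entropy over every finite set from below.\<close>

lemma entropy_rate:
  assumes \<mu>: "\<mu> \<in> inv_probs G \<phi>" and \<alpha>: "finite_Borel_partition \<alpha>" and K: "Folner_sequence G K"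
  obtains a where "(\<lambda>n. fent \<mu> (pname \<alpha> (K n)) / real (card (K n))) \<longlonglongrightarrow> a"
    "\<And>J. finite J \<Longrightarrow> J \<subseteq> carrier G \<Longrightarrow> a * real (card J) \<le> fent \<mu> (pname \<alpha> J)"
proof -
  interpret prob_space \<mu> by (rule inv_probsD(2)[OF \<mu>])
  have sp: "space \<mu> = UNIV" by (rule inv_probsD(3)[OF \<mu>])
  have Kn: "finite (K n)" "K n \<subseteq> carrier G" "K n \<noteq> {}" for n using K by (auto simp: Folner_sequence_def)
  define H where "H J = fent \<mu> (pname \<alpha> J)" for J
  have H0: "H J \<ge> 0" if "finite J" "J \<subseteq> carrier G" for J
    unfolding H_def by (rule fent_nonneg[OF sp finite_valued_pname[OF \<mu> \<alpha> that]])
  define S where "S = {J. finite J \<and> J \<subseteq> carrier G \<and> J \<noteq> {}}"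
  define a where "a = (INF J\<in>S. H J / real (card J))"
  have Sne: "S \<noteq> {}" using Kn[of 0] by (auto simp: S_def)
  have bdd: "bdd_below ((\<lambda>J. H J / real (card J)) ` S)"
    by (rule bdd_belowI2[of _ 0]) (auto simp: S_def H0)
  have lower: "a \<le> H J / real (card J)" if "J \<in> S" for J
    unfolding a_def by (rule cINF_lower[OF bdd that])
  have "(\<lambda>n. H (K n) / real (card (K n))) \<longlonglongrightarrow> a"
  proof (rule LIMSEQ_I)
    fix r :: real assume r: "r > 0"
    obtain F where F: "F \<in> S" "H F / real (card F) < a + r / 2"
      using cINF_less_iff[OF Sne bdd, of "a + r / 2"] r unfolding a_def by auto
    have Ff: "finite F" "F \<subseteq> carrier G" "F \<noteq> {}" using F by (auto simp: S_def)
    define q where "q = H F / real (card F)"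
    have cF: "real (card F) > 0" using Ff by (simp add: card_gt_0_iff)
    have q0: "q \<ge> 0" using H0[OF Ff(1,2)] by (simp add: q_def)
    \<comment> \<open>makes the error \<open>\<tau> * q\<close> at most \<open>r / 2\<close>\<close>
    define \<tau> where "\<tau> = r / (2 * (q + 1))"
    have \<tau>: "\<tau> > 0" using r q0 by (simp add: \<tau>_def)
    have "\<tau> * q \<le> r / 2" using r q0 by (simp add: \<tau>_def field_simps)
    have "finite (m_inv G ` F)" "m_inv G ` F \<subseteq> carrier G" using Ff by auto
    from Folner_invariance[OF K this \<tau>]
    obtain N where N: "\<And>n. n \<ge> N \<Longrightarrow> real (card ((m_inv G ` F <#> K n) - K n)) \<le> \<tau> * real (card (K n))"
      by (auto simp: eventually_sequentially)
    have "norm (H (K n) / real (card (K n)) - a) < r" if n: "n \<ge> N" for n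
    proof -
      have cK: "real (card (K n)) > 0" using Kn[of n] by (simp add: card_gt_0_iff)
      have "real (card F) * H (K n) \<le> (real (card (K n)) + real (card ((m_inv G ` F <#> K n) - K n))) * H F"
        unfolding H_def by (rule entropy_cover_bound[OF \<mu> \<alpha> Ff(1,2) Kn(1,2)])
      also have "\<dots> \<le> ((1 + \<tau>) * real (card (K n))) * H F"
        using N[OF n] H0[OF Ff(1,2)] by (intro mult_right_mono) (auto simp: algebra_simps)
      finally have "H (K n) / real (card (K n)) \<le> (1 + \<tau>) * q"
        using cK cF by (simp add: q_def field_simps)
      also have "\<dots> = q + \<tau> * q" by (simp add: algebra_simps)
      also have "\<dots> < a + r" using \<open>\<tau> * q \<le> r / 2\<close> F(2)[folded q_def] by linarith
      finally have "H (K n) / real (card (K n)) < a + r" .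
      moreover have "a \<le> H (K n) / real (card (K n))" using lower Kn by (auto simp: S_def)
      ultimately show ?thesis by (simp add: abs_if)
    qed
    then show "\<exists>N. \<forall>n\<ge>N. norm (H (K n) / real (card (K n)) - a) < r" by blast
  qed
  moreover have "a * real (card J) \<le> H J" if J: "finite J" "J \<subseteq> carrier G" for J
  proof (cases "J = {}")
    case False
    then have "real (card J) > 0" using J by (simp add: card_gt_0_iff)
    then show ?thesis using lower[of J] False J by (simp add: S_def field_simps)
  qed (use H0 J in auto)
  ultimately show thesis using that unfolding H_def by blast
qed

lemma measure_entropy_gt:
  assumes \<mu>: "\<mu> \<in> inv_probs G \<phi>" and K: "Folner_sequence G K" and h: "ereal h < measure_entropy K \<phi> \<mu>"
  obtains \<alpha> a where "finite_Borel_partition \<alpha>" "h < a"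
    "\<And>J. finite J \<Longrightarrow> J \<subseteq> carrier G \<Longrightarrow> a * real (card J) \<le> fent \<mu> (pname \<alpha> J)"
proof -
  obtain \<alpha> where \<alpha>: "finite_Borel_partition \<alpha>" and
    l: "ereal h < lim (\<lambda>n. ereal (1 / real (card (K n)) * partition_entropy \<mu> (partition_join \<phi> (K n) \<alpha>)))"
    using h unfolding measure_entropy_def less_SUP_iff by auto
  obtain a where a: "(\<lambda>n. fent \<mu> (pname \<alpha> (K n)) / real (card (K n))) \<longlonglongrightarrow> a"
    "\<And>J. finite J \<Longrightarrow> J \<subseteq> carrier G \<Longrightarrow> a * real (card J) \<le> fent \<mu> (pname \<alpha> J)"
    by (rule entropy_rate[OF \<mu> \<alpha> K]) blast
  have "partition_entropy \<mu> (partition_join \<phi> (K n) \<alpha>) = fent \<mu> (pname \<alpha> (K n))" for n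
    using \<alpha> K by (intro partition_entropy_join) (auto simp: finite_Borel_partition_def Folner_sequence_def)
  then have "(\<lambda>n. ereal (1 / real (card (K n)) * partition_entropy \<mu> (partition_join \<phi> (K n) \<alpha>))) \<longlonglongrightarrow> ereal a"
    using a(1) by simp
  then have "lim (\<lambda>n. ereal (1 / real (card (K n)) * partition_entropy \<mu> (partition_join \<phi> (K n) \<alpha>))) = ereal a"
    by (rule limI)
  then show thesis using that[OF \<alpha> _ a(2)] l by simp
qed

end

section \<open>Entropy at a fixed scale\<close>

lemma open_inner_approx:
  fixes M :: "'x::metric_space measure"
  assumes "finite_measure M" "sets M = sets borel" "open A" "e > 0"
  shows "\<exists>C. closed C \<and> C \<subseteq> A \<and> measure M (A - C) < e"
proof (cases "A = UNIV")
  case True then show ?thesis using assms(4) by (intro exI[of _ UNIV]) auto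
next
  case False
  interpret finite_measure M by fact
  define C where "C n = {x. inverse (real (Suc n)) \<le> infdist x (- A)}" for n
  have cl: "closed (C n)" for n
    unfolding C_def by (intro closed_Collect_le continuous_intros)
  have CA: "C n \<subseteq> A" for n
  proof
    fix x assume "x \<in> C n"
    then have "infdist x (- A) > 0" unfolding C_def by (auto intro: less_le_trans[of 0 "inverse (real (Suc n))"])
    then show "x \<in> A" by (cases "x \<in> A") auto
  qed
  have U: "(\<Union>n. C n) = A"
  proof (intro equalityI subsetI)
    fix x assume x: "x \<in> A"
    have "infdist x (- A) \<noteq> 0"
      using in_closed_iff_infdist_zero[of "- A" x] assms(3) False x by auto
    then have "infdist x (- A) > 0" using infdist_nonneg[of x "- A"] by linarith
    then obtain n where "inverse (real (Suc n)) < infdist x (- A)" using reals_Archimedean by blast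
    then show "x \<in> (\<Union>n. C n)" by (auto simp: C_def intro!: exI[of _ n])
  qed (use CA in blast)
  have "incseq C"
  proof (rule incseq_SucI)
    fix n
    have "inverse (real (Suc (Suc n))) \<le> inverse (real (Suc n))" by (intro le_imp_inverse_le) auto
    then show "C n \<subseteq> C (Suc n)" unfolding C_def by (intro Collect_mono impI) (rule order_trans)
  qed
  then have "(\<lambda>n. measure M (C n)) \<longlonglongrightarrow> measure M (\<Union>n. C n)"
    using cl assms(2) by (intro finite_Lim_measure_incseq) (auto intro: borel_closed)
  then have "\<forall>\<^sub>F n in sequentially. measure M A - e < measure M (C n)"
    using assms(4) unfolding U by (intro order_tendstoD(1)) auto
  then obtain n where n: "measure M A - e < measure M (C n)" using eventually_happens by force
  have "measure M (A - C n) = measure M A - measure M (C n)"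
    using CA cl assms by (intro finite_measure_Diff) (auto intro: borel_closed)
  then show ?thesis using n CA cl by (intro exI[of _ "C n"]) auto
qed

text \<open>Regularity of finite Borel measures on an arbitrary metric space: the sets that can be approximated from both sides form a
  \<open>\<sigma>\<close>-algebra containing the open sets.\<close>

lemma closed_open_approx:
  fixes M :: "'x::metric_space measure"
  assumes fM: "finite_measure M" and sM: "sets M = sets borel" and A: "A \<in> sets borel"
  shows "\<forall>e>0. \<exists>C U. closed C \<and> open U \<and> C \<subseteq> A \<and> A \<subseteq> U \<and> measure M (U - C) < e"
proof -
  interpret finite_measure M by fact
  note bc = borel_closed borel_open
  have "A \<in> sigma_sets UNIV {S. open S}" using A by (simp add: sets_borel)
  then show ?thesis
  proof (induction rule: sigma_sets.induct)
    case (Basic A)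
    show ?case
    proof (intro allI impI)
      fix e :: real assume "e > 0"
      then obtain C where "closed C" "C \<subseteq> A" "measure M (A - C) < e"
        using open_inner_approx[OF fM sM] Basic by blast
      then show "\<exists>C U. closed C \<and> open U \<and> C \<subseteq> A \<and> A \<subseteq> U \<and> measure M (U - C) < e"
        using Basic by (intro exI[of _ C] exI[of _ A]) auto
    qed
  next
    case Empty
    show ?case by (intro allI impI exI[of _ "{}"]) auto
  next
    case (Compl A)
    show ?case
    proof (intro allI impI)
      fix e :: real assume "e > 0"
      from Compl.IH[rule_format, OF this]
      obtain C U where CU: "closed C" "open U" "C \<subseteq> A" "A \<subseteq> U" "measure M (U - C) < e"
        by (elim exE conjE)
      have "- C - - U = U - C" by blast
      then show "\<exists>C U. closed C \<and> open U \<and> C \<subseteq> UNIV - A \<and> UNIV - A \<subseteq> U \<and> measure M (U - C) < e"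
        using CU by (intro exI[of _ "- U"] exI[of _ "- C"]) auto
    qed
  next
    case (Union A)
    show ?case
    proof (intro allI impI)
      fix e :: real assume e: "e > 0"
      have "\<forall>i. \<exists>C U. closed C \<and> open U \<and> C \<subseteq> A i \<and> A i \<subseteq> U \<and> measure M (U - C) < e / 2 * (1 / 2) ^ Suc i"
      proof
        fix i
        have "e / 2 * (1 / 2) ^ Suc i > 0" using e by simp
        then show "\<exists>C U. closed C \<and> open U \<and> C \<subseteq> A i \<and> A i \<subseteq> U \<and> measure M (U - C) < e / 2 * (1 / 2) ^ Suc i"
          by (rule Union.IH[rule_format])
      qed
      then obtain C U where CU: "\<And>i. closed (C i)" "\<And>i. open (U i)" "\<And>i. C i \<subseteq> A i" "\<And>i. A i \<subseteq> U i"
        "\<And>i. measure M (U i - C i) < e / 2 * (1 / 2) ^ Suc i" by metis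
      have mb: "C i \<in> sets M" "U i \<in> sets M" for i using CU sM bc by auto
      have hs: "(\<lambda>i. e / 2 * (1 / 2) ^ Suc i) sums (e / 2 * 1)" by (intro sums_mult power_half_series)
      have summ: "summable (\<lambda>i. measure M (U i - C i))"
        by (rule summable_comparison_test[OF _ sums_summable[OF hs]])
          (use CU(5) in \<open>auto intro: less_imp_le\<close>)
      have le1: "measure M (\<Union>i. U i - C i) \<le> e / 2"
      proof -
        have "measure M (\<Union>i. U i - C i) \<le> (\<Sum>i. measure M (U i - C i))"
          using mb by (intro finite_measure_subadditive_countably summ) auto
        also have "\<dots> \<le> (\<Sum>i. e / 2 * (1 / 2) ^ Suc i)"
          using CU(5) by (intro suminf_le summ sums_summable[OF hs]) (auto intro: less_imp_le)
        also have "\<dots> = e / 2" using sums_unique[OF hs] by simp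
        finally show ?thesis .
      qed
      define D where "D n = (\<Union>i<n. C i)" for n
      have D: "closed (D n)" for n unfolding D_def using CU(1) by (intro closed_UN) auto
      have Dm: "D n \<in> sets M" for n using D sM bc by auto
      have "incseq D" unfolding D_def by (intro incseq_SucI UN_mono) auto
      moreover have UD: "(\<Union>n. D n) = (\<Union>i. C i)" unfolding D_def by auto
      ultimately have "(\<lambda>n. measure M (D n)) \<longlonglongrightarrow> measure M (\<Union>i. C i)"
        using finite_Lim_measure_incseq[of D] Dm by auto
      then have "\<forall>\<^sub>F n in sequentially. measure M (\<Union>i. C i) - e / 2 < measure M (D n)"
        using e by (intro order_tendstoD(1)) auto
      then obtain n where n: "measure M (\<Union>i. C i) - e / 2 < measure M (D n)" using eventually_happens by force
      have "measure M ((\<Union>i. C i) - D n) = measure M (\<Union>i. C i) - measure M (D n)"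
        using Dm mb UD by (intro finite_measure_Diff) auto
      then have le2: "measure M ((\<Union>i. C i) - D n) < e / 2" using n by simp
      have "measure M ((\<Union>i. U i) - D n) \<le> measure M ((\<Union>i. U i - C i) \<union> ((\<Union>i. C i) - D n))"
        using mb Dm by (intro finite_measure_mono) auto
      also have "\<dots> \<le> measure M (\<Union>i. U i - C i) + measure M ((\<Union>i. C i) - D n)"
        using mb Dm by (intro measure_subadditive) (auto simp: emeasure_eq_measure)
      also have "\<dots> < e" using le1 le2 by simp
      finally have "measure M ((\<Union>i. U i) - D n) < e" .
      moreover have "D n \<subseteq> (\<Union>i. A i)" unfolding D_def using CU(3) by blast
      moreover have "(\<Union>i. A i) \<subseteq> (\<Union>i. U i)" using CU(4) by blast
      ultimately show "\<exists>C U. closed C \<and> open U \<and> C \<subseteq> \<Union> (range A) \<and> \<Union> (range A) \<subseteq> U \<and> measure M (U - C) < e"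
        using D[of n] CU(2) by (intro exI[of _ "D n"] exI[of _ "\<Union>i. U i"]) auto
    qed
  qed
qed

lemma neg_mult_ln_le_sqrt: "- (t * ln t) \<le> 2 * sqrt t" if "t \<ge> 0" for t :: real
proof (cases "t = 0")
  case False
  then have t: "t > 0" "sqrt t > 0" using that by auto
  have "ln (inverse (sqrt t)) \<le> inverse (sqrt t) - 1" using t by (intro ln_le_minus_one) simp
  then have "- ln t \<le> 2 * inverse (sqrt t)" using t by (simp add: ln_inverse ln_sqrt)
  then have "t * (- ln t) \<le> t * (2 * inverse (sqrt t))" using t by (intro mult_left_mono) auto
  also have "\<dots> = 2 * sqrt t" using t by (simp add: field_simps)
  finally show ?thesis by simp
qed simp

lemma neg_mult_ln_le_compl: "- (t * ln t) \<le> 1 - t" if "t \<ge> 0" for t :: real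
proof (cases "t = 0")
  case False
  then have t: "t > 0" using that by auto
  have "ln (inverse t) \<le> inverse t - 1" using t by (intro ln_le_minus_one) simp
  then have "t * (- ln t) \<le> t * (inverse t - 1)" using t by (intro mult_left_mono) (auto simp: ln_inverse)
  also have "\<dots> = 1 - t" using t by (simp add: algebra_simps)
  finally show ?thesis by simp
qed simp

context G_system begin

text \<open>The construction knows the entropy of \<open>\<mu>\<close> only in this form, which replaces a partition by a metric scale.\<close>

definition entropy_floor :: "'x measure \<Rightarrow> real \<Rightarrow> real \<Rightarrow> bool" where
  "entropy_floor \<mu> a \<delta> \<longleftrightarrow> (\<forall>J c. finite J \<and> J \<subseteq> carrier G \<and> finite_valued \<mu> c \<and>
      (\<forall>x. \<forall>g\<in>J. dist (\<phi> g x) (\<phi> g (c x)) \<le> \<delta>) \<longrightarrow> a * real (card J) \<le> fent \<mu> (c :: 'x \<Rightarrow> 'x))"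

text \<open>Shrink the cells of \<open>\<alpha>\<close> to closed subsets of nearly full measure. The map that reveals the cell of a point only outside these
  subsets is constant up to small measure, hence has small entropy.\<close>

lemma compact_core:
  assumes \<mu>: "\<mu> \<in> inv_probs G \<phi>" and \<alpha>: "finite_Borel_partition \<alpha>" and \<kappa>: "\<kappa> > 0"
  obtains Kc where "\<And>A. A \<in> \<alpha> \<Longrightarrow> closed (Kc A) \<and> Kc A \<subseteq> A"
    "fent \<mu> (\<lambda>x. if \<exists>A\<in>\<alpha>. x \<in> Kc A then None else Some (cell \<alpha> x)) \<le> \<kappa>"
    "finite_valued \<mu> (\<lambda>x. if \<exists>A\<in>\<alpha>. x \<in> Kc A then None else Some (cell \<alpha> x))"
proof -
  interpret prob_space \<mu> by (rule inv_probsD(2)[OF \<mu>])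
  have sp: "space \<mu> = UNIV" and sb: "sets \<mu> = sets borel" by (rule inv_probsD[OF \<mu>])+
  have p: "partition_on UNIV \<alpha>" "finite \<alpha>" "\<alpha> \<subseteq> sets borel" using \<alpha> by (auto simp: finite_Borel_partition_def)
  define N where "N = real (card \<alpha>)"
  \<comment> \<open>each of the \<open>N\<close> cells loses measure \<open>s\<^sup>2\<close>, which contributes at most \<open>2 * s + s\<^sup>2 \<le> 3 * s\<close> to the entropy\<close>
  define s where "s = min 1 (\<kappa> / (3 * (N + 1)))"
  have N0: "N \<ge> 0" by (simp add: N_def)
  have s: "s > 0" "s \<le> 1" using \<kappa> N0 by (auto simp: s_def)
  have sN: "N * (3 * s) \<le> \<kappa>"
  proof -
    have "s \<le> \<kappa> / (3 * (N + 1))" by (simp add: s_def)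
    then have "3 * (N + 1) * s \<le> \<kappa>" using N0 by (simp add: field_simps)
    then show ?thesis using s by (simp add: algebra_simps)
  qed
  have "\<exists>C. closed C \<and> C \<subseteq> A \<and> measure \<mu> (A - C) < s\<^sup>2" if "A \<in> \<alpha>" for A
  proof -
    have "A \<in> sets borel" using that p by auto
    then obtain C U where "closed C" "open U" "C \<subseteq> A" "A \<subseteq> U" "measure \<mu> (U - C) < s\<^sup>2"
      using closed_open_approx[OF finite_measure_axioms sb] s by (metis zero_less_power)
    moreover have "measure \<mu> (A - C) \<le> measure \<mu> (U - C)"
      using calculation sb by (intro finite_measure_mono) (auto intro: borel_open borel_closed)
    ultimately show ?thesis by (intro exI[of _ C]) auto
  qed
  then obtain Kc where Kc: "\<And>A. A \<in> \<alpha> \<Longrightarrow> closed (Kc A)" "\<And>A. A \<in> \<alpha> \<Longrightarrow> Kc A \<subseteq> A"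
    "\<And>A. A \<in> \<alpha> \<Longrightarrow> measure \<mu> (A - Kc A) < s\<^sup>2" by metis
  define Z where "Z x = (if \<exists>A\<in>\<alpha>. x \<in> Kc A then None else Some (cell \<alpha> x))" for x
  have in_core: "(\<exists>A\<in>\<alpha>. x \<in> Kc A) \<longleftrightarrow> x \<in> Kc (cell \<alpha> x)" for x
    using cell_in[OF p(1), of x] Kc(2) cell_eq[OF p(1)] by blast
  have fibS: "Z -` {Some A} = A - Kc A" if "A \<in> \<alpha>" for A
  proof -
    have c: "cell \<alpha> x = A \<longleftrightarrow> x \<in> A" for x using cell_in[OF p(1), of x] cell_eq[OF p(1) that] by auto
    have "Z x = Some A \<longleftrightarrow> x \<in> A - Kc A" for x
      using c[of x] by (auto simp: Z_def in_core)
    then show ?thesis by auto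
  qed
  have rZ: "range Z \<subseteq> insert None (Some ` \<alpha>)" using cell_in(1)[OF p(1)] by (auto simp: Z_def)
  have finS: "finite (insert None (Some ` \<alpha>))" using p(2) by simp
  have fibN: "Z -` {None} = (\<Union>A\<in>\<alpha>. Kc A)" by (auto simp: Z_def split: if_splits)
  have Am: "A - Kc A \<in> sets \<mu>" if "A \<in> \<alpha>" for A using p(3) Kc(1)[OF that] sb that by (auto intro: borel_closed)
  have Nm: "(\<Union>A\<in>\<alpha>. Kc A) \<in> sets \<mu>" using Kc(1) p(2) sb by (auto intro!: sets.finite_UN borel_closed)
  have fv: "finite_valued \<mu> Z"
    unfolding finite_valued_def
  proof (intro conjI allI)
    show "finite (range Z)" using rZ finS finite_subset by blast
    fix v show "Z -` {v} \<in> sets \<mu>"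
    proof (cases "v \<in> insert None (Some ` \<alpha>)")
      case True then show ?thesis using fibS fibN Am Nm by auto
    next
      case False
      then have "v \<notin> range Z" using rZ by blast
      then have "Z -` {v} = {}" by auto
      then show ?thesis by simp
    qed
  qed
  have tot: "prob (Z -` {None}) + (\<Sum>A\<in>\<alpha>. prob (A - Kc A)) = 1"
  proof -
    have "(\<Sum>v\<in>insert None (Some ` \<alpha>). prob (UNIV \<inter> Z -` {v})) = prob UNIV"
      using fv finS rZ sets.top[of \<mu>] sp by (intro sum_fibres) auto
    then show ?thesis using p(2) prob_space sp by (simp add: sum.reindex fibS)
  qed
  have small: "(\<Sum>A\<in>\<alpha>. prob (A - Kc A)) \<le> N * s\<^sup>2"
    using sum_mono[of \<alpha> "\<lambda>A. prob (A - Kc A)" "\<lambda>_. s\<^sup>2"] Kc(3) by (force simp: N_def)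
  have "fent \<mu> Z = - (prob (Z -` {None}) * ln (prob (Z -` {None}))) + (\<Sum>A\<in>\<alpha>. - (prob (A - Kc A) * ln (prob (A - Kc A))))"
    using p(2) by (subst fent_sum[OF finS rZ]) (simp add: sum.reindex fibS sum_negf)
  also have "\<dots> \<le> (1 - prob (Z -` {None})) + (\<Sum>A\<in>\<alpha>. 2 * s)"
  proof (intro add_mono neg_mult_ln_le_compl measure_nonneg sum_mono)
    fix A assume "A \<in> \<alpha>"
    have "- (prob (A - Kc A) * ln (prob (A - Kc A))) \<le> 2 * sqrt (prob (A - Kc A))"
      by (rule neg_mult_ln_le_sqrt) simp
    also have "\<dots> \<le> 2 * sqrt (s\<^sup>2)" using Kc(3)[OF \<open>A \<in> \<alpha>\<close>] by (simp only: mult_left_mono real_sqrt_le_iff less_imp_le)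
    finally show "- (prob (A - Kc A) * ln (prob (A - Kc A))) \<le> 2 * s" using s by simp
  qed
  also have "\<dots> \<le> N * s\<^sup>2 + N * (2 * s)" using tot small by (simp add: N_def)
  also have "\<dots> \<le> N * (3 * s)"
  proof -
    have "s\<^sup>2 \<le> s" using s by (simp add: power2_eq_square mult_left_le)
    then have "N * s\<^sup>2 \<le> N * s" using N0 by (rule mult_left_mono)
    then show ?thesis by (simp add: algebra_simps)
  qed
  finally have "fent \<mu> Z \<le> \<kappa>" using sN by simp
  then show thesis using that[of Kc] Kc(1,2) fv unfolding Z_def[abs_def] by blast
qed

lemma finite_disjoint_compact_gap:
  assumes fin: "finite \<alpha>" and cl: "\<And>A. A \<in> \<alpha> \<Longrightarrow> closed (Kc A :: 'x set)"
    and dj: "\<And>A B. A \<in> \<alpha> \<Longrightarrow> B \<in> \<alpha> \<Longrightarrow> A \<noteq> B \<Longrightarrow> Kc A \<inter> Kc B = {}"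
  shows "\<exists>d>0. \<forall>A\<in>\<alpha>. \<forall>B\<in>\<alpha>. A \<noteq> B \<longrightarrow> (\<forall>x\<in>Kc A. \<forall>y\<in>Kc B. d \<le> dist x y)"
proof -
  define T where "T = {(A, B). A \<in> \<alpha> \<and> B \<in> \<alpha> \<and> A \<noteq> B}"
  have "finite T" using fin by (auto simp: T_def intro: finite_subset[of _ "\<alpha> \<times> \<alpha>"])
  have "\<forall>z\<in>T. \<exists>d>0. \<forall>x\<in>Kc (fst z). \<forall>y\<in>Kc (snd z). d \<le> dist x y"
  proof
    fix z assume "z \<in> T"
    then have z: "fst z \<in> \<alpha>" "snd z \<in> \<alpha>" "fst z \<noteq> snd z" by (auto simp: T_def)
    have comp: "compact (Kc (fst z))" using compact_Int_closed[OF compact_space cl[OF z(1)]] by simp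
    show "\<exists>d>0. \<forall>x\<in>Kc (fst z). \<forall>y\<in>Kc (snd z). d \<le> dist x y"
    proof (cases "Kc (fst z) = {} \<or> Kc (snd z) = {}")
      case True then show ?thesis by (intro exI[of _ 1]) auto
    next
      case False
      then obtain x0 where x0: "x0 \<in> Kc (fst z)" "\<And>x. x \<in> Kc (fst z) \<Longrightarrow> infdist x0 (Kc (snd z)) \<le> infdist x (Kc (snd z))"
        using continuous_attains_inf[OF comp _ continuous_on_infdist[OF continuous_on_id], of "Kc (snd z)"]
        by auto
      have "x0 \<notin> Kc (snd z)" using x0(1) dj[OF z] by blast
      then have "infdist x0 (Kc (snd z)) \<noteq> 0"
        using in_closed_iff_infdist_zero[OF cl[OF z(2)]] False by auto
      then have "infdist x0 (Kc (snd z)) > 0" using infdist_nonneg[of x0 "Kc (snd z)"] by linarith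
      moreover have "infdist x0 (Kc (snd z)) \<le> dist x y" if "x \<in> Kc (fst z)" "y \<in> Kc (snd z)" for x y
        using x0(2)[OF that(1)] infdist_le[OF that(2), of x] by linarith
      ultimately show ?thesis by blast
    qed
  qed
  then obtain d where d: "\<And>z. z \<in> T \<Longrightarrow> d z > 0" "\<And>z x y. z \<in> T \<Longrightarrow> x \<in> Kc (fst z) \<Longrightarrow> y \<in> Kc (snd z) \<Longrightarrow> d z \<le> dist x y"
    by metis
  define m where "m = Min (insert 1 (d ` T))"
  have "m > 0" using \<open>finite T\<close> d(1) by (simp add: m_def)
  have "m \<le> d z" if "z \<in> T" for z using \<open>finite T\<close> that by (simp add: m_def)
  moreover have "d (A, B) \<le> dist x y" if "(A, B) \<in> T" "x \<in> Kc A" "y \<in> Kc B" for A B x y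
    using d(2)[OF that(1)] that by simp
  ultimately have "m \<le> dist x y" if "(A, B) \<in> T" "x \<in> Kc A" "y \<in> Kc B" for A B x y
    using that by (meson order_trans)
  then show ?thesis using \<open>m > 0\<close>
    by (intro exI[of _ m] conjI ballI impI) (auto simp: T_def)
qed

text \<open>The closed subsets of distinct cells have a positive distance \<open>d\<close>, so a point known to within \<open>d / 3\<close> that lies in one of
  them has a known cell. The other visits are recorded by the map of \<open>compact_core\<close>, at the price \<open>\<kappa>\<close> per group
  element. Hence \<open>c\<close> accounts for all but \<open>\<kappa> |J|\<close> of the entropy of the \<open>J\<close>-names.\<close>

lemma entropy_floor_of_partition:
  assumes \<mu>: "\<mu> \<in> inv_probs G \<phi>" and \<alpha>: "finite_Borel_partition \<alpha>" and \<kappa>: "\<kappa> > 0"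
    and a: "\<And>J. finite J \<Longrightarrow> J \<subseteq> carrier G \<Longrightarrow> a * real (card J) \<le> fent \<mu> (pname \<alpha> J)"
  shows "\<exists>\<delta>>0. entropy_floor \<mu> (a - \<kappa>) \<delta>"
proof -
  interpret prob_space \<mu> by (rule inv_probsD(2)[OF \<mu>])
  have sp: "space \<mu> = UNIV" by (rule inv_probsD[OF \<mu>])
  have p: "partition_on UNIV \<alpha>" "finite \<alpha>" using \<alpha> by (auto simp: finite_Borel_partition_def)
  obtain Kc where Kc0: "\<And>A. A \<in> \<alpha> \<Longrightarrow> closed (Kc A) \<and> Kc A \<subseteq> A"
    and Z0: "fent \<mu> (\<lambda>x. if \<exists>A\<in>\<alpha>. x \<in> Kc A then None else Some (cell \<alpha> x)) \<le> \<kappa>"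
      "finite_valued \<mu> (\<lambda>x. if \<exists>A\<in>\<alpha>. x \<in> Kc A then None else Some (cell \<alpha> x))"
    by (rule compact_core[OF \<mu> \<alpha> \<kappa>]) blast
  define Z where "Z = (\<lambda>x. if \<exists>A\<in>\<alpha>. x \<in> Kc A then None else Some (cell \<alpha> x))"
  note Z = Z0[folded Z_def]
  have Kc: "closed (Kc A)" "Kc A \<subseteq> A" if "A \<in> \<alpha>" for A using Kc0[OF that] by auto
  have dj: "Kc A \<inter> Kc B = {}" if "A \<in> \<alpha>" "B \<in> \<alpha>" "A \<noteq> B" for A B
  proof -
    have "A \<inter> B = {}" using p(1) that by (auto simp: partition_on_def disjoint_def)
    then show ?thesis using Kc(2)[OF that(1)] Kc(2)[OF that(2)] by blast
  qed
  have "\<exists>d>0. \<forall>A\<in>\<alpha>. \<forall>B\<in>\<alpha>. A \<noteq> B \<longrightarrow> (\<forall>x\<in>Kc A. \<forall>y\<in>Kc B. d \<le> dist x y)"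
    by (rule finite_disjoint_compact_gap[OF p(2)]) (use Kc(1) dj in auto)
  then obtain d where d: "d > 0" "\<And>A B x y. A \<in> \<alpha> \<Longrightarrow> B \<in> \<alpha> \<Longrightarrow> A \<noteq> B \<Longrightarrow> x \<in> Kc A \<Longrightarrow> y \<in> Kc B \<Longrightarrow> d \<le> dist x y"
    by metis
  have "entropy_floor \<mu> (a - \<kappa>) (d / 3)"
    unfolding entropy_floor_def
  proof (intro allI impI, elim conjE)
    fix J and c :: "'x \<Rightarrow> 'x"
    assume J: "finite J" "J \<subseteq> carrier G" and c: "finite_valued \<mu> c"
      and close: "\<forall>x. \<forall>g\<in>J. dist (\<phi> g x) (\<phi> g (c x)) \<le> d / 3"
    let ?Z = "\<lambda>g x. Z (\<phi> g x)"
    have fvZ: "finite_valued \<mu> (?Z g)" "fent \<mu> (?Z g) = fent \<mu> Z" if "g \<in> J" for g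
      using finite_valued_act[OF \<mu> _ Z(2), of g] that J by auto
    have fvN: "finite_valued \<mu> (names ?Z J)" by (rule finite_valued_names[OF J(1) fvZ(1) sp])
    have "fent \<mu> (pname \<alpha> J) \<le> fent \<mu> (\<lambda>x. (c x, names ?Z J x))"
    proof (rule fent_mono_kernel[OF sp finite_valued_pname[OF \<mu> \<alpha> J] finite_valued_pair[OF c fvN]])
      fix x y assume eq: "(c x, names ?Z J x) = (c y, names ?Z J y)"
      show "pname \<alpha> J x = pname \<alpha> J y"
        unfolding pname_def names_eq_iff
      proof
        fix g assume g: "g \<in> J"
        have Zeq: "Z (\<phi> g x) = Z (\<phi> g y)" using eq g by (auto simp: names_eq_iff)
        show "cell \<alpha> (\<phi> g x) = cell \<alpha> (\<phi> g y)"
        proof (cases "Z (\<phi> g x)")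
          case (Some A)
          then show ?thesis using Zeq by (auto simp: Z_def split: if_splits)
        next
          case None
          then obtain A B where AB: "A \<in> \<alpha>" "\<phi> g x \<in> Kc A" "B \<in> \<alpha>" "\<phi> g y \<in> Kc B"
            using Zeq by (auto simp: Z_def split: if_splits)
          have "dist (\<phi> g x) (\<phi> g y) \<le> dist (\<phi> g x) (\<phi> g (c x)) + dist (\<phi> g y) (\<phi> g (c x))"
            by (rule dist_triangle2)
          also have "\<dots> \<le> d / 3 + d / 3" using close[rule_format, OF g, of x] close[rule_format, OF g, of y] eq by simp
          also have "\<dots> < d" using d(1) by simp
          finally have "A = B" using d(2)[OF AB(1,3) _ AB(2,4)] by force
          then show ?thesis
            using cell_eq[OF p(1) AB(1)] Kc(2)[OF AB(1)] AB by auto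
        qed
      qed
    qed
    also have "\<dots> \<le> fent \<mu> c + fent \<mu> (names ?Z J)" by (rule fent_pair_le[OF sp c fvN])
    also have "fent \<mu> (names ?Z J) \<le> (\<Sum>g\<in>J. fent \<mu> (?Z g))" by (rule fent_names_le[OF sp J(1) fvZ(1)])
    also have "(\<Sum>g\<in>J. fent \<mu> (?Z g)) \<le> (\<Sum>g\<in>J. \<kappa>)" using fvZ(2) Z(1) by (intro sum_mono) simp
    finally have "a * real (card J) \<le> fent \<mu> c + real (card J) * \<kappa>" using a[OF J] by simp
    then show "(a - \<kappa>) * real (card J) \<le> fent \<mu> c" by (simp add: algebra_simps)
  qed
  then show ?thesis using d(1) by (intro exI[of _ "d / 3"]) auto
qed

lemma card_separated_le:
  assumes C: "finite C" "\<And>x::'x. \<exists>c\<in>C. dist c x < \<delta> / 2"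
    and J: "finite J" and E: "separated \<phi> J \<delta> E"
  shows "finite E \<and> card E \<le> card C ^ card J"
proof -
  obtain i where i: "\<And>x. i x \<in> C" "\<And>x. dist (i x) x < \<delta> / 2" using C(2) by metis
  have inj: "inj_on (names (\<lambda>g x. i (\<phi> g x)) J) E"
  proof (rule inj_onI, rule ccontr)
    fix x y assume xy: "x \<in> E" "y \<in> E" "names (\<lambda>g x. i (\<phi> g x)) J x = names (\<lambda>g x. i (\<phi> g x)) J y" "x \<noteq> y"
    then obtain g where g: "g \<in> J" "dist (\<phi> g x) (\<phi> g y) > \<delta>" using E by (auto simp: separated_def)
    have "i (\<phi> g x) = i (\<phi> g y)" using xy(3) g(1) by (simp add: names_eq_iff)
    then have "dist (\<phi> g x) (\<phi> g y) < \<delta>"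
      using i(2)[of "\<phi> g x"] i(2)[of "\<phi> g y"] by (metis dist_triangle_half_r)
    then show False using g by simp
  qed
  have sub: "names (\<lambda>g x. i (\<phi> g x)) J ` E \<subseteq> PiE J (\<lambda>_. C)" using i(1) by (auto simp: names_def)
  have fin: "finite (PiE J (\<lambda>_. C))" using C J by (simp add: finite_PiE)
  have "card (PiE J (\<lambda>_. C)) = card C ^ card J" using J by (simp add: card_PiE)
  then show ?thesis using card_inj_on_le[OF inj sub fin] inj_on_finite[OF inj sub fin] by simp
qed

lemma finite_net:
  assumes "\<delta> > 0"
  shows "\<exists>C. finite C \<and> C \<noteq> {} \<and> (\<forall>x::'x. \<exists>c\<in>C. dist c x < \<delta>)"
proof -
  have "\<forall>e>0. \<exists>k. finite k \<and> (UNIV :: 'x set) \<subseteq> (\<Union>x\<in>k. ball x e)"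
    using compact_space[unfolded compact_eq_totally_bounded] by (rule conjunct2)
  then obtain C where C: "finite C" "(UNIV :: 'x set) \<subseteq> (\<Union>c\<in>C. ball c \<delta>)" using assms by blast
  have "\<exists>c\<in>C. dist c x < \<delta>" for x using subsetD[OF C(2), of x] by simp
  then show ?thesis using C(1) by blast
qed

text \<open>A maximal separated set is also spanning; \<open>c x\<close> is the first of its points, in some order, that is close to \<open>x\<close>, which makes
  \<open>c\<close> measurable.\<close>

lemma nearest_separated_point:
  assumes J: "finite J" "J \<subseteq> carrier G" and \<delta>: "\<delta> > 0" and \<mu>: "\<mu> \<in> inv_probs G \<phi>"
  obtains E c where "finite E" "separated \<phi> J \<delta> E" "\<And>x. c x \<in> E" "finite_valued \<mu> c"
    "\<And>x g. g \<in> J \<Longrightarrow> dist (\<phi> g x) (\<phi> g (c x)) \<le> \<delta>"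
proof -
  have sb: "sets \<mu> = sets borel" by (rule inv_probsD[OF \<mu>])
  obtain E where E: "finite E" "separated \<phi> J \<delta> E" "card E = sep_card \<phi> UNIV J \<delta>"
    using sep_card_attained(1)[OF tds J \<delta>, of UNIV] by blast
  have span: "\<exists>e\<in>E. \<forall>g\<in>J. dist (\<phi> g x) (\<phi> g e) \<le> \<delta>" for x
  proof (rule ccontr)
    assume "\<not> ?thesis"
    then have far: "\<And>e. e \<in> E \<Longrightarrow> \<exists>g\<in>J. dist (\<phi> g x) (\<phi> g e) > \<delta>" by (auto simp: not_le)
    then have "x \<notin> E" using \<delta> by force
    have "separated \<phi> J \<delta> (insert x E)"
      using E(2) far unfolding separated_def by (auto simp: dist_commute)
    then have "card (insert x E) \<le> card E"
      using sep_card_attained(2)[OF tds J \<delta>, of "insert x E" UNIV] E(3) by simp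
    then show False using E(1) \<open>x \<notin> E\<close> by simp
  qed
  obtain es where es: "set es = E" using finite_list[OF E(1)] by blast
  define S where "S e = {x. \<forall>g\<in>J. dist (\<phi> g x) (\<phi> g e) \<le> \<delta>}" for e
  have Scl: "closed (S e)" for e
  proof -
    have "S e = (\<Inter>g\<in>J. {x. dist (\<phi> g x) (\<phi> g e) \<le> \<delta>})" by (auto simp: S_def)
    then show ?thesis using J(2)
      by (auto intro!: closed_INT closed_Collect_le continuous_intros continuous_act)
  qed
  define i where "i x = (LEAST k. k < length es \<and> x \<in> S (es ! k))" for x
  define c where "c x = es ! i x" for x
  have ex: "\<exists>k. k < length es \<and> x \<in> S (es ! k)" for x
  proof -
    obtain e where "e \<in> E" "x \<in> S e" using span[of x] by (auto simp: S_def)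
    then show ?thesis using es by (auto simp: in_set_conv_nth)
  qed
  have i: "i x < length es" "x \<in> S (es ! i x)" for x
    using LeastI_ex[OF ex[of x]] by (auto simp: i_def)
  have cE: "c x \<in> E" for x using i(1)[of x] es by (auto simp: c_def)
  have fv: "finite_valued \<mu> c"
    unfolding finite_valued_def
  proof (intro conjI allI)
    show "finite (range c)" using cE E(1) by (meson finite_subset image_subset_iff)
    fix v
    have ik: "i -` {k} = (if k < length es then S (es ! k) - (\<Union>j<k. S (es ! j)) else {})" for k
    proof -
      have "i x = k \<longleftrightarrow> k < length es \<and> x \<in> S (es ! k) \<and> (\<forall>j<k. x \<notin> S (es ! j))" for x
      proof
        assume eq: "i x = k"
        have "x \<notin> S (es ! j)" if "j < k" for j
        proof -
          have "\<not> (j < length es \<and> x \<in> S (es ! j))"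
            by (rule not_less_Least) (use that eq in \<open>simp add: i_def\<close>)
          then show ?thesis using that eq i(1)[of x] by simp
        qed
        then show "k < length es \<and> x \<in> S (es ! k) \<and> (\<forall>j<k. x \<notin> S (es ! j))"
          using i[of x] eq by simp
      next
        assume "k < length es \<and> x \<in> S (es ! k) \<and> (\<forall>j<k. x \<notin> S (es ! j))"
        then show "i x = k" unfolding i_def by (intro Least_equality) (auto simp: not_less[symmetric])
      qed
      then show ?thesis by auto
    qed
    have "i -` {k} \<in> sets \<mu>" for k
      unfolding ik sb using Scl by (auto intro!: sets.Diff sets.finite_UN borel_closed)
    then have "(\<Union>k\<in>{k. k < length es \<and> es ! k = v}. i -` {k}) \<in> sets \<mu>"
      by (intro sets.finite_UN) auto
    moreover have "c -` {v} = (\<Union>k\<in>{k. k < length es \<and> es ! k = v}. i -` {k})"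
      using i(1) by (auto simp: c_def)
    ultimately show "c -` {v} \<in> sets \<mu>" by simp
  qed
  show thesis
    using that[OF E(1,2) cE fv] i(2) by (auto simp: S_def c_def)
qed

lemma integral_act:
  assumes \<mu>: "\<mu> \<in> inv_probs G \<phi>" and g: "g \<in> carrier G" and f: "continuous_on UNIV f"
  shows "integrable \<mu> (\<lambda>x. f (\<phi> g x) :: real)" "(\<integral>x. f (\<phi> g x) \<partial>\<mu>) = (\<integral>x. f x \<partial>\<mu>)"
proof -
  interpret prob_space \<mu> by (rule inv_probsD(2)[OF \<mu>])
  have sb: "sets \<mu> = sets borel" by (rule inv_probsD[OF \<mu>])
  have fm: "f \<in> borel_measurable \<mu>"
    using borel_measurable_continuous_onI[OF f] measurable_cong_sets[OF sb refl] by blast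
  have "compact (range f)" using compact_continuous_image[OF f compact_space] .
  then obtain B where B: "\<And>x. \<bar>f x\<bar> \<le> B"
    using compact_imp_bounded bounded_iff by (metis rangeI real_norm_def)
  show "integrable \<mu> (\<lambda>x. f (\<phi> g x) :: real)"
    using B measurable_compose[OF inv_probsD(5)[OF \<mu> g] fm] by (intro integrable_const_bound[of _ B]) auto
  have "(\<integral>x. f x \<partial>\<mu>) = (\<integral>x. f x \<partial>distr \<mu> \<mu> (\<phi> g))" using inv_probsD(4)[OF \<mu> g] by simp
  also have "\<dots> = (\<integral>x. f (\<phi> g x) \<partial>\<mu>)" by (rule integral_distr[OF inv_probsD(5)[OF \<mu> g] fm])
  finally show "(\<integral>x. f (\<phi> g x) \<partial>\<mu>) = (\<integral>x. f x \<partial>\<mu>)" ..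
qed

lemma integral_finite_valued:
  assumes "prob_space \<mu>" "space \<mu> = UNIV" "finite_valued \<mu> c" "finite S" "range c \<subseteq> S"
  shows "integrable \<mu> (\<lambda>x. u (c x) :: real)" "(\<integral>x. u (c x) \<partial>\<mu>) = (\<Sum>e\<in>S. measure \<mu> (c -` {e}) * u e)"
proof -
  interpret prob_space \<mu> by fact
  have eq: "(\<lambda>x. u (c x)) = (\<lambda>x. \<Sum>e\<in>S. u e * indicator (c -` {e}) x)"
  proof
    fix x
    have "(\<Sum>e\<in>S. u e * indicator (c -` {e}) x) = (\<Sum>e\<in>S. if e = c x then u e else 0)"
      by (intro sum.cong) (auto simp: indicator_def)
    also have "\<dots> = u (c x)" using assms(4,5) by (subst sum.delta) auto
    finally show "u (c x) = (\<Sum>e\<in>S. u e * indicator (c -` {e}) x)" ..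
  qed
  have m: "c -` {e} \<in> events" for e using assms(3) by (simp add: finite_valued_def)
  have i: "integrable \<mu> (\<lambda>x. u e * indicator (c -` {e}) x)" for e
    using m by (intro integrable_mult_right integrable_real_indicator) (auto simp: emeasure_eq_measure)
  show "integrable \<mu> (\<lambda>x. u (c x) :: real)" unfolding eq using i by (intro Bochner_Integration.integrable_sum) auto
  show "(\<integral>x. u (c x) \<partial>\<mu>) = (\<Sum>e\<in>S. measure \<mu> (c -` {e}) * u e)"
    unfolding eq using i m assms(2) by (subst Bochner_Integration.integral_sum) (auto simp: mult.commute)
qed

text \<open>The image of \<open>\<mu>\<close> under \<open>nearest_separated_point\<close>, restricted to its support. The orbit sums have the right mean because \<open>\<mu>\<close>
  is invariant, for every \<open>J\<close>.\<close>

lemma separated_distribution: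
  assumes \<mu>: "\<mu> \<in> inv_probs G \<phi>" and floor: "entropy_floor \<mu> a \<delta>" and \<delta>: "\<delta> > 0"
    and J: "finite J" "J \<subseteq> carrier G"
    and fs: "\<And>f. f \<in> fs \<Longrightarrow> continuous_on UNIV f"
    and \<omega>: "\<And>f x y. f \<in> fs \<Longrightarrow> dist x y \<le> \<delta> \<Longrightarrow> \<bar>f x - f y\<bar> \<le> \<omega>"
  shows "\<exists>E p. finite E \<and> E \<noteq> {} \<and> separated \<phi> J \<delta> E \<and> (\<forall>e\<in>E. p e > 0) \<and> sum p E = (1::real) \<and>
     a * real (card J) \<le> (\<Sum>e\<in>E. p e * - ln (p e)) \<and>
     (\<forall>f\<in>fs. \<bar>(\<Sum>e\<in>E. p e * (\<Sum>g\<in>J. f (\<phi> g e))) - real (card J) * (\<integral>x. f x \<partial>\<mu>)\<bar> \<le> real (card J) * \<omega>)"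
proof -
  interpret prob_space \<mu> by (rule inv_probsD(2)[OF \<mu>])
  have sp: "space \<mu> = UNIV" by (rule inv_probsD[OF \<mu>])
  obtain E0 c where E0: "finite E0" "separated \<phi> J \<delta> E0" and c: "\<And>x. c x \<in> E0" "finite_valued \<mu> c"
    "\<And>x g. g \<in> J \<Longrightarrow> dist (\<phi> g x) (\<phi> g (c x)) \<le> \<delta>"
    by (rule nearest_separated_point[OF J \<delta> \<mu>]) blast
  define p where "p e = prob (c -` {e})" for e
  define E where "E = {e\<in>E0. p e > 0}"
  have sub: "range c \<subseteq> E0" using c(1) by auto
  have restr: "(\<Sum>e\<in>E0. p e * u e) = (\<Sum>e\<in>E. p e * u e)" for u :: "'x \<Rightarrow> real"
  proof (rule sum.mono_neutral_right[OF E0(1)])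
    show "E \<subseteq> E0" by (auto simp: E_def)
    have "p e = 0" if "e \<in> E0 - E" for e
    proof -
      have "p e \<ge> 0" by (simp add: p_def)
      then show ?thesis using that by (auto simp: E_def)
    qed
    then show "\<forall>e\<in>E0 - E. p e * u e = 0" by simp
  qed
  have int: "(\<integral>x. u (c x) \<partial>\<mu>) = (\<Sum>e\<in>E. p e * u e)" "integrable \<mu> (\<lambda>x. u (c x))" for u :: "'x \<Rightarrow> real"
    using integral_finite_valued[OF prob_space_axioms sp c(2) E0(1) sub, of u]
    by (auto simp: p_def[symmetric] restr)
  have one: "sum p E = 1" using int(1)[of "\<lambda>_. 1"] prob_space by simp
  have ent: "fent \<mu> c = (\<Sum>e\<in>E. p e * - ln (p e))"
    using restr[of "\<lambda>e. - ln (p e)"] by (subst fent_sum[OF E0(1) sub]) (simp add: p_def sum_negf)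
  have "a * real (card J) \<le> fent \<mu> c"
    using floor J c(2,3) unfolding entropy_floor_def by blast
  moreover have "\<bar>(\<Sum>e\<in>E. p e * (\<Sum>g\<in>J. f (\<phi> g e))) - real (card J) * (\<integral>x. f x \<partial>\<mu>)\<bar> \<le> real (card J) * \<omega>"
    if f: "f \<in> fs" for f
  proof -
    let ?u = "\<lambda>x. \<Sum>g\<in>J. f (\<phi> g x)"
    have ig: "integrable \<mu> (\<lambda>x. f (\<phi> g x))" "(\<integral>x. f (\<phi> g x) \<partial>\<mu>) = (\<integral>x. f x \<partial>\<mu>)" if "g \<in> J" for g
      using integral_act[OF \<mu> _ fs[OF f]] that J by auto
    have i2: "integrable \<mu> ?u" using ig(1) by (intro Bochner_Integration.integrable_sum)
    have e2: "(\<integral>x. ?u x \<partial>\<mu>) = real (card J) * (\<integral>x. f x \<partial>\<mu>)"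
      using ig by (subst Bochner_Integration.integral_sum) auto
    have "\<bar>(\<integral>x. ?u (c x) \<partial>\<mu>) - (\<integral>x. ?u x \<partial>\<mu>)\<bar> = \<bar>\<integral>x. ?u (c x) - ?u x \<partial>\<mu>\<bar>"
      using int(2)[of ?u] i2 by simp
    also have "\<dots> \<le> (\<integral>x. \<bar>?u (c x) - ?u x\<bar> \<partial>\<mu>)" by (rule integral_abs_bound)
    also have "\<dots> \<le> (\<integral>x. real (card J) * \<omega> \<partial>\<mu>)"
    proof (rule integral_mono)
      show "integrable \<mu> (\<lambda>x. \<bar>?u (c x) - ?u x\<bar>)" using int(2)[of ?u] i2 by (intro integrable_abs Bochner_Integration.integrable_diff)
      fix x
      have "\<bar>?u (c x) - ?u x\<bar> = \<bar>\<Sum>g\<in>J. f (\<phi> g (c x)) - f (\<phi> g x)\<bar>" by (simp add: sum_subtractf)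
      also have "\<dots> \<le> (\<Sum>g\<in>J. \<bar>f (\<phi> g (c x)) - f (\<phi> g x)\<bar>)" by (rule sum_abs)
      also have "\<dots> \<le> (\<Sum>g\<in>J. \<omega>)" using \<omega>[OF f] c(3) by (intro sum_mono) (simp add: dist_commute)
      finally show "\<bar>?u (c x) - ?u x\<bar> \<le> real (card J) * \<omega>" by simp
    qed simp
    also have "\<dots> = real (card J) * \<omega>" using prob_space by simp
    finally show ?thesis unfolding e2 int(1)[of ?u] .
  qed
  moreover have "separated \<phi> J \<delta> E" using E0(2) unfolding separated_def E_def by blast
  moreover have "E \<noteq> {}" using one by auto
  moreover have "finite E" "\<forall>e\<in>E. p e > 0" using E0(1) by (auto simp: E_def)
  ultimately show ?thesis using one ent by (intro exI[of _ E] exI[of _ p]) auto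
qed

end

section \<open>Typical sequences in a finite product\<close>

lemma sum_product_weights:
  fixes p :: "'j \<Rightarrow> 'e \<Rightarrow> real"
  assumes J: "finite J" and E: "\<And>j. j \<in> J \<Longrightarrow> finite (E j)" and one: "\<And>j. j \<in> J \<Longrightarrow> sum (p j) (E j) = 1"
  shows "(\<Sum>\<omega>\<in>PiE J E. \<Prod>j\<in>J. p j (\<omega> j)) = 1"
  using prod_sum_PiE[of J E p] J E one by simp

text \<open>Independent centred coordinates are orthogonal.\<close>

lemma variance_of_product:
  fixes p v :: "'j \<Rightarrow> 'e \<Rightarrow> real"
  assumes J: "finite J" and E: "\<And>j. j \<in> J \<Longrightarrow> finite (E j)" and one: "\<And>j. j \<in> J \<Longrightarrow> sum (p j) (E j) = 1"
    and mean: "\<And>j. j \<in> J \<Longrightarrow> (\<Sum>e\<in>E j. p j e * v j e) = 0"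
  shows "(\<Sum>\<omega>\<in>PiE J E. (\<Prod>j\<in>J. p j (\<omega> j)) * (\<Sum>j\<in>J. v j (\<omega> j))\<^sup>2) = (\<Sum>j\<in>J. \<Sum>e\<in>E j. p j e * (v j e)\<^sup>2)"
proof -
  have pair: "(\<Sum>\<omega>\<in>PiE J E. (\<Prod>i\<in>J. p i (\<omega> i)) * (v j (\<omega> j) * v k (\<omega> k))) =
     (if j = k then \<Sum>e\<in>E j. p j e * (v j e)\<^sup>2 else 0)" if jk: "j \<in> J" "k \<in> J" for j k
  proof -
    \<comment> \<open>writes the mixed moment as a product over the coordinates, with centred factors at \<open>j \<noteq> k\<close>\<close>
    define q where "q i e = p i e * (if i = j then v j e else 1) * (if i = k then v k e else 1)" for i e
    have "(\<Prod>i\<in>J. q i (\<omega> i)) = (\<Prod>i\<in>J. p i (\<omega> i)) * (v j (\<omega> j) * v k (\<omega> k))" for \<omega>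
      using J jk unfolding q_def prod.distrib by (simp add: prod.delta)
    then have "(\<Sum>\<omega>\<in>PiE J E. (\<Prod>i\<in>J. p i (\<omega> i)) * (v j (\<omega> j) * v k (\<omega> k))) = (\<Sum>\<omega>\<in>PiE J E. \<Prod>i\<in>J. q i (\<omega> i))"
      by simp
    also have "\<dots> = (\<Prod>i\<in>J. \<Sum>e\<in>E i. q i e)" using prod_sum_PiE[of J E q] J E by simp
    also have "\<dots> = (if j = k then \<Sum>e\<in>E j. p j e * (v j e)\<^sup>2 else 0)"
    proof (cases "j = k")
      case False
      then have "(\<Sum>e\<in>E j. q j e) = 0" using mean[OF jk(1)] by (simp add: q_def)
      then show ?thesis using J jk False by (auto intro: prod_zero)
    next
      case True
      have "(\<Prod>i\<in>J - {j}. \<Sum>e\<in>E i. q i e) = 1"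
        by (intro prod.neutral ballI) (use True one in \<open>auto simp: q_def\<close>)
      then show ?thesis using True prod.remove[OF J jk(1), of "\<lambda>i. \<Sum>e\<in>E i. q i e"]
        by (simp add: q_def power2_eq_square mult.assoc)
    qed
    finally show ?thesis .
  qed
  have sq: "(\<Sum>j\<in>J. v j (\<omega> j))\<^sup>2 = (\<Sum>j\<in>J. \<Sum>k\<in>J. v j (\<omega> j) * v k (\<omega> k))" for \<omega>
    unfolding power2_eq_square by (rule sum_product)
  have "(\<Sum>\<omega>\<in>PiE J E. (\<Prod>j\<in>J. p j (\<omega> j)) * (\<Sum>j\<in>J. v j (\<omega> j))\<^sup>2) =
      (\<Sum>\<omega>\<in>PiE J E. \<Sum>j\<in>J. \<Sum>k\<in>J. (\<Prod>i\<in>J. p i (\<omega> i)) * (v j (\<omega> j) * v k (\<omega> k)))"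
    by (simp only: sq sum_distrib_left)
  also have "\<dots> = (\<Sum>j\<in>J. \<Sum>\<omega>\<in>PiE J E. \<Sum>k\<in>J. (\<Prod>i\<in>J. p i (\<omega> i)) * (v j (\<omega> j) * v k (\<omega> k)))"
    by (rule sum.swap)
  also have "\<dots> = (\<Sum>j\<in>J. \<Sum>k\<in>J. \<Sum>\<omega>\<in>PiE J E. (\<Prod>i\<in>J. p i (\<omega> i)) * (v j (\<omega> j) * v k (\<omega> k)))"
    by (intro sum.cong refl sum.swap)
  also have "\<dots> = (\<Sum>j\<in>J. \<Sum>k\<in>J. if j = k then \<Sum>e\<in>E j. p j e * (v j e)\<^sup>2 else 0)"
    by (intro sum.cong refl pair)
  also have "\<dots> = (\<Sum>j\<in>J. \<Sum>e\<in>E j. p j e * (v j e)\<^sup>2)"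
    using J by simp
  finally show ?thesis .
qed

text \<open>Chebyshev's inequality; the variance of a coordinate is at most its second moment.\<close>

lemma weak_law_of_product:
  fixes p u :: "'j \<Rightarrow> 'e \<Rightarrow> real"
  assumes J: "finite J" and E: "\<And>j. j \<in> J \<Longrightarrow> finite (E j)" and one: "\<And>j. j \<in> J \<Longrightarrow> sum (p j) (E j) = 1"
    and p: "\<And>j e. j \<in> J \<Longrightarrow> e \<in> E j \<Longrightarrow> p j e \<ge> 0"
    and V: "\<And>j. j \<in> J \<Longrightarrow> (\<Sum>e\<in>E j. p j e * (u j e)\<^sup>2) \<le> V" and s: "s > 0"
  shows "(\<Sum>\<omega>\<in>{\<omega>\<in>PiE J E. \<bar>(\<Sum>j\<in>J. u j (\<omega> j)) - (\<Sum>j\<in>J. \<Sum>e\<in>E j. p j e * u j e)\<bar> > s}. \<Prod>j\<in>J. p j (\<omega> j))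
     \<le> real (card J) * V / s\<^sup>2" (is "sum ?P ?bad \<le> _")
proof -
  define m where "m j = (\<Sum>e\<in>E j. p j e * u j e)" for j
  define v where "v j e = u j e - m j" for j e
  have fin: "finite (PiE J E)" using J E by (simp add: finite_PiE)
  have P0: "?P \<omega> \<ge> 0" if "\<omega> \<in> PiE J E" for \<omega> using that p by (intro prod_nonneg) (auto simp: PiE_def Pi_def)
  have "s\<^sup>2 * sum ?P ?bad = (\<Sum>\<omega>\<in>?bad. ?P \<omega> * s\<^sup>2)" by (simp add: sum_distrib_left mult.commute)
  also have "\<dots> \<le> (\<Sum>\<omega>\<in>?bad. ?P \<omega> * (\<Sum>j\<in>J. v j (\<omega> j))\<^sup>2)"
  proof (intro sum_mono mult_left_mono)
    fix \<omega> assume w: "\<omega> \<in> ?bad"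
    have "(\<Sum>j\<in>J. v j (\<omega> j)) = (\<Sum>j\<in>J. u j (\<omega> j)) - (\<Sum>j\<in>J. \<Sum>e\<in>E j. p j e * u j e)"
      by (simp add: v_def m_def sum_subtractf)
    then have "s < \<bar>\<Sum>j\<in>J. v j (\<omega> j)\<bar>" using w by simp
    then have "s\<^sup>2 \<le> \<bar>\<Sum>j\<in>J. v j (\<omega> j)\<bar>\<^sup>2" using s by (intro power_mono) auto
    then show "s\<^sup>2 \<le> (\<Sum>j\<in>J. v j (\<omega> j))\<^sup>2" by simp
    show "0 \<le> ?P \<omega>" using w P0 by blast
  qed
  also have "\<dots> \<le> (\<Sum>\<omega>\<in>PiE J E. ?P \<omega> * (\<Sum>j\<in>J. v j (\<omega> j))\<^sup>2)"
    using P0 fin by (intro sum_mono2) (auto simp del: PiE_iff)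
  also have "\<dots> = (\<Sum>j\<in>J. \<Sum>e\<in>E j. p j e * (v j e)\<^sup>2)"
  proof (rule variance_of_product[OF J E one])
    show "(\<Sum>e\<in>E j. p j e * v j e) = 0" if "j \<in> J" for j
      using one[OF that] by (simp add: v_def algebra_simps sum_subtractf sum_distrib_left[symmetric] m_def[symmetric])
  qed
  also have "\<dots> \<le> (\<Sum>j\<in>J. V)"
  proof (rule sum_mono)
    fix j assume j: "j \<in> J"
    have "(\<Sum>e\<in>E j. p j e * (v j e)\<^sup>2) = (\<Sum>e\<in>E j. p j e * (u j e)\<^sup>2 - 2 * m j * (p j e * u j e) + (m j)\<^sup>2 * p j e)"
      by (intro sum.cong refl) (simp add: v_def power2_eq_square algebra_simps)
    also have "\<dots> = (\<Sum>e\<in>E j. p j e * (u j e)\<^sup>2) - 2 * m j * m j + (m j)\<^sup>2 * 1"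
      by (simp add: sum.distrib sum_subtractf sum_distrib_left[symmetric] m_def[symmetric] one[OF j])
    also have "\<dots> \<le> V"
    proof -
      have "0 \<le> m j * m j" by simp
      then show ?thesis using V[OF j] unfolding power2_eq_square by linarith
    qed
    finally show "(\<Sum>e\<in>E j. p j e * (v j e)\<^sup>2) \<le> V" .
  qed
  finally have "s\<^sup>2 * sum ?P ?bad \<le> real (card J) * V" by simp
  then show ?thesis using s by (simp add: field_simps)
qed

text \<open>Bounds the second moment of the information \<open>- ln p\<close> by four times the number of outcomes.\<close>

lemma mult_ln_square_le: "p * (ln p)\<^sup>2 \<le> 4" if "0 < p" "p \<le> 1" for p :: real
proof -
  define q where "q = sqrt p"
  have q: "0 < q" "q \<le> 1" "p = q\<^sup>2" using that by (auto simp: q_def)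
  have "ln (inverse q) \<le> inverse q - 1" using q by (intro ln_le_minus_one) simp
  then have "q * (- ln q) \<le> q * (inverse q - 1)" using q by (intro mult_left_mono) (auto simp: ln_inverse)
  also have "\<dots> = 1 - q" using q by (simp add: algebra_simps)
  finally have "q * (- ln q) \<le> 1" using q by simp
  moreover have "0 \<le> q * (- ln q)" using q by (intro mult_nonneg_nonneg) auto
  ultimately have "(q * (- ln q))\<^sup>2 \<le> 1" by (rule power_le_one[rotated])
  moreover have "p * (ln p)\<^sup>2 = 4 * (q * (- ln q))\<^sup>2"
    using q(1) by (simp add: q(3) ln_realpow power_mult_distrib)
  ultimately show ?thesis by simp
qed

text \<open>The weak law is applied to the functions \<open>u t\<close> and also to the information \<open>- ln (p j e)\<close>. A sequence typical for the latter
  has probability at most \<open>exp (s - H)\<close>, where \<open>H\<close> is the total entropy; since the typical sequences have probability at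
  least one half, there are at least \<open>exp (H - s) / 2\<close> of them.\<close>

lemma typical_sequences:
  fixes p :: "'j \<Rightarrow> 'e \<Rightarrow> real" and u :: "'t \<Rightarrow> 'j \<Rightarrow> 'e \<Rightarrow> real"
  assumes J: "finite J" and E: "\<And>j. j \<in> J \<Longrightarrow> finite (E j)" and one: "\<And>j. j \<in> J \<Longrightarrow> sum (p j) (E j) = 1"
    and p: "\<And>j e. j \<in> J \<Longrightarrow> e \<in> E j \<Longrightarrow> p j e > 0" and T: "finite T"
    and V: "\<And>t j. t \<in> T \<Longrightarrow> j \<in> J \<Longrightarrow> (\<Sum>e\<in>E j. p j e * (u t j e)\<^sup>2) \<le> V"
    and V4: "\<And>j. j \<in> J \<Longrightarrow> 4 * real (card (E j)) \<le> V"
    and s: "s > 0" "(real (card T) + 1) * (real (card J) * V) \<le> s\<^sup>2 / 2"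
  shows "\<exists>\<Omega>. \<Omega> \<subseteq> PiE J E \<and> exp ((\<Sum>j\<in>J. \<Sum>e\<in>E j. p j e * - ln (p j e)) - s) / 2 \<le> real (card \<Omega>) \<and>
     (\<forall>\<omega>\<in>\<Omega>. \<forall>t\<in>T. \<bar>(\<Sum>j\<in>J. u t j (\<omega> j)) - (\<Sum>j\<in>J. \<Sum>e\<in>E j. p j e * u t j e)\<bar> \<le> s)"
proof -
  let ?P = "\<lambda>\<omega>. \<Prod>j\<in>J. p j (\<omega> j)"
  \<comment> \<open>the index \<open>None\<close> stands for the information function\<close>
  define w where "w t = (case t of None \<Rightarrow> (\<lambda>j e. - ln (p j e)) | Some t \<Rightarrow> u t)" for t :: "'t option"
  define T' where "T' = insert None (Some ` T)"
  have T': "finite T'" "card T' = card T + 1" using T by (auto simp: T'_def card_image)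
  define bad where "bad t = {\<omega>\<in>PiE J E. \<bar>(\<Sum>j\<in>J. w t j (\<omega> j)) - (\<Sum>j\<in>J. \<Sum>e\<in>E j. p j e * w t j e)\<bar> > s}" for t
  define \<Omega> where "\<Omega> = PiE J E - (\<Union>t\<in>T'. bad t)"
  have fin: "finite (PiE J E)" using J E by (simp add: finite_PiE)
  have p0: "p j e \<ge> 0" if "j \<in> J" "e \<in> E j" for j e using p[OF that] by simp
  have P0: "?P \<omega> > 0" if "\<omega> \<in> PiE J E" for \<omega> using that p by (intro prod_pos) (auto simp: PiE_def Pi_def)
  have Pb: "sum ?P (bad t) \<le> real (card J) * V / s\<^sup>2" if t: "t \<in> T'" for t
    unfolding bad_def
  proof (rule weak_law_of_product[OF J E one p0 _ s(1)])
    fix j assume j: "j \<in> J"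
    show "(\<Sum>e\<in>E j. p j e * (w t j e)\<^sup>2) \<le> V"
    proof (cases t)
      case None
      have "(\<Sum>e\<in>E j. p j e * (ln (p j e))\<^sup>2) \<le> (\<Sum>e\<in>E j. 4)"
      proof (intro sum_mono mult_ln_square_le)
        fix e assume e: "e \<in> E j"
        show "0 < p j e" by (rule p[OF j e])
        have "p j e \<le> sum (p j) (E j)" using e E[OF j] p0[OF j] by (intro member_le_sum) auto
        then show "p j e \<le> 1" using one[OF j] by simp
      qed
      then show ?thesis using V4[OF j] None by (simp add: w_def)
    next
      case (Some t')
      then show ?thesis using V[of t' j] j t by (auto simp: w_def T'_def)
    qed
  qed
  have restr: "(\<Sum>\<omega>\<in>PiE J E. if \<omega> \<in> A then ?P \<omega> else 0) = sum ?P A" if "A \<subseteq> PiE J E" for A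
    using sum.inter_restrict[OF fin, of ?P A] that by (simp add: Int_absorb1)
  have "1 = sum ?P (PiE J E)" using sum_product_weights[OF J E one] by simp
  also have "\<dots> \<le> (\<Sum>\<omega>\<in>PiE J E. (if \<omega> \<in> \<Omega> then ?P \<omega> else 0) + (\<Sum>t\<in>T'. if \<omega> \<in> bad t then ?P \<omega> else 0))"
  proof (rule sum_mono)
    fix \<omega> assume w: "\<omega> \<in> PiE J E"
    note pos = P0[OF w]
    show "?P \<omega> \<le> (if \<omega> \<in> \<Omega> then ?P \<omega> else 0) + (\<Sum>t\<in>T'. if \<omega> \<in> bad t then ?P \<omega> else 0)"
    proof (cases "\<omega> \<in> \<Omega>")
      case True
      have "(\<Sum>t\<in>T'. if \<omega> \<in> bad t then ?P \<omega> else 0) \<ge> 0" using pos by (intro sum_nonneg) auto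
      then show ?thesis using True by simp
    next
      case False
      then obtain t where t: "t \<in> T'" "\<omega> \<in> bad t" using w by (auto simp: \<Omega>_def)
      have "(if \<omega> \<in> bad t then ?P \<omega> else 0) \<le> (\<Sum>t\<in>T'. if \<omega> \<in> bad t then ?P \<omega> else 0)"
        using t(1) T'(1) pos by (intro member_le_sum[of t T' "\<lambda>t. if \<omega> \<in> bad t then ?P \<omega> else 0"]) auto
      then show ?thesis using t(2) False by simp
    qed
  qed
  also have "\<dots> = sum ?P \<Omega> + (\<Sum>t\<in>T'. sum ?P (bad t))"
    unfolding sum.distrib
  proof (intro arg_cong2[of _ _ _ _ "(+)"])
    show "(\<Sum>\<omega>\<in>PiE J E. if \<omega> \<in> \<Omega> then ?P \<omega> else 0) = sum ?P \<Omega>" by (rule restr) (auto simp: \<Omega>_def)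
    have "(\<Sum>\<omega>\<in>PiE J E. \<Sum>t\<in>T'. if \<omega> \<in> bad t then ?P \<omega> else 0) =
        (\<Sum>t\<in>T'. \<Sum>\<omega>\<in>PiE J E. if \<omega> \<in> bad t then ?P \<omega> else 0)" by (rule sum.swap)
    also have "\<dots> = (\<Sum>t\<in>T'. sum ?P (bad t))" by (intro sum.cong refl restr) (auto simp: bad_def)
    finally show "(\<Sum>\<omega>\<in>PiE J E. \<Sum>t\<in>T'. if \<omega> \<in> bad t then ?P \<omega> else 0) = (\<Sum>t\<in>T'. sum ?P (bad t))" .
  qed
  also have "(\<Sum>t\<in>T'. sum ?P (bad t)) \<le> (\<Sum>t\<in>T'. real (card J) * V / s\<^sup>2)" by (intro sum_mono Pb)
  also have "\<dots> = (real (card T) + 1) * (real (card J) * V) / s\<^sup>2" by (simp add: T'(2))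
  also have "\<dots> \<le> (s\<^sup>2 / 2) / s\<^sup>2" using s by (intro divide_right_mono) auto
  also have "\<dots> = 1 / 2" using s by simp
  finally have half: "1 / 2 \<le> sum ?P \<Omega>" by simp
  define H where "H = (\<Sum>j\<in>J. \<Sum>e\<in>E j. p j e * - ln (p j e))"
  have le: "?P \<omega> \<le> exp (s - H)" if "\<omega> \<in> \<Omega>" for \<omega>
  proof -
    have w: "\<omega> \<in> PiE J E" "\<omega> \<notin> bad None" using that by (auto simp: \<Omega>_def T'_def)
    then have "\<bar>(\<Sum>j\<in>J. - ln (p j (\<omega> j))) - H\<bar> \<le> s" by (auto simp: bad_def w_def H_def not_less)
    then have "(\<Sum>j\<in>J. ln (p j (\<omega> j))) \<le> s - H" by (simp add: sum_negf abs_le_iff)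
    moreover have "?P \<omega> = exp (\<Sum>j\<in>J. ln (p j (\<omega> j)))"
      unfolding exp_sum[OF J] using w(1) p by (intro prod.cong refl) (auto simp: PiE_def Pi_def)
    ultimately show ?thesis by simp
  qed
  have "1 / 2 \<le> real (card \<Omega>) * exp (s - H)"
    using half sum_bounded_above[of \<Omega> ?P "exp (s - H)"] le by (simp add: mult.commute)
  then have "1 / 2 * exp (H - s) \<le> real (card \<Omega>) * exp (s - H) * exp (H - s)" by (intro mult_right_mono) auto
  also have "\<dots> = real (card \<Omega>)" by (simp add: mult.assoc exp_add[symmetric])
  finally have "exp (H - s) / 2 \<le> real (card \<Omega>)" by simp
  moreover have "\<Omega> \<subseteq> PiE J E" by (auto simp: \<Omega>_def)
  moreover have "\<bar>(\<Sum>j\<in>J. u t j (\<omega> j)) - (\<Sum>j\<in>J. \<Sum>e\<in>E j. p j e * u t j e)\<bar> \<le> s" if "\<omega> \<in> \<Omega>" "t \<in> T" for \<omega> t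
  proof -
    have "\<omega> \<in> PiE J E" "\<omega> \<notin> bad (Some t)" using that by (auto simp: \<Omega>_def T'_def)
    then show ?thesis by (auto simp: bad_def w_def not_less)
  qed
  ultimately show ?thesis unfolding H_def by (intro exI[of _ \<Omega>]) simp
qed

section \<open>Specification and typical orbit segments\<close>

lemma (in G_system) uniform_modulus:
  fixes fs :: "('x \<Rightarrow> real) set"
  assumes "finite fs" "\<And>f. f \<in> fs \<Longrightarrow> continuous_on UNIV f" "\<omega> > 0"
  shows "\<exists>d>0. \<forall>f\<in>fs. \<forall>x y. dist x y \<le> d \<longrightarrow> \<bar>f x - f y\<bar> \<le> \<omega>"
  using assms(1,2)
proof (induction fs rule: finite_induct)
  case empty then show ?case by (intro exI[of _ 1]) auto
next
  case (insert f fs)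
  obtain d where d: "d > 0" "\<forall>f\<in>fs. \<forall>x y. dist x y \<le> d \<longrightarrow> \<bar>f x - f y\<bar> \<le> \<omega>" using insert by auto
  have "uniformly_continuous_on UNIV f"
    using insert compact_space by (intro compact_uniformly_continuous) auto
  then obtain d' where d': "d' > 0" "\<And>x y. dist x y < d' \<Longrightarrow> \<bar>f x - f y\<bar> < \<omega>"
    using assms(3) unfolding uniformly_continuous_on_def dist_real_def by (metis UNIV_I dist_commute abs_minus_commute)
  have "\<bar>f x - f y\<bar> \<le> \<omega>" if "dist x y \<le> min d (d' / 2)" for x y
    using d'(2)[of x y] that d'(1) by force
  then show ?case using d d'(1)
    by (intro exI[of _ "min d (d' / 2)"]) auto
qed

lemma (in G_system) uniform_bound:
  fixes fs :: "('x \<Rightarrow> real) set"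
  assumes "finite fs" "\<And>f. f \<in> fs \<Longrightarrow> continuous_on UNIV f"
  shows "\<exists>B>0. \<forall>f\<in>fs. \<forall>x. \<bar>f x\<bar> \<le> B"
  using assms
proof (induction fs rule: finite_induct)
  case empty then show ?case by (intro exI[of _ 1]) auto
next
  case (insert f fs)
  obtain B where B: "B > 0" "\<forall>f\<in>fs. \<forall>x. \<bar>f x\<bar> \<le> B" using insert by auto
  have "compact (range f)" using compact_continuous_image[OF _ compact_space, of f] insert by auto
  then obtain B' where B': "\<And>x. \<bar>f x\<bar> \<le> B'"
    using compact_imp_bounded bounded_iff by (metis rangeI real_norm_def)
  have "\<forall>g\<in>insert f fs. \<forall>x. \<bar>g x\<bar> \<le> max B B'"
    using B(2) B' by (auto simp: le_max_iff_disj)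
  then show ?case using B(1) by (intro exI[of _ "max B B'"]) auto
qed

context G_system begin

text \<open>Specification with constant \<open>K\<close> at scale \<open>\<epsilon>\<close>, for families of any cardinality.\<close>

definition traceable :: "real \<Rightarrow> 'g set \<Rightarrow> bool" where
  "traceable \<epsilon> K \<longleftrightarrow> (\<forall>P x. (\<forall>I\<in>P. finite I \<and> I \<subseteq> carrier G) \<and> K_separated K P \<longrightarrow>
     (\<exists>y. \<forall>I\<in>P. \<forall>s\<in>I. dist (\<phi> s (x I)) (\<phi> s y) \<le> \<epsilon>))"

text \<open>For an infinite family the points tracing one orbit segment form a closed set, and specification gives the finite intersection
  property.\<close>

lemma specification_traceable:
  assumes spec: "specification_property G \<phi>" and \<epsilon>: "\<epsilon> > 0"
  shows "\<exists>K. finite K \<and> K \<subseteq> carrier G \<and> traceable \<epsilon> K"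
proof -
  obtain K where K: "K \<subseteq> carrier G" "finite K"
    and tr: "\<And>(m::nat) (F :: nat \<Rightarrow> 'g set) (x :: nat \<Rightarrow> 'x).
           (\<forall>i\<in>{1..m}. F i \<subseteq> carrier G \<and> finite (F i)) \<and>
           (\<forall>i\<in>{1..m}. \<forall>j\<in>{1..m}. i \<noteq> j \<longrightarrow> (K <#> F i) \<inter> F j = {}) \<Longrightarrow>
           (\<exists>y. \<forall>i\<in>{1..m}. \<forall>s\<in>F i. dist (\<phi> s (x i)) (\<phi> s y) \<le> \<epsilon>)"
    using spec[unfolded specification_property_def, rule_format, OF \<epsilon>] by (elim exE conjE) (rule that, auto)
  have fin: "\<exists>y. \<forall>I\<in>P. \<forall>s\<in>I. dist (\<phi> s (x I)) (\<phi> s y) \<le> \<epsilon>"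
    if P: "finite P" "\<And>I. I \<in> P \<Longrightarrow> finite I \<and> I \<subseteq> carrier G" "K_separated K P" for P and x :: "'g set \<Rightarrow> 'x"
  proof -
    obtain h where h: "bij_betw h {1..card P} P" using ex_bij_betw_nat_finite_1[OF P(1)] by blast
    have hP: "h i \<in> P" if "i \<in> {1..card P}" for i using h that by (auto simp: bij_betw_def)
    have "(K <#> h i) \<inter> h j = {}" if "i \<in> {1..card P}" "j \<in> {1..card P}" "i \<noteq> j" for i j
    proof -
      have "h i \<noteq> h j" using h that by (meson bij_betw_def inj_on_def)
      then show ?thesis using P(3) hP that by (simp add: K_separated_def)
    qed
    then obtain y where y: "\<forall>i\<in>{1..card P}. \<forall>s\<in>h i. dist (\<phi> s (x (h i))) (\<phi> s y) \<le> \<epsilon>"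
      using tr[of "card P" h "\<lambda>i. x (h i)"] P(2) hP by blast
    have "\<forall>s\<in>I. dist (\<phi> s (x I)) (\<phi> s y) \<le> \<epsilon>" if I: "I \<in> P" for I
    proof -
      have "I \<in> h ` {1..card P}" using h I by (simp add: bij_betw_def)
      then show ?thesis using y by auto
    qed
    then show ?thesis by blast
  qed
  have "traceable \<epsilon> K"
    unfolding traceable_def
  proof (intro allI impI, elim conjE)
    fix P and x :: "'g set \<Rightarrow> 'x"
    assume P: "\<forall>I\<in>P. finite I \<and> I \<subseteq> carrier G" "K_separated K P"
    define S where "S I = {y. \<forall>s\<in>I. dist (\<phi> s (x I)) (\<phi> s y) \<le> \<epsilon>}" for I
    have "UNIV \<inter> (\<Inter>I\<in>P. S I) \<noteq> {}"
    proof (rule compact_imp_fip_image[OF compact_space])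
      fix I assume "I \<in> P"
      have "S I = (\<Inter>s\<in>I. {y. dist (\<phi> s (x I)) (\<phi> s y) \<le> \<epsilon>})" by (auto simp: S_def)
      then show "closed (S I)" using P(1) \<open>I \<in> P\<close>
        by (auto intro!: closed_INT closed_Collect_le continuous_intros continuous_act)
    next
      fix P' assume P': "finite P'" "P' \<subseteq> P"
      have "K_separated K P'" using P(2) P'(2) by (auto simp: K_separated_def)
      then obtain y where "\<forall>I\<in>P'. \<forall>s\<in>I. dist (\<phi> s (x I)) (\<phi> s y) \<le> \<epsilon>"
        using fin[OF P'(1)] P(1) P'(2) by blast
      then have "y \<in> UNIV \<inter> (\<Inter>I\<in>P'. S I)" by (simp add: S_def)
      then show "UNIV \<inter> (\<Inter>I\<in>P'. S I) \<noteq> {}" by blast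
    qed
    then show "\<exists>y. \<forall>I\<in>P. \<forall>s\<in>I. dist (\<phi> s (x I)) (\<phi> s y) \<le> \<epsilon>" by (auto simp: S_def)
  qed
  then show ?thesis using K by blast
qed

lemma K_separated_mono: "K_separated K' P \<Longrightarrow> K \<subseteq> K' \<Longrightarrow> K_separated K P"
proof -
  assume *: "K_separated K' P" "K \<subseteq> K'"
  have "K <#> I \<subseteq> K' <#> I" for I using *(2) by (auto simp: set_mult_def)
  then have "(K <#> I) \<inter> J = {}" if "(K' <#> I) \<inter> J = {}" for I J using that by blast
  then show ?thesis using *(1) by (simp add: K_separated_def)
qed

lemma traceable_mono: "traceable \<epsilon> K \<Longrightarrow> K \<subseteq> K' \<Longrightarrow> traceable \<epsilon> K'"
proof -
  assume tr: "traceable \<epsilon> K" and sub: "K \<subseteq> K'"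
  show ?thesis
    unfolding traceable_def
  proof (intro allI impI)
    fix P and x :: "'g set \<Rightarrow> 'x"
    assume "(\<forall>I\<in>P. finite I \<and> I \<subseteq> carrier G) \<and> K_separated K' P"
    then have "(\<forall>I\<in>P. finite I \<and> I \<subseteq> carrier G) \<and> K_separated K P"
      using K_separated_mono[OF _ sub] by simp
    then show "\<exists>y. \<forall>I\<in>P. \<forall>s\<in>I. dist (\<phi> s (x I)) (\<phi> s y) \<le> \<epsilon>"
      using tr unfolding traceable_def by (elim allE[of _ P] allE[of _ x]) simp
  qed
qed

text \<open>Enlarging \<open>K\<close> only makes separation more restrictive, so \<open>K\<close> may be taken symmetric and as large as desired.\<close>

lemma symmetric_traceable:
  assumes spec: "specification_property G \<phi>" and \<epsilon>: "\<epsilon> > 0" and inf: "infinite (carrier G)"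
  shows "\<exists>K. finite K \<and> K \<subseteq> carrier G \<and> \<one> \<in> K \<and> (\<forall>k\<in>K. inv k \<in> K) \<and> m \<le> card K \<and> traceable \<epsilon> K"
proof -
  obtain K0 where K0: "finite K0" "K0 \<subseteq> carrier G" "traceable \<epsilon> K0"
    using specification_traceable[OF spec \<epsilon>] by blast
  obtain L where L: "finite L" "L \<subseteq> carrier G" "card L = m"
    using infinite_arbitrarily_large[OF inf] by blast
  define K where "K = insert \<one> (K0 \<union> L) \<union> m_inv G ` insert \<one> (K0 \<union> L)"
  have sub: "insert \<one> (K0 \<union> L) \<subseteq> carrier G" using K0 L by auto
  have fin: "finite K" using K0 L by (auto simp: K_def)
  have "inv k \<in> K" if "k \<in> K" for k
    using that sub unfolding K_def by auto
  moreover have "K \<subseteq> carrier G" using sub by (auto simp: K_def)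
  moreover have "m \<le> card K" using L(3) fin card_mono[of K L] by (auto simp: K_def)
  moreover have "traceable \<epsilon> K" by (rule traceable_mono[OF K0(3)]) (auto simp: K_def)
  ultimately show ?thesis using fin by (intro exI[of _ K]) (auto simp: K_def)
qed

lemma entropy_floor_mono: "entropy_floor \<mu> a \<delta> \<Longrightarrow> \<delta>' \<le> \<delta> \<Longrightarrow> entropy_floor \<mu> a \<delta>'"
  unfolding entropy_floor_def by (meson order_trans)

lemma abs_sum_le_part:
  fixes F :: "'i \<Rightarrow> real"
  assumes "finite A" "U \<subseteq> A" "\<And>g. g \<in> A \<Longrightarrow> \<bar>F g\<bar> \<le> b"
  shows "\<bar>\<Sum>g\<in>A. F g\<bar> \<le> \<bar>\<Sum>g\<in>U. F g\<bar> + real (card (A - U)) * b"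
proof -
  have "(\<Sum>g\<in>A. F g) = (\<Sum>g\<in>A - U. F g) + (\<Sum>g\<in>U. F g)" by (rule sum.subset_diff[OF assms(2,1)])
  moreover have "\<bar>\<Sum>g\<in>A - U. F g\<bar> \<le> real (card (A - U)) * b"
  proof -
    have "\<bar>\<Sum>g\<in>A - U. F g\<bar> \<le> (\<Sum>g\<in>A - U. \<bar>F g\<bar>)" by (rule sum_abs)
    also have "\<dots> \<le> (\<Sum>g\<in>A - U. b)" using assms(3) by (intro sum_mono) auto
    finally show ?thesis by simp
  qed
  ultimately show ?thesis by linarith
qed

lemma abs_integral_le:
  assumes \<mu>: "\<mu> \<in> inv_probs G \<phi>" and f: "continuous_on UNIV f" and B: "\<And>x. \<bar>f x :: real\<bar> \<le> B"
  shows "\<bar>\<integral>x. f x \<partial>\<mu>\<bar> \<le> B"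
proof -
  interpret prob_space \<mu> by (rule inv_probsD(2)[OF \<mu>])
  have i: "integrable \<mu> f" using integral_act(1)[OF \<mu> one_closed f] fun_cong[OF act.id_eq_one] by simp
  have "\<bar>\<integral>x. f x \<partial>\<mu>\<bar> \<le> (\<integral>x. \<bar>f x\<bar> \<partial>\<mu>)" by (rule integral_abs_bound)
  also have "\<dots> \<le> (\<integral>x. B \<partial>\<mu>)" using i B by (intro integral_mono) auto
  finally show ?thesis using prob_space by simp
qed

lemma K_separated_disjoint:
  assumes "\<one> \<in> K" "K_separated K P" "I \<in> P" "J \<in> P" "I \<noteq> J" "I \<subseteq> carrier G"
  shows "I \<inter> J = {}"
  using assms sep_disjoint[OF assms(1,6)] by (auto simp: K_separated_def)

lemma card_disjoint_family_le:
  assumes "finite A" "\<Union>P \<subseteq> A" "\<And>I. I \<in> P \<Longrightarrow> I \<noteq> {}" "\<And>I J. I \<in> P \<Longrightarrow> J \<in> P \<Longrightarrow> I \<noteq> J \<Longrightarrow> I \<inter> J = {}"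
  shows "card P \<le> card A"
proof -
  have "\<forall>I\<in>P. \<exists>x. x \<in> I" using assms(3) by blast
  then obtain x where x: "\<And>I. I \<in> P \<Longrightarrow> x I \<in> I" by metis
  have "inj_on x P" using x assms(4) by (intro inj_onI) (metis IntI emptyE)
  moreover have "x ` P \<subseteq> A" using x assms(2) by blast
  ultimately show ?thesis using assms(1) by (metis card_inj_on_le)
qed

text \<open>Two label families differ on some piece, where the labels are \<open>\<delta>\<close>-apart; tracing within \<open>\<delta> / 4\<close> on both sides costs
  half of this distance.\<close>

lemma traced_labels_separated:
  assumes \<delta>: "\<delta> > 0" and P: "\<And>I. I \<in> P \<Longrightarrow> I \<subseteq> A" and E: "\<And>I. I \<in> P \<Longrightarrow> separated \<phi> I \<delta> (E I)"
    and \<Omega>: "\<Omega> \<subseteq> PiE P E" and \<epsilon>: "\<epsilon> \<le> \<delta> / 4"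
    and y: "\<And>\<omega> I g. \<omega> \<in> \<Omega> \<Longrightarrow> I \<in> P \<Longrightarrow> g \<in> I \<Longrightarrow> dist (\<phi> g (\<omega> I)) (\<phi> g (y \<omega>)) \<le> \<epsilon>"
  shows "separated \<phi> A (\<delta> / 2) (y ` \<Omega>)" "inj_on y \<Omega>"
proof -
  have far: "\<exists>g\<in>A. dist (\<phi> g (y \<omega>)) (\<phi> g (y \<omega>')) > \<delta> / 2" if w: "\<omega> \<in> \<Omega>" "\<omega>' \<in> \<Omega>" "\<omega> \<noteq> \<omega>'" for \<omega> \<omega>'
  proof -
    have wP: "\<omega> \<in> PiE P E" "\<omega>' \<in> PiE P E" using w \<Omega> by auto
    obtain I where I: "I \<in> P" "\<omega> I \<noteq> \<omega>' I" using PiE_ext[OF wP] w(3) by blast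
    have "\<omega> I \<in> E I" "\<omega>' I \<in> E I" using PiE_mem[OF wP(1) I(1)] PiE_mem[OF wP(2) I(1)] by auto
    then obtain g where g: "g \<in> I" "dist (\<phi> g (\<omega> I)) (\<phi> g (\<omega>' I)) > \<delta>"
      using E[OF I(1)] I(2) unfolding separated_def by blast
    have "dist (\<phi> g (\<omega> I)) (\<phi> g (\<omega>' I)) \<le> dist (\<phi> g (\<omega> I)) (\<phi> g (y \<omega>)) + dist (\<phi> g (y \<omega>)) (\<phi> g (y \<omega>')) + dist (\<phi> g (y \<omega>')) (\<phi> g (\<omega>' I))"
      using dist_triangle[of "\<phi> g (\<omega> I)" "\<phi> g (\<omega>' I)" "\<phi> g (y \<omega>)"] dist_triangle[of "\<phi> g (y \<omega>)" "\<phi> g (\<omega>' I)" "\<phi> g (y \<omega>')"]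
      by linarith
    also have "\<dots> \<le> \<delta> / 4 + dist (\<phi> g (y \<omega>)) (\<phi> g (y \<omega>')) + \<delta> / 4"
      using y[OF w(1) I(1) g(1)] y[OF w(2) I(1) g(1)] \<epsilon> by (simp add: dist_commute)
    finally have "\<delta> / 2 < dist (\<phi> g (y \<omega>)) (\<phi> g (y \<omega>'))" using g(2) by simp
    then show ?thesis using g(1) P[OF I(1)] by blast
  qed
  show "separated \<phi> A (\<delta> / 2) (y ` \<Omega>)" unfolding separated_def using far by blast
  show "inj_on y \<Omega>"
  proof (rule inj_onI, rule ccontr)
    fix \<omega> \<omega>' assume "\<omega> \<in> \<Omega>" "\<omega>' \<in> \<Omega>" "y \<omega> = y \<omega>'" "\<omega> \<noteq> \<omega>'"
    then show False using far[of \<omega> \<omega>'] \<delta> by auto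
  qed
qed

definition good_labels :: "'x measure \<Rightarrow> ('x \<Rightarrow> real) set \<Rightarrow> real \<Rightarrow> real \<Rightarrow> real \<Rightarrow> 'g set \<Rightarrow> 'x set \<Rightarrow> bool" where
  "good_labels \<mu> fs r h \<delta> A E \<longleftrightarrow> finite E \<and> separated \<phi> A \<delta> E \<and> exp (h * real (card A)) \<le> real (card E) \<and>
     (\<forall>x\<in>E. \<forall>f\<in>fs. \<bar>(\<Sum>g\<in>A. f (\<phi> g x)) - real (card A) * (\<integral>x. f x \<partial>\<mu>)\<bar> \<le> r * real (card A))"

text \<open>Every sufficiently large finite set, of any shape, carries many good labels: carve it into small pieces, draw independent
  labels from \<open>separated_distribution\<close>, keep the typical sequences and glue each of them into one point.\<close>

lemma typical_orbits:
  assumes \<mu>: "\<mu> \<in> inv_probs G \<phi>" and spec: "specification_property G \<phi>" and Fo: "Folner_sequence G Fo"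
    and inf: "infinite (carrier G)"
    and floor: "entropy_floor \<mu> a \<delta>1" "\<delta>1 > 0" and a: "a \<ge> 0" and h: "h < a"
    and fin: "finite fs" and ct: "\<forall>f\<in>fs. continuous_on UNIV f" and r: "r > 0"
  shows "\<exists>\<delta> M0. \<delta> > 0 \<and> (\<forall>A. finite A \<and> A \<subseteq> carrier G \<and> M0 \<le> card A \<longrightarrow>
     (\<exists>E. good_labels \<mu> fs r h \<delta> A E))"
proof -
  note fs = fin bspec[OF ct]
  obtain B where B: "B > 0" "\<And>f x. f \<in> fs \<Longrightarrow> \<bar>f x\<bar> \<le> B" using uniform_bound[OF fs] by blast
  obtain d where d: "d > 0" "\<And>f x y. f \<in> fs \<Longrightarrow> dist x y \<le> d \<Longrightarrow> \<bar>f x - f y\<bar> \<le> r / 4"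
    using uniform_modulus[OF fs, of "r / 4"] r by auto
  define \<delta> where "\<delta> = min \<delta>1 d"
  have \<delta>: "\<delta> > 0" "\<delta> \<le> d" using floor(2) d(1) by (auto simp: \<delta>_def)
  have fl: "entropy_floor \<mu> a \<delta>" by (rule entropy_floor_mono[OF floor(1)]) (simp add: \<delta>_def)
  have mod: "\<bar>f x - f y\<bar> \<le> r / 4" if "f \<in> fs" "dist x y \<le> \<delta>" for f x y using d(2) that \<delta>(2) by auto
  \<comment> \<open>the first bound controls the averages (carving loss and deviation \<open>\<eta>\<close>), the second one the entropy\<close>
  define \<eta> where "\<eta> = min 1 (min (r / (2 * (2 * B + 1))) ((a - h) / (2 * (a + 1))))"
  have \<eta>: "\<eta> > 0" "\<eta> \<le> 1" "\<eta> \<le> r / (2 * (2 * B + 1))" "\<eta> \<le> (a - h) / (2 * (a + 1))"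
    using r B(1) a h by (auto simp: \<eta>_def)
  have \<eta>B: "(2 * B + 1) * \<eta> \<le> r / 2" using \<eta>(3) B(1) by (simp add: field_simps)
  have \<eta>a: "(a + 1) * \<eta> \<le> (a - h) / 2" using \<eta>(4) a by (simp add: field_simps)
  have "\<delta> / 4 > 0" using \<delta> by simp
  from symmetric_traceable[OF spec this inf, of 0]
  obtain K where K: "finite K" "K \<subseteq> carrier G" "\<one> \<in> K" "\<forall>k\<in>K. inv k \<in> K" and tr: "traceable (\<delta> / 4) K"
    by blast
  obtain F where F: "finite F" "F \<noteq> {}" "F \<subseteq> carrier G" "real (card (bdry K F)) \<le> \<eta> * real (card F)"
    using Folner_thin[OF Fo K(1,2) \<eta>(1)] by blast
  have "\<delta> / 2 > 0" using \<delta> by simp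
  from finite_net[OF this] obtain C where C: "finite C" "C \<noteq> {}" "\<And>x::'x. \<exists>c\<in>C. dist c x < \<delta> / 2" by blast
  define N where "N = real (card C)"
  have N1: "N \<ge> 1" using C by (simp add: N_def Suc_le_eq card_gt_0_iff)
  define V where "V = 4 * N ^ card F + (real (card F) * B)\<^sup>2"
  have V0: "V \<ge> 0" using N1 by (auto simp: V_def)
  \<comment> \<open>\<open>V\<close> bounds the second moments; the two terms are for Chebyshev's inequality and for the factor \<open>1 / 2\<close> in the count\<close>
  define M0 where "M0 = nat \<lceil>max (2 * (real (card fs) + 1) * V / \<eta>\<^sup>2) (2 * ln 2 / (a - h))\<rceil> + 1"
  show ?thesis
    unfolding good_labels_def
  proof (intro exI[of _ "\<delta> / 2"] exI[of _ M0] conjI allI impI)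
    show "\<delta> / 2 > 0" using \<delta> by simp
    fix A assume "finite A \<and> A \<subseteq> carrier G \<and> M0 \<le> card A"
    then have A: "finite A" "A \<subseteq> carrier G" "M0 \<le> card A" by auto
    define n where "n = real (card A)"
    have "max (2 * (real (card fs) + 1) * V / \<eta>\<^sup>2) (2 * ln 2 / (a - h)) \<le> real M0" unfolding M0_def by linarith
    also have "\<dots> \<le> n" using A(3) by (simp add: n_def)
    finally have nV: "2 * (real (card fs) + 1) * V / \<eta>\<^sup>2 \<le> n" and nln: "2 * ln 2 / (a - h) \<le> n" by auto
    have npos: "n > 0" using A(3) by (simp add: n_def M0_def)
    obtain P where P: "finite P" "\<forall>I\<in>P. I \<subseteq> A \<and> I \<noteq> {} \<and> (\<exists>c\<in>carrier G. I \<subseteq> F #> c)"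
      and Ps: "\<forall>I\<in>P. \<forall>J\<in>P. I \<noteq> J \<longrightarrow> (K <#> I) \<inter> J = {}" and PU: "(1 - \<eta>) * n \<le> real (card (\<Union>P))"
      using finite_carving[OF K(2,4,3) F(3,1,2,4) A(2,1)] unfolding n_def by (elim exE conjE)
    have sepP: "K_separated K P" using Ps by (simp add: K_separated_def)
    have J: "finite J" "J \<subseteq> carrier G" "J \<noteq> {}" "J \<subseteq> A" "card J \<le> card F" if "J \<in> P" for J
    proof -
      have j: "J \<subseteq> A \<and> J \<noteq> {} \<and> (\<exists>c\<in>carrier G. J \<subseteq> F #> c)" using P(2) that by blast
      then show "J \<noteq> {}" "J \<subseteq> A" by auto
      then show "finite J" "J \<subseteq> carrier G" using A finite_subset by auto
      obtain c where c: "c \<in> carrier G" "J \<subseteq> F #> c" using j by blast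
      show "card J \<le> card F" using card_mono[OF finite_r_coset[OF F(1)] c(2)] card_r_coset[OF F(3) c(1)] by simp
    qed
    have dj: "I \<inter> J = {}" if "I \<in> P" "J \<in> P" "I \<noteq> J" for I J
      by (rule K_separated_disjoint[OF K(3) sepP that J(2)[OF that(1)]])
    have UA: "\<Union>P \<subseteq> A" using J(4) by blast
    have cardP: "real (card P) \<le> n" unfolding n_def
      using card_disjoint_family_le[OF A(1) UA J(3) dj] by simp
    have cardU: "real (card (\<Union>P)) = (\<Sum>J\<in>P. real (card J))"
      using card_Union_disjoint[of P] dj J(1) by (simp add: pairwise_def disjnt_def)
    have sumU: "(\<Sum>g\<in>\<Union>P. u g) = (\<Sum>J\<in>P. \<Sum>g\<in>J. u g)" for u :: "'g \<Rightarrow> real"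
      using J(1) dj by (subst sum.Union_disjoint) auto
    define D where "D J E p \<longleftrightarrow> finite E \<and> E \<noteq> {} \<and> separated \<phi> J \<delta> E \<and> (\<forall>e\<in>E. p e > 0) \<and> sum p E = (1::real) \<and>
       a * real (card J) \<le> (\<Sum>e\<in>E. p e * - ln (p e)) \<and>
       (\<forall>f\<in>fs. \<bar>(\<Sum>e\<in>E. p e * (\<Sum>g\<in>J. f (\<phi> g e))) - real (card J) * (\<integral>x. f x \<partial>\<mu>)\<bar> \<le> real (card J) * (r / 4))"
      for J E p
    have "\<forall>J\<in>P. \<exists>E p. D J E p"
    proof
      fix I assume I: "I \<in> P"
      show "\<exists>E p. D I E p"
        unfolding D_def by (rule separated_distribution[OF \<mu> fl \<delta>(1) J(1,2)[OF I] fs(2) mod])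
    qed
    from bchoice[OF this] obtain E where "\<forall>J\<in>P. \<exists>p. D J (E J) p" ..
    from bchoice[OF this] obtain p where "\<forall>J\<in>P. D J (E J) (p J)" ..
    note Ep = this[unfolded D_def]
    have E: "finite (E J)" "separated \<phi> J \<delta> (E J)" "sum (p J) (E J) = 1"
      "a * real (card J) \<le> (\<Sum>e\<in>E J. p J e * - ln (p J e))" if "J \<in> P" for J
      using bspec[OF Ep that] by auto
    have ppos: "p J e > 0" if "J \<in> P" "e \<in> E J" for J e using bspec[OF Ep that(1)] that(2) by auto
    have mean: "\<bar>(\<Sum>e\<in>E J. p J e * (\<Sum>g\<in>J. f (\<phi> g e))) - real (card J) * (\<integral>x. f x \<partial>\<mu>)\<bar> \<le> real (card J) * (r / 4)"
      if "J \<in> P" "f \<in> fs" for J f using bspec[OF Ep that(1)] that(2) by auto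
    define s where "s = \<eta> * n"
    have s0: "s > 0" using \<eta> npos by (simp add: s_def)
    have sV: "(real (card fs) + 1) * (real (card P) * V) \<le> s\<^sup>2 / 2"
    proof -
      have "(real (card fs) + 1) * (real (card P) * V) \<le> (real (card fs) + 1) * (n * V)"
        using cardP V0 by (intro mult_left_mono mult_right_mono) auto
      also have "\<dots> = (2 * (real (card fs) + 1) * V / \<eta>\<^sup>2) * (\<eta>\<^sup>2 * n / 2)" using \<eta> by (simp add: field_simps)
      also have "\<dots> \<le> n * (\<eta>\<^sup>2 * n / 2)" using nV npos by (intro mult_right_mono) auto
      also have "\<dots> = s\<^sup>2 / 2" by (simp add: s_def power2_eq_square)
      finally show ?thesis .
    qed
    have "\<exists>\<Omega>. \<Omega> \<subseteq> PiE P E \<and> exp ((\<Sum>j\<in>P. \<Sum>e\<in>E j. p j e * - ln (p j e)) - s) / 2 \<le> real (card \<Omega>) \<and>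
     (\<forall>\<omega>\<in>\<Omega>. \<forall>f\<in>fs. \<bar>(\<Sum>j\<in>P. (\<Sum>g\<in>j. f (\<phi> g (\<omega> j)))) - (\<Sum>j\<in>P. \<Sum>e\<in>E j. p j e * (\<Sum>g\<in>j. f (\<phi> g e)))\<bar> \<le> s)"
    proof (rule typical_sequences[OF P(1) E(1) E(3) ppos fs(1) _ _ s0 sV])
      fix f J' assume f: "f \<in> fs" "J' \<in> P"
      have "(\<Sum>e\<in>E J'. p J' e * (\<Sum>g\<in>J'. f (\<phi> g e))\<^sup>2) \<le> (\<Sum>e\<in>E J'. p J' e * (real (card F) * B)\<^sup>2)"
      proof (intro sum_mono mult_left_mono)
        fix e assume e: "e \<in> E J'"
        have "\<bar>\<Sum>g\<in>J'. f (\<phi> g e)\<bar> \<le> (\<Sum>g\<in>J'. \<bar>f (\<phi> g e)\<bar>)" by (rule sum_abs)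
        also have "\<dots> \<le> (\<Sum>g\<in>J'. B)" using B(2)[OF f(1)] by (intro sum_mono)
        also have "\<dots> \<le> real (card F) * B" using J(5)[OF f(2)] B(1) by (simp add: mult_right_mono)
        finally have "\<bar>\<Sum>g\<in>J'. f (\<phi> g e)\<bar>\<^sup>2 \<le> (real (card F) * B)\<^sup>2" by (intro power_mono) auto
        then show "(\<Sum>g\<in>J'. f (\<phi> g e))\<^sup>2 \<le> (real (card F) * B)\<^sup>2" by simp
        show "0 \<le> p J' e" using ppos[OF f(2) e] by simp
      qed
      also have "\<dots> = (real (card F) * B)\<^sup>2" using E(3)[OF f(2)] by (simp add: sum_distrib_right[symmetric])
      also have "\<dots> \<le> V" using N1 by (simp add: V_def)
      finally show "(\<Sum>e\<in>E J'. p J' e * (\<Sum>g\<in>J'. f (\<phi> g e))\<^sup>2) \<le> V" .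
    next
      fix J' assume J': "J' \<in> P"
      have "real (card (E J')) \<le> N ^ card J'"
        using card_separated_le[OF C(1,3) J(1)[OF J'] E(2)[OF J']] unfolding N_def
        by (metis of_nat_le_iff of_nat_power)
      also have "\<dots> \<le> N ^ card F" using N1 J(5)[OF J'] by (rule power_increasing[rotated])
      finally show "4 * real (card (E J')) \<le> V" by (simp add: V_def add_increasing2)
    qed
    then obtain \<Omega> where \<Omega>: "\<Omega> \<subseteq> PiE P E"
      and cnt: "exp ((\<Sum>j\<in>P. \<Sum>e\<in>E j. p j e * - ln (p j e)) - s) / 2 \<le> real (card \<Omega>)"
      and near: "\<forall>\<omega>\<in>\<Omega>. \<forall>f\<in>fs. \<bar>(\<Sum>j\<in>P. (\<Sum>g\<in>j. f (\<phi> g (\<omega> j)))) - (\<Sum>j\<in>P. \<Sum>e\<in>E j. p j e * (\<Sum>g\<in>j. f (\<phi> g e)))\<bar> \<le> s"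
      by (elim exE conjE)
    have "\<forall>\<omega>. \<exists>y. \<forall>I\<in>P. \<forall>s\<in>I. dist (\<phi> s (\<omega> I)) (\<phi> s y) \<le> \<delta> / 4"
    proof
      fix \<omega> :: "'g set \<Rightarrow> 'x"
      have "(\<forall>I\<in>P. finite I \<and> I \<subseteq> carrier G) \<and> K_separated K P" using J(1,2) sepP by simp
      then show "\<exists>y. \<forall>I\<in>P. \<forall>s\<in>I. dist (\<phi> s (\<omega> I)) (\<phi> s y) \<le> \<delta> / 4"
        using tr unfolding traceable_def by (elim allE[of _ P] allE[of _ \<omega>]) simp
    qed
    then obtain y where y: "\<And>\<omega> I g. I \<in> P \<Longrightarrow> g \<in> I \<Longrightarrow> dist (\<phi> g (\<omega> I)) (\<phi> g (y \<omega>)) \<le> \<delta> / 4" by metis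
    have sepy: "separated \<phi> A (\<delta> / 2) (y ` \<Omega>)" and injy: "inj_on y \<Omega>"
      using traced_labels_separated[OF \<delta>(1) J(4) E(2) \<Omega> order_refl y] by auto
    have fin\<Omega>: "finite \<Omega>" by (rule finite_subset[OF \<Omega>]) (auto intro!: finite_PiE P(1) E(1))
    show "\<exists>E. finite E \<and> separated \<phi> A (\<delta> / 2) E \<and> exp (h * real (card A)) \<le> real (card E) \<and>
        (\<forall>x\<in>E. \<forall>f\<in>fs. \<bar>(\<Sum>g\<in>A. f (\<phi> g x)) - real (card A) * (\<integral>x. f x \<partial>\<mu>)\<bar> \<le> r * real (card A))"
    proof (intro exI[of _ "y ` \<Omega>"] conjI ballI)
      show "finite (y ` \<Omega>)" using fin\<Omega> by simp
      show "separated \<phi> A (\<delta> / 2) (y ` \<Omega>)" by (rule sepy)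
      have "h * n \<le> a * (1 - \<eta>) * n - \<eta> * n - ln 2"
      proof -
        have "(a + 1) * \<eta> * n \<le> (a - h) / 2 * n" using \<eta>a npos by (intro mult_right_mono) auto
        moreover have "ln 2 \<le> (a - h) / 2 * n" using nln h by (simp add: field_simps)
        ultimately show ?thesis by (simp add: field_simps)
      qed
      also have "\<dots> \<le> (\<Sum>j\<in>P. \<Sum>e\<in>E j. p j e * - ln (p j e)) - s - ln 2"
      proof -
        have "a * ((1 - \<eta>) * n) \<le> a * (\<Sum>J\<in>P. real (card J))" using PU a unfolding cardU by (rule mult_left_mono)
        also have "\<dots> = (\<Sum>J\<in>P. a * real (card J))" by (rule sum_distrib_left)
        also have "\<dots> \<le> (\<Sum>j\<in>P. \<Sum>e\<in>E j. p j e * - ln (p j e))" by (intro sum_mono E(4))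
        finally show ?thesis by (simp add: s_def mult.assoc)
      qed
      finally have "exp (h * n) \<le> exp ((\<Sum>j\<in>P. \<Sum>e\<in>E j. p j e * - ln (p j e)) - s - ln 2)" by simp
      also have "\<dots> = exp ((\<Sum>j\<in>P. \<Sum>e\<in>E j. p j e * - ln (p j e)) - s) / 2"
        by (subst exp_diff) simp
      finally show "exp (h * real (card A)) \<le> real (card (y ` \<Omega>))"
        using cnt by (simp add: card_image[OF injy] n_def)
    next
      fix x f assume x: "x \<in> y ` \<Omega>" and f: "f \<in> fs"
      then obtain \<omega> where w: "\<omega> \<in> \<Omega>" "x = y \<omega>" by blast
      define I where "I = (\<integral>x. f x \<partial>\<mu>)"
      have IB: "\<bar>I\<bar> \<le> B" unfolding I_def by (rule abs_integral_le[OF \<mu> fs(2)[OF f] B(2)[OF f]])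
      have b: "\<bar>f (\<phi> g x) - I\<bar> \<le> 2 * B" for g using B(2)[OF f, of "\<phi> g x"] IB by linarith
      have "\<bar>\<Sum>g\<in>A. f (\<phi> g x) - I\<bar> \<le> \<bar>\<Sum>g\<in>\<Union>P. f (\<phi> g x) - I\<bar> + real (card (A - \<Union>P)) * (2 * B)"
        by (rule abs_sum_le_part[OF A(1) UA b])
      moreover have "real (card (A - \<Union>P)) \<le> \<eta> * n"
        using card_Diff_subset[OF finite_subset[OF UA A(1)] UA] card_mono[OF A(1) UA] PU
        by (simp add: n_def algebra_simps of_nat_diff)
      then have "real (card (A - \<Union>P)) * (2 * B) \<le> \<eta> * n * (2 * B)" using B(1) by (intro mult_right_mono) auto
      moreover have "\<bar>\<Sum>g\<in>\<Union>P. f (\<phi> g x) - I\<bar> \<le> r / 4 * n + s + r / 4 * n"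
      proof -
        have "(\<Sum>g\<in>\<Union>P. f (\<phi> g x) - I) = (\<Sum>J\<in>P. \<Sum>g\<in>J. f (\<phi> g x) - I)" by (rule sumU)
        also have "\<dots> = (\<Sum>J\<in>P. \<Sum>g\<in>J. f (\<phi> g x) - f (\<phi> g (\<omega> J)))
           + ((\<Sum>J\<in>P. \<Sum>g\<in>J. f (\<phi> g (\<omega> J))) - (\<Sum>j\<in>P. \<Sum>e\<in>E j. p j e * (\<Sum>g\<in>j. f (\<phi> g e))))
           + (\<Sum>J\<in>P. (\<Sum>e\<in>E J. p J e * (\<Sum>g\<in>J. f (\<phi> g e))) - real (card J) * I)"
          by (simp add: sum_subtractf)
        finally have eq: "(\<Sum>g\<in>\<Union>P. f (\<phi> g x) - I) = (\<Sum>J\<in>P. \<Sum>g\<in>J. f (\<phi> g x) - f (\<phi> g (\<omega> J)))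
           + ((\<Sum>J\<in>P. \<Sum>g\<in>J. f (\<phi> g (\<omega> J))) - (\<Sum>j\<in>P. \<Sum>e\<in>E j. p j e * (\<Sum>g\<in>j. f (\<phi> g e))))
           + (\<Sum>J\<in>P. (\<Sum>e\<in>E J. p J e * (\<Sum>g\<in>J. f (\<phi> g e))) - real (card J) * I)" .
        have Un: "real (card (\<Union>P)) \<le> n" using card_mono[OF A(1) UA] by (simp add: n_def)
        have "\<bar>\<Sum>J\<in>P. \<Sum>g\<in>J. f (\<phi> g x) - f (\<phi> g (\<omega> J))\<bar> \<le> (\<Sum>J\<in>P. \<bar>\<Sum>g\<in>J. f (\<phi> g x) - f (\<phi> g (\<omega> J))\<bar>)" by (rule sum_abs)
        also have "\<dots> \<le> (\<Sum>J\<in>P. \<Sum>g\<in>J. \<bar>f (\<phi> g x) - f (\<phi> g (\<omega> J))\<bar>)" by (intro sum_mono sum_abs)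
        also have "\<dots> \<le> (\<Sum>J\<in>P. \<Sum>g\<in>J. r / 4)"
        proof (intro sum_mono mod f)
          fix J' g assume "J' \<in> P" "g \<in> J'"
          then show "dist (\<phi> g x) (\<phi> g (\<omega> J')) \<le> \<delta>" using y[of J' g \<omega>] w(2) \<delta>(1) by (simp add: dist_commute)
        qed
        also have "\<dots> = r / 4 * real (card (\<Union>P))" by (simp add: cardU sum_distrib_left mult.commute)
        also have "\<dots> \<le> r / 4 * n" using Un r by (intro mult_left_mono) auto
        finally have 1: "\<bar>\<Sum>J\<in>P. \<Sum>g\<in>J. f (\<phi> g x) - f (\<phi> g (\<omega> J))\<bar> \<le> r / 4 * n" .
        have "\<bar>\<Sum>J\<in>P. (\<Sum>e\<in>E J. p J e * (\<Sum>g\<in>J. f (\<phi> g e))) - real (card J) * I\<bar> \<le>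
          (\<Sum>J\<in>P. \<bar>(\<Sum>e\<in>E J. p J e * (\<Sum>g\<in>J. f (\<phi> g e))) - real (card J) * I\<bar>)" by (rule sum_abs)
        also have "\<dots> \<le> (\<Sum>J\<in>P. real (card J) * (r / 4))" unfolding I_def by (intro sum_mono mean f)
        also have "\<dots> = r / 4 * real (card (\<Union>P))" by (simp add: cardU sum_distrib_left mult.commute)
        also have "\<dots> \<le> r / 4 * n" using Un r by (intro mult_left_mono) auto
        finally have 2: "\<bar>\<Sum>J\<in>P. (\<Sum>e\<in>E J. p J e * (\<Sum>g\<in>J. f (\<phi> g e))) - real (card J) * I\<bar> \<le> r / 4 * n" .
        have 3: "\<bar>(\<Sum>J\<in>P. \<Sum>g\<in>J. f (\<phi> g (\<omega> J))) - (\<Sum>j\<in>P. \<Sum>e\<in>E j. p j e * (\<Sum>g\<in>j. f (\<phi> g e)))\<bar> \<le> s"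
          using near w(1) f by blast
        show ?thesis unfolding eq using 1 2 3 by linarith
      qed
      ultimately have "\<bar>\<Sum>g\<in>A. f (\<phi> g x) - I\<bar> \<le> r / 2 * n + ((2 * B + 1) * \<eta>) * n"
        by (simp add: s_def algebra_simps)
      also have "\<dots> \<le> r / 2 * n + r / 2 * n" using \<eta>B npos by (intro add_left_mono mult_right_mono) auto
      finally show "\<bar>(\<Sum>g\<in>A. f (\<phi> g x)) - real (card A) * (\<integral>x. f x \<partial>\<mu>)\<bar> \<le> r * real (card A)"
        by (simp add: sum_subtractf n_def I_def)
    qed
  qed
qed

end

section \<open>Points traced along spread families\<close>

lemma sum_Pow_power:
  fixes s :: real
  assumes "finite W"
  shows "(\<Sum>Q\<in>Pow W. s ^ card Q) = (1 + s) ^ card W"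
  using assms
proof (induction W rule: finite_induct)
  case (insert w W)
  have inj: "inj_on (insert w) (Pow W)" using insert.hyps by (auto simp: inj_on_def)
  have "(\<Sum>Q\<in>Pow (insert w W). s ^ card Q) = (\<Sum>Q\<in>Pow W. s ^ card Q) + (\<Sum>Q\<in>insert w ` Pow W. s ^ card Q)"
    unfolding Pow_insert using insert.hyps by (intro sum.union_disjoint) auto
  also have "(\<Sum>Q\<in>insert w ` Pow W. s ^ card Q) = (\<Sum>Q\<in>Pow W. s ^ card (insert w Q))"
    by (simp add: sum.reindex[OF inj])
  also have "\<dots> = (\<Sum>Q\<in>Pow W. s * s ^ card Q)"
  proof (intro sum.cong refl)
    fix Q assume "Q \<in> Pow W"
    then have "finite Q" "w \<notin> Q" using insert.hyps finite_subset by auto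
    then show "s ^ card (insert w Q) = s * s ^ card Q" by simp
  qed
  finally show ?case using insert by (simp add: sum_distrib_left[symmetric] algebra_simps)
qed simp

text \<open>Weighting a subset \<open>Q\<close> with \<open>s ^ (|Q| - \<kappa> |W|)\<close>, which is at least 1 for the subsets counted here, reduces the count to
  the binomial theorem.\<close>

lemma card_small_subsets_le:
  fixes s \<kappa> :: real
  assumes W: "finite W" and s: "0 < s" "s \<le> 1"
  shows "real (card {Q. Q \<subseteq> W \<and> real (card Q) \<le> \<kappa> * real (card W)}) \<le> exp (real (card W) * (s - \<kappa> * ln s))"
proof -
  let ?Q = "{Q. Q \<subseteq> W \<and> real (card Q) \<le> \<kappa> * real (card W)}"
  let ?n = "real (card W)"
  have "real (card ?Q) = (\<Sum>Q\<in>?Q. 1)" by simp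
  also have "\<dots> \<le> (\<Sum>Q\<in>?Q. s ^ card Q * exp (- (\<kappa> * ?n * ln s)))"
  proof (rule sum_mono)
    fix Q assume Q: "Q \<in> ?Q"
    have "ln s \<le> 0" using s by simp
    then have "\<kappa> * ?n * ln s \<le> real (card Q) * ln s" using Q by (intro mult_right_mono_neg) auto
    then have "1 \<le> exp (real (card Q) * ln s - \<kappa> * ?n * ln s)" by simp
    also have "\<dots> = s ^ card Q * exp (- (\<kappa> * ?n * ln s))"
      using s by (simp add: exp_diff exp_minus exp_of_nat_mult divide_inverse)
    finally show "1 \<le> s ^ card Q * exp (- (\<kappa> * ?n * ln s))" .
  qed
  also have "\<dots> \<le> (\<Sum>Q\<in>Pow W. s ^ card Q * exp (- (\<kappa> * ?n * ln s)))"
    using W s by (intro sum_mono2) auto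
  also have "\<dots> = (1 + s) ^ card W * exp (- (\<kappa> * ?n * ln s))"
    by (simp add: sum_distrib_right[symmetric] sum_Pow_power[OF W])
  also have "\<dots> \<le> exp s ^ card W * exp (- (\<kappa> * ?n * ln s))"
    using s exp_ge_add_one_self[of s] by (intro mult_right_mono power_mono) auto
  also have "\<dots> = exp (?n * (s - \<kappa> * ln s))"
    by (simp add: exp_of_nat_mult[symmetric] exp_add[symmetric] algebra_simps)
  finally show ?thesis .
qed

context G_system begin

text \<open>The sets \<open>E\<close> are chosen without regard to translations. Moving each base point \<open>b\<close> of \<open>I\<close> to the identity, taking the labels
  chosen for the resulting set and moving back gives an equivariant choice, at the price of a factor \<open>|I|\<close> in the number of labels.\<close>

definition labels :: "('g set \<Rightarrow> 'x set) \<Rightarrow> 'g set \<Rightarrow> 'x set" where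
  "labels E I = (\<Union>b\<in>I. \<phi> (inv b) ` E (I #> inv b))"

lemma labels_equivariant:
  assumes I: "I \<subseteq> carrier G" and h: "h \<in> carrier G" and p: "p \<in> labels E I"
  shows "\<phi> h p \<in> labels E (I #> inv h)"
proof -
  obtain b q where bq: "b \<in> I" "q \<in> E (I #> inv b)" "p = \<phi> (inv b) q" using p by (auto simp: labels_def)
  have b: "b \<in> carrier G" using bq I by auto
  have "b \<otimes> inv h \<in> I #> inv h" using r_coset_memI[OF bq(1)] .
  moreover have e: "inv (b \<otimes> inv h) = h \<otimes> inv b" using b h by (simp add: inv_mult_group)
  moreover have "(I #> inv h) #> (h \<otimes> inv b) = I #> inv b"
    using I b h by (simp add: coset_mult_assoc m_assoc[symmetric])
  moreover have "\<phi> h p = \<phi> (h \<otimes> inv b) q" using b h by (simp add: bq(3) act_mult)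
  ultimately show ?thesis unfolding labels_def using bq(2) by (intro UN_I[of "b \<otimes> inv h"]) auto
qed

lemma orbit_sum_shift:
  assumes "I \<subseteq> carrier G" "b \<in> carrier G"
  shows "(\<Sum>g\<in>I. f (\<phi> g (\<phi> (inv b) q))) = (\<Sum>g\<in>I #> inv b. f (\<phi> g q))"
proof -
  have im: "I #> inv b = (\<lambda>g. g \<otimes> inv b) ` I" by (auto simp: r_coset_def)
  have inj: "inj_on (\<lambda>g. g \<otimes> inv b) I" using assms by (intro inj_onI) (simp add: subset_iff)
  show ?thesis unfolding im sum.reindex[OF inj] comp_def
    using assms by (intro sum.cong refl) (simp add: act_mult subset_iff)
qed

lemma separated_shift:
  assumes I: "I \<subseteq> carrier G" and b: "b \<in> carrier G" and E: "separated \<phi> (I #> inv b) \<delta> E"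
  shows "separated \<phi> I \<delta> (\<phi> (inv b) ` E)"
  unfolding separated_def
proof (intro ballI impI)
  fix x y assume "x \<in> \<phi> (inv b) ` E" "y \<in> \<phi> (inv b) ` E" "x \<noteq> y"
  then obtain p q where pq: "p \<in> E" "q \<in> E" "p \<noteq> q" "x = \<phi> (inv b) p" "y = \<phi> (inv b) q" by blast
  then obtain g' where "g' \<in> I #> inv b" "dist (\<phi> g' p) (\<phi> g' q) > \<delta>" using E unfolding separated_def by blast
  then obtain g where g: "g \<in> I" "dist (\<phi> (g \<otimes> inv b) p) (\<phi> (g \<otimes> inv b) q) > \<delta>" by (auto simp: r_coset_def)
  then show "\<exists>g\<in>I. dist (\<phi> g x) (\<phi> g y) > \<delta>"
    using pq I b by (intro bexI[of _ g]) (auto simp: act_mult subset_iff)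
qed

definition traced_points ::
    "('g set set \<Rightarrow> bool) \<Rightarrow> ('g set \<Rightarrow> 'x set) \<Rightarrow> real \<Rightarrow> 'x set" where
  "traced_points S L \<epsilon> = {x. \<exists>P. S P \<and> (\<forall>I\<in>P. \<exists>p\<in>L I. \<forall>g\<in>I. dist (\<phi> g p) (\<phi> g x) \<le> \<epsilon>)}"

lemma traced_points_invariant:
  assumes K: "K \<subseteq> carrier G" and M: "M \<subseteq> carrier G" and h: "h \<in> carrier G"
    and x: "x \<in> traced_points (spread_family K M0 M \<tau> \<kappa>) (labels E) \<epsilon>"
  shows "\<phi> h x \<in> traced_points (spread_family K M0 M \<tau> \<kappa>) (labels E) \<epsilon>"
proof -
  obtain P where P: "spread_family K M0 M \<tau> \<kappa> P"
    "\<And>I. I \<in> P \<Longrightarrow> \<exists>p\<in>labels E I. \<forall>g\<in>I. dist (\<phi> g p) (\<phi> g x) \<le> \<epsilon>"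
    using x by (auto simp: traced_points_def)
  have ih: "inv h \<in> carrier G" using h by simp
  have "spread_family K M0 M \<tau> \<kappa> ((\<lambda>I. I #> inv h) ` P)" by (rule spread_family_r_coset[OF K M ih P(1)])
  moreover have "\<exists>p\<in>labels E (I #> inv h). \<forall>g\<in>I #> inv h. dist (\<phi> g p) (\<phi> g (\<phi> h x)) \<le> \<epsilon>" if I: "I \<in> P" for I
  proof -
    have Ic: "I \<subseteq> carrier G" using P(1) I by (auto simp: spread_family_def)
    obtain p where p: "p \<in> labels E I" "\<forall>g\<in>I. dist (\<phi> g p) (\<phi> g x) \<le> \<epsilon>" using P(2)[OF I] by blast
    have "dist (\<phi> g (\<phi> h p)) (\<phi> g (\<phi> h x)) \<le> \<epsilon>" if "g \<in> I #> inv h" for g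
    proof -
      obtain g' where g': "g' \<in> I" "g = g' \<otimes> inv h" using \<open>g \<in> I #> inv h\<close> by (auto simp: r_coset_def)
      then have "g' \<in> carrier G" using Ic by auto
      then have "\<phi> g (\<phi> h z) = \<phi> g' z" for z using g' h by (simp add: act_mult act_inv)
      then show ?thesis using p(2) g'(1) by simp
    qed
    then show ?thesis using labels_equivariant[OF Ic h p(1)] by blast
  qed
  ultimately show ?thesis unfolding traced_points_def by (intro CollectI exI[of _ "(\<lambda>I. I #> inv h) ` P"]) auto
qed

lemma closure_invariant:
  assumes "\<And>h x. h \<in> carrier G \<Longrightarrow> x \<in> Y \<Longrightarrow> \<phi> h x \<in> Y"
  shows "G_invariant_set G \<phi> (closure Y)"
  unfolding G_invariant_set_def
proof
  fix g assume g: "g \<in> carrier G"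
  have sub: "\<phi> h ` closure Y \<subseteq> closure Y" if "h \<in> carrier G" for h
    using assms[OF that] closure_subset[of Y]
    by (intro image_closure_subset[OF continuous_act[OF that] closed_closure]) auto
  have "x \<in> \<phi> g ` closure Y" if "x \<in> closure Y" for x
  proof -
    have "\<phi> (inv g) x \<in> closure Y" using sub[of "inv g"] g that by auto
    then show ?thesis using act_inv(2)[OF g, of x] by (metis imageI)
  qed
  then show "\<phi> g ` closure Y = closure Y" using sub[OF g] by blast
qed

text \<open>Being separated at scale \<open>\<gamma>\<close> is an open condition, so passing to the closure does not increase separation numbers.\<close>

lemma separated_in_closure:
  assumes F: "finite F" "F \<subseteq> carrier G" and E: "finite E" "E \<subseteq> closure Y" "separated \<phi> F \<gamma> E" and \<gamma>: "\<gamma> > 0"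
  shows "\<exists>E'\<subseteq>Y. finite E' \<and> separated \<phi> F \<gamma> E' \<and> card E' = card E"
proof -
  have "\<forall>x\<in>E. \<exists>s. (\<forall>n. s n \<in> Y) \<and> s \<longlonglongrightarrow> x" using E(2) closure_sequential by blast
  then obtain s where s: "\<And>x n. x \<in> E \<Longrightarrow> s x n \<in> Y" "\<And>x. x \<in> E \<Longrightarrow> s x \<longlonglongrightarrow> x" by metis
  have "\<forall>\<^sub>F n in sequentially. \<forall>z\<in>{z\<in>E \<times> E. fst z \<noteq> snd z}. \<exists>g\<in>F. dist (\<phi> g (s (fst z) n)) (\<phi> g (s (snd z) n)) > \<gamma>"
  proof (rule eventually_ball_finite)
    show "finite {z\<in>E \<times> E. fst z \<noteq> snd z}" using E(1) by auto
    show "\<forall>z\<in>{z\<in>E \<times> E. fst z \<noteq> snd z}. \<forall>\<^sub>F n in sequentially. \<exists>g\<in>F. dist (\<phi> g (s (fst z) n)) (\<phi> g (s (snd z) n)) > \<gamma>"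
    proof
      fix z assume "z \<in> {z\<in>E \<times> E. fst z \<noteq> snd z}"
      then have z: "fst z \<in> E" "snd z \<in> E" "fst z \<noteq> snd z" by auto
      then obtain g where g: "g \<in> F" "dist (\<phi> g (fst z)) (\<phi> g (snd z)) > \<gamma>"
        using E(3) unfolding separated_def by blast
      have gc: "g \<in> carrier G" using g F by auto
      have cont: "isCont (\<phi> g) x" for x
        using continuous_act[OF gc, of UNIV] by (simp add: continuous_on_eq_continuous_at)
      have "(\<lambda>n. dist (\<phi> g (s (fst z) n)) (\<phi> g (s (snd z) n))) \<longlonglongrightarrow> dist (\<phi> g (fst z)) (\<phi> g (snd z))"
        using s(2) z cont by (intro tendsto_dist isCont_tendsto_compose[of _ "\<phi> g"]) auto
      then have "\<forall>\<^sub>F n in sequentially. dist (\<phi> g (s (fst z) n)) (\<phi> g (s (snd z) n)) > \<gamma>"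
        using g(2) by (rule order_tendstoD(1))
      then show "\<forall>\<^sub>F n in sequentially. \<exists>g\<in>F. dist (\<phi> g (s (fst z) n)) (\<phi> g (s (snd z) n)) > \<gamma>"
        by (rule eventually_mono) (use g(1) in blast)
    qed
  qed
  from eventually_happens'[OF sequentially_bot this]
  obtain n where "\<forall>z\<in>{z\<in>E \<times> E. fst z \<noteq> snd z}. \<exists>g\<in>F. dist (\<phi> g (s (fst z) n)) (\<phi> g (s (snd z) n)) > \<gamma>" ..
  then have n: "\<exists>g\<in>F. dist (\<phi> g (s x n)) (\<phi> g (s y n)) > \<gamma>" if "x \<in> E" "y \<in> E" "x \<noteq> y" for x y
    using that by auto
  have inj: "inj_on (\<lambda>x. s x n) E"
  proof (rule inj_onI, rule ccontr)
    fix x y assume "x \<in> E" "y \<in> E" "s x n = s y n" "x \<noteq> y"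
    then show False using n[of x y] \<gamma> by auto
  qed
  have "separated \<phi> F \<gamma> ((\<lambda>x. s x n) ` E)" unfolding separated_def using n by blast
  then show ?thesis using E(1) s(1) card_image[OF inj]
    by (intro exI[of _ "(\<lambda>x. s x n) ` E"]) auto
qed

lemma spread_familyD:
  assumes "spread_family K M0 M \<tau> \<kappa> P"
  shows "K_separated K P" "\<And>I. I \<in> P \<Longrightarrow> K_connected K I" "\<And>I. I \<in> P \<Longrightarrow> finite I"
    "\<And>I. I \<in> P \<Longrightarrow> I \<subseteq> carrier G" "\<And>I. I \<in> P \<Longrightarrow> M0 \<le> card I"
    "\<And>W. finite W \<Longrightarrow> W \<subseteq> carrier G \<Longrightarrow> real (card ((M <#> W) - W)) \<le> \<tau> * real (card W) \<Longrightarrow>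
        real (card (W - \<Union>{I\<in>P. I \<subseteq> W})) \<le> \<kappa> * real (card W)"
  using assms by (auto simp: spread_family_def)

text \<open>For a fixed family \<open>J\<close> of pieces, a point of \<open>E\<close> is determined by its labels and by the nearest points of the net \<open>C\<close> at the
  group elements not covered by the pieces.\<close>

lemma card_traced_fibre_le:
  assumes W: "finite W" and L: "\<And>I. I \<in> J \<Longrightarrow> finite (L I) \<and> real (card (L I)) \<le> exp (h * real (card I))"
    and h: "h \<ge> 0" and J: "\<Union>J \<subseteq> W" "\<And>I I'. I \<in> J \<Longrightarrow> I' \<in> J \<Longrightarrow> I \<noteq> I' \<Longrightarrow> I \<inter> I' = {}"
    and \<epsilon>: "2 * \<epsilon> \<le> \<gamma>" and C: "finite C" "\<And>x::'x. \<exists>c\<in>C. dist c x < \<gamma> / 2"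
    and E: "finite E" "separated \<phi> W \<gamma> E"
    and tr: "\<And>z I. z \<in> E \<Longrightarrow> I \<in> J \<Longrightarrow> \<exists>p\<in>L I. \<forall>g\<in>I. dist (\<phi> g p) (\<phi> g z) \<le> \<epsilon>"
  shows "real (card E) \<le> exp (h * real (card W)) * real (card C) ^ card (W - \<Union>J)"
proof -
  have finJ: "finite J" using W J(1) by (meson finite_UnionD finite_subset)
  obtain l where l: "\<And>z I. z \<in> E \<Longrightarrow> I \<in> J \<Longrightarrow> l z I \<in> L I \<and> (\<forall>g\<in>I. dist (\<phi> g (l z I)) (\<phi> g z) \<le> \<epsilon>)"
    using tr by metis
  obtain i where i: "\<And>x. i x \<in> C" "\<And>x. dist (i x) x < \<gamma> / 2" using C(2) by metis
  let ?Q = "W - \<Union>J"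
  define F where "F z = (restrict (l z) J, names (\<lambda>g x. i (\<phi> g x)) ?Q z)" for z
  have inj: "inj_on F E"
  proof (rule inj_onI, rule ccontr)
    fix y z assume yz: "y \<in> E" "z \<in> E" "F y = F z" "y \<noteq> z"
    then obtain g where g: "g \<in> W" "dist (\<phi> g y) (\<phi> g z) > \<gamma>" using E(2) unfolding separated_def by blast
    show False
    proof (cases "g \<in> \<Union>J")
      case True
      then obtain I where I: "I \<in> J" "g \<in> I" by blast
      have "l y I = l z I" using yz(3) I(1) unfolding F_def by (auto simp: restrict_def fun_eq_iff split: if_splits dest!: spec[of _ I])
      then have "dist (\<phi> g y) (\<phi> g z) \<le> \<epsilon> + \<epsilon>"
        using l[OF yz(1) I(1)] l[OF yz(2) I(1)] I(2)
        by (metis add_mono dist_commute dist_triangle_le)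
      then show False using g(2) \<epsilon> by simp
    next
      case False
      then have "i (\<phi> g y) = i (\<phi> g z)" using yz(3) g(1) unfolding F_def by (auto simp: names_eq_iff)
      then have "dist (\<phi> g y) (\<phi> g z) < \<gamma>"
        using i(2)[of "\<phi> g y"] i(2)[of "\<phi> g z"] by (metis dist_triangle_half_r)
      then show False using g(2) by simp
    qed
  qed
  have sub: "F ` E \<subseteq> PiE J L \<times> PiE ?Q (\<lambda>_. C)"
  proof (rule image_subsetI)
    fix z assume "z \<in> E"
    then show "F z \<in> PiE J L \<times> PiE ?Q (\<lambda>_. C)"
      unfolding F_def names_def mem_Times_iff fst_conv snd_conv restrict_PiE_iff using l i(1) by auto
  qed
  have finL: "finite (PiE J L)" "finite (PiE ?Q (\<lambda>_. C))"
    using finJ L C W by (auto intro!: finite_PiE)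
  have "card E \<le> card (PiE J L \<times> PiE ?Q (\<lambda>_. C))"
    using finL by (intro card_inj_on_le[OF inj sub]) auto
  also have "\<dots> = (\<Prod>I\<in>J. card (L I)) * card C ^ card ?Q"
    using finJ W by (simp add: card_cartesian_product card_PiE)
  finally have "real (card E) \<le> real ((\<Prod>I\<in>J. card (L I)) * card C ^ card ?Q)" by (rule of_nat_mono)
  also have "\<dots> = (\<Prod>I\<in>J. real (card (L I))) * real (card C) ^ card ?Q" by simp
  also have "\<dots> \<le> (\<Prod>I\<in>J. exp (h * real (card I))) * real (card C) ^ card ?Q"
    using L by (intro mult_right_mono prod_mono) auto
  also have "(\<Prod>I\<in>J. exp (h * real (card I))) = exp (h * (\<Sum>I\<in>J. real (card I)))"
    by (simp add: exp_sum[OF finJ, symmetric] sum_distrib_left)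
  also have "(\<Sum>I\<in>J. real (card I)) = real (card (\<Union>J))"
  proof -
    have "pairwise disjnt J" using J(2) by (auto simp: pairwise_def disjnt_def)
    moreover have "finite I" if "I \<in> J" for I using J(1) that by (intro finite_subset[OF _ W]) blast
    ultimately show ?thesis by (simp add: card_Union_disjoint)
  qed
  also have "exp (h * real (card (\<Union>J))) * real (card C) ^ card ?Q \<le> exp (h * real (card W)) * real (card C) ^ card ?Q"
    using card_mono[OF W J(1)] h by (intro mult_right_mono) (auto intro!: mult_left_mono)
  finally show ?thesis .
qed

text \<open>The upper count. The pieces inside the window \<open>W\<close> are the connected components of the complement of a sparse set \<open>Q\<close>, so
  it suffices to count these sets and, for each of them, the labels.\<close>

lemma card_separated_traced_le:
  assumes K: "K \<subseteq> carrier G" "\<forall>k\<in>K. inv k \<in> K" "\<one> \<in> K"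
    and W: "finite W" "W \<subseteq> carrier G" "real (card ((M <#> W) - W)) \<le> \<tau> * real (card W)"
    and L: "\<And>I. finite I \<Longrightarrow> I \<subseteq> carrier G \<Longrightarrow> M0 \<le> card I \<Longrightarrow> finite (L I) \<and> real (card (L I)) \<le> exp (h * real (card I))"
    and h: "h \<ge> 0" and \<epsilon>: "2 * \<epsilon> \<le> \<gamma>" and C: "finite C" "C \<noteq> {}" "\<And>x::'x. \<exists>c\<in>C. dist c x < \<gamma> / 2"
    and E: "finite E" "separated \<phi> W \<gamma> E" "E \<subseteq> traced_points (spread_family K M0 M \<tau> \<kappa>) L \<epsilon>"
    and s: "0 < s" "s \<le> 1"
  shows "real (card E) \<le> exp (real (card W) * (h + \<kappa> * ln (real (card C)) + s - \<kappa> * ln s))"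
proof -
  have "\<forall>z\<in>E. \<exists>P. spread_family K M0 M \<tau> \<kappa> P \<and> (\<forall>I\<in>P. \<exists>p\<in>L I. \<forall>g\<in>I. dist (\<phi> g p) (\<phi> g z) \<le> \<epsilon>)"
    using E(3) by (auto simp: traced_points_def)
  then obtain P where "\<forall>z\<in>E. spread_family K M0 M \<tau> \<kappa> (P z) \<and> (\<forall>I\<in>P z. \<exists>p\<in>L I. \<forall>g\<in>I. dist (\<phi> g p) (\<phi> g z) \<le> \<epsilon>)"
    by metis
  then have P: "\<And>z. z \<in> E \<Longrightarrow> spread_family K M0 M \<tau> \<kappa> (P z)"
    "\<And>z I. z \<in> E \<Longrightarrow> I \<in> P z \<Longrightarrow> \<exists>p\<in>L I. \<forall>g\<in>I. dist (\<phi> g p) (\<phi> g z) \<le> \<epsilon>" by auto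
  define J where "J z = {I\<in>P z. I \<subseteq> W}" for z
  define Q where "Q z = W - \<Union>(J z)" for z
  let ?\<Q> = "{Q. Q \<subseteq> W \<and> real (card Q) \<le> \<kappa> * real (card W)}"
  have fin\<Q>: "finite ?\<Q>" using W(1) by (auto intro: finite_subset[of _ "Pow W"])
  have Q\<Q>: "Q z \<in> ?\<Q>" if "z \<in> E" for z
    using spread_familyD(6)[OF P(1)[OF that] W] by (auto simp: Q_def J_def)
  define N where "N = real (card C)"
  have N1: "N \<ge> 1" using C by (simp add: N_def Suc_le_eq card_gt_0_iff)
  have JW: "\<Union>(J z) \<subseteq> W" for z by (auto simp: J_def)
  have Jprop: "K_separated K (J z)" "\<forall>I\<in>J z. K_connected K I" if "z \<in> E" for z
    using spread_familyD(1,2)[OF P(1)[OF that]] by (auto simp: J_def K_separated_def)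
  have fibre: "real (card {z\<in>E. Q z = R}) \<le> exp (h * real (card W)) * exp (\<kappa> * real (card W) * ln N)"
    if R: "R \<in> ?\<Q>" for R
  proof (cases "{z\<in>E. Q z = R} = {}")
    case True
    then show ?thesis unfolding True by simp
  next
    case False
    then obtain z0 where z0: "z0 \<in> E" "Q z0 = R" by blast
    have same: "J z = J z0" if z: "z \<in> E" "Q z = R" for z
    proof -
      have "\<Union>(J z) = W - R" "\<Union>(J z0) = W - R" using JW[of z] JW[of z0] z(2) z0(2) unfolding Q_def by blast+
      then have "\<Union>(J z) = \<Union>(J z0)" by simp
      moreover have "\<Union>(J z) \<subseteq> carrier G" using JW[of z] W(2) by blast
      ultimately show ?thesis
        by (rule connected_family_unique[OF K(1,2) Jprop[OF z(1)] Jprop[OF z0(1)]])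
    qed
    have "real (card {z\<in>E. Q z = R}) \<le> exp (h * real (card W)) * real (card C) ^ card (W - \<Union>(J z0))"
    proof (rule card_traced_fibre_le[OF W(1) _ h JW _ \<epsilon> C(1,3)])
      fix I assume "I \<in> J z0"
      then have "I \<in> P z0" by (simp add: J_def)
      then show "finite (L I) \<and> real (card (L I)) \<le> exp (h * real (card I))"
        by (intro L spread_familyD(3-5)[OF P(1)[OF z0(1)]])
    next
      fix I I' assume I: "I \<in> J z0" "I' \<in> J z0" "I \<noteq> I'"
      have "I \<subseteq> carrier G" using I(1) JW[of z0] W(2) by blast
      then show "I \<inter> I' = {}" by (rule K_separated_disjoint[OF K(3) Jprop(1)[OF z0(1)] I])
    next
      show "finite {z\<in>E. Q z = R}" using E(1) by simp
      show "separated \<phi> W \<gamma> {z\<in>E. Q z = R}" using E(2) by (simp add: separated_def)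
      fix z I assume "z \<in> {z\<in>E. Q z = R}" "I \<in> J z0"
      then have "z \<in> E" "I \<in> P z" using same[of z] by (auto simp: J_def)
      then show "\<exists>p\<in>L I. \<forall>g\<in>I. dist (\<phi> g p) (\<phi> g z) \<le> \<epsilon>" by (rule P(2))
    qed
    also have "W - \<Union>(J z0) = R" using z0(2) by (simp add: Q_def)
    also have "real (card C) ^ card R \<le> exp (\<kappa> * real (card W) * ln N)"
    proof -
      have "real (card C) ^ card R = exp (real (card R) * ln N)" using N1 by (simp add: exp_of_nat_mult N_def)
      also have "\<dots> \<le> exp (\<kappa> * real (card W) * ln N)" using R N1 by (auto intro!: mult_right_mono)
      finally show ?thesis .
    qed
    finally show ?thesis by simp
  qed
  have "E = (\<Union>R\<in>?\<Q>. {z\<in>E. Q z = R})" using Q\<Q> by blast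
  then have "card E \<le> (\<Sum>R\<in>?\<Q>. card {z\<in>E. Q z = R})"
    using card_UN_le[OF fin\<Q>, of "\<lambda>R. {z\<in>E. Q z = R}"] by metis
  then have "real (card E) \<le> (\<Sum>R\<in>?\<Q>. real (card {z\<in>E. Q z = R}))"
    by (simp only: of_nat_sum[symmetric] of_nat_le_iff)
  also have "\<dots> \<le> (\<Sum>R\<in>?\<Q>. exp (h * real (card W)) * exp (\<kappa> * real (card W) * ln N))"
    by (intro sum_mono fibre)
  also have "\<dots> = real (card ?\<Q>) * (exp (h * real (card W)) * exp (\<kappa> * real (card W) * ln N))" by simp
  also have "\<dots> \<le> exp (real (card W) * (s - \<kappa> * ln s)) * (exp (h * real (card W)) * exp (\<kappa> * real (card W) * ln N))"
    by (intro mult_right_mono card_small_subsets_le[OF W(1) s]) auto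
  also have "\<dots> = exp (real (card W) * (h + \<kappa> * ln (real (card C)) + s - \<kappa> * ln s))"
    by (simp add: exp_add[symmetric] N_def algebra_simps)
  finally show ?thesis .
qed

text \<open>The lower count: the labels on the pieces inside \<open>W\<close> are chosen freely, those on the other pieces are kept fixed.\<close>

lemma exists_separated_traced:
  assumes K: "\<one> \<in> K" and P: "spread_family K M0 M \<tau> \<kappa> P" and tr: "traceable \<epsilon> K"
    and L: "\<And>I. finite I \<Longrightarrow> I \<subseteq> carrier G \<Longrightarrow> M0 \<le> card I \<Longrightarrow>
      \<exists>E\<subseteq>L I. finite E \<and> separated \<phi> I \<delta> E \<and> exp (h * real (card I)) \<le> real (card E)"
    and h: "h \<ge> 0" and \<delta>: "\<delta> > 0" "\<epsilon> \<le> \<delta> / 4"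
    and W: "finite W" "W \<subseteq> carrier G" "real (card ((M <#> W) - W)) \<le> \<tau> * real (card W)"
  shows "\<exists>E\<subseteq>traced_points (spread_family K M0 M \<tau> \<kappa>) L \<epsilon>. finite E \<and> E \<noteq> {} \<and> separated \<phi> W (\<delta> / 2) E \<and>
     exp (h * (1 - \<kappa>) * real (card W)) \<le> real (card E)"
proof -
  note PD = spread_familyD[OF P]
  have "\<forall>I\<in>P. \<exists>E\<subseteq>L I. finite E \<and> separated \<phi> I \<delta> E \<and> exp (h * real (card I)) \<le> real (card E)"
    by (intro ballI L PD(3-5))
  then obtain E where "\<forall>I\<in>P. E I \<subseteq> L I \<and> finite (E I) \<and> separated \<phi> I \<delta> (E I) \<and> exp (h * real (card I)) \<le> real (card (E I))"
    by metis
  then have E: "E I \<subseteq> L I" "finite (E I)" "separated \<phi> I \<delta> (E I)" "exp (h * real (card I)) \<le> real (card (E I))"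
    if "I \<in> P" for I using that by auto
  define d where "d I = (SOME e. e \<in> E I)" for I
  have "E I \<noteq> {}" if "I \<in> P" for I
    using E(4)[OF that] exp_gt_zero[of "h * real (card I)"] by (auto simp del: exp_gt_zero)
  then have d: "d I \<in> E I" if "I \<in> P" for I using that by (simp add: d_def some_in_eq)
  define J where "J = {I\<in>P. I \<subseteq> W}"
  define \<Omega> where "\<Omega> = PiE J E"
  have ex: "\<exists>y. \<forall>I\<in>P. \<forall>g\<in>I. dist (\<phi> g (x I)) (\<phi> g y) \<le> \<epsilon>" for x :: "'g set \<Rightarrow> 'x"
  proof -
    have "(\<forall>I\<in>P. finite I \<and> I \<subseteq> carrier G) \<and> K_separated K P" using PD by simp
    then show ?thesis using tr unfolding traceable_def by (elim allE[of _ P] allE[of _ x]) simp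
  qed
  have "\<forall>\<omega>. \<exists>y. \<forall>I\<in>P. \<forall>g\<in>I. dist (\<phi> g (if I \<in> J then \<omega> I else d I)) (\<phi> g y) \<le> \<epsilon>"
  proof
    fix \<omega>
    show "\<exists>y. \<forall>I\<in>P. \<forall>g\<in>I. dist (\<phi> g (if I \<in> J then \<omega> I else d I)) (\<phi> g y) \<le> \<epsilon>"
      by (rule ex[of "\<lambda>I. if I \<in> J then \<omega> I else d I"])
  qed
  then obtain y where y: "\<And>\<omega> I g. I \<in> P \<Longrightarrow> g \<in> I \<Longrightarrow> dist (\<phi> g (if I \<in> J then \<omega> I else d I)) (\<phi> g (y \<omega>)) \<le> \<epsilon>"
    by metis
  have JP: "I \<in> P" "I \<subseteq> W" if "I \<in> J" for I using that by (auto simp: J_def)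
  have sep: "separated \<phi> W (\<delta> / 2) (y ` \<Omega>)" and inj: "inj_on y \<Omega>"
  proof -
    have "dist (\<phi> g (\<omega> I)) (\<phi> g (y \<omega>)) \<le> \<epsilon>" if "I \<in> J" "g \<in> I" for \<omega> I g
      using y[of I g \<omega>] that JP(1) by simp
    then show "separated \<phi> W (\<delta> / 2) (y ` \<Omega>)" "inj_on y \<Omega>"
      using traced_labels_separated[OF \<delta>(1), of J W E \<Omega> \<epsilon> y] JP E(3) \<delta>(2) by (auto simp: \<Omega>_def)
  qed
  have finJ: "finite J" using W(1) by (auto simp: J_def intro: finite_subset[of _ "Pow W"])
  have fin: "finite \<Omega>" unfolding \<Omega>_def using finJ E(2) JP(1) by (intro finite_PiE) auto
  have in_tr: "y \<omega> \<in> traced_points (spread_family K M0 M \<tau> \<kappa>) L \<epsilon>" if w: "\<omega> \<in> \<Omega>" for \<omega>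
  proof -
    have "\<exists>p\<in>L I. \<forall>g\<in>I. dist (\<phi> g p) (\<phi> g (y \<omega>)) \<le> \<epsilon>" if I: "I \<in> P" for I
    proof -
      have "(if I \<in> J then \<omega> I else d I) \<in> E I"
        using PiE_mem[of \<omega> J E I] w d[OF I] by (simp add: \<Omega>_def)
      then show ?thesis using E(1)[OF I] y[OF I] by blast
    qed
    then show ?thesis unfolding traced_points_def using P by blast
  qed
  have UJ: "\<Union>J \<subseteq> W" using JP(2) by blast
  have "real (card (W - \<Union>J)) \<le> \<kappa> * real (card W)" using PD(6)[OF W] by (simp add: J_def)
  moreover have "real (card W) = real (card (W - \<Union>J)) + real (card (\<Union>J))"
    using card_Diff_subset[OF finite_subset[OF UJ W(1)] UJ] card_mono[OF W(1) UJ] by simp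
  ultimately have "(1 - \<kappa>) * real (card W) \<le> real (card (\<Union>J))" by (simp add: algebra_simps)
  also have "\<dots> = (\<Sum>I\<in>J. real (card I))"
  proof -
    have "disjoint J" unfolding disjoint_def
    proof (intro ballI impI)
      fix I I' assume "I \<in> J" "I' \<in> J" "I \<noteq> I'"
      then show "I \<inter> I' = {}" using K_separated_disjoint[OF K PD(1)] PD(4) JP(1) by blast
    qed
    then show ?thesis using card_Union_disjoint[of J] PD(3) JP(1) by (simp add: pairwise_def disjnt_def disjoint_def)
  qed
  finally have "h * ((1 - \<kappa>) * real (card W)) \<le> h * (\<Sum>I\<in>J. real (card I))" using h by (rule mult_left_mono)
  then have "exp (h * (1 - \<kappa>) * real (card W)) \<le> exp (\<Sum>I\<in>J. h * real (card I))"
    by (simp add: sum_distrib_left mult.assoc)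
  also have "\<dots> = (\<Prod>I\<in>J. exp (h * real (card I)))" by (rule exp_sum[OF finJ])
  also have "\<dots> \<le> (\<Prod>I\<in>J. real (card (E I)))" using E(4) JP(1) by (intro prod_mono) auto
  also have "\<dots> = real (card \<Omega>)" using finJ by (simp add: \<Omega>_def card_PiE)
  finally have cnt: "exp (h * (1 - \<kappa>) * real (card W)) \<le> real (card (y ` \<Omega>))" by (simp add: card_image[OF inj])
  then have "y ` \<Omega> \<noteq> {}" using exp_gt_zero[of "h * (1 - \<kappa>) * real (card W)"] by (auto simp del: exp_gt_zero)
  then show ?thesis using sep fin in_tr cnt by (intro exI[of _ "y ` \<Omega>"]) auto
qed

text \<open>The average over a window is a weighted average over pieces, up to the few group elements outside the pieces.\<close>

lemma traced_orbit_average: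
  assumes K: "\<one> \<in> K" and W: "finite W" "W \<subseteq> carrier G" "real (card ((M <#> W) - W)) \<le> \<tau> * real (card W)"
    and z: "z \<in> traced_points (spread_family K M0 M \<tau> \<kappa>) L \<epsilon>"
    and L: "\<And>I p. finite I \<Longrightarrow> I \<subseteq> carrier G \<Longrightarrow> M0 \<le> card I \<Longrightarrow> p \<in> L I \<Longrightarrow>
       \<bar>(\<Sum>g\<in>I. f (\<phi> g p)) - real (card I) * c\<bar> \<le> r * real (card I)"
    and mod: "\<And>x y. dist x y \<le> \<epsilon> \<Longrightarrow> \<bar>f x - f y\<bar> \<le> \<omega>" and B: "\<And>x. \<bar>f x :: real\<bar> \<le> B" "\<bar>c\<bar> \<le> B"
    and r: "r \<ge> 0" "\<omega> \<ge> 0"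
  shows "\<bar>(\<Sum>g\<in>W. f (\<phi> g z)) - real (card W) * c\<bar> \<le> (r + \<omega> + 2 * B * \<kappa>) * real (card W)"
proof -
  obtain P where P: "spread_family K M0 M \<tau> \<kappa> P"
    "\<And>I. I \<in> P \<Longrightarrow> \<exists>p\<in>L I. \<forall>g\<in>I. dist (\<phi> g p) (\<phi> g z) \<le> \<epsilon>"
    using z by (auto simp: traced_points_def)
  note PD = spread_familyD[OF P(1)]
  define J where "J = {I\<in>P. I \<subseteq> W}"
  have JP: "I \<in> P" "I \<subseteq> W" if "I \<in> J" for I using that by (auto simp: J_def)
  have UJ: "\<Union>J \<subseteq> W" using JP(2) by blast
  have finJ: "finite J" using W(1) by (auto simp: J_def intro: finite_subset[of _ "Pow W"])
  have dj: "I \<inter> I' = {}" if "I \<in> J" "I' \<in> J" "I \<noteq> I'" for I I'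
    using K_separated_disjoint[OF K PD(1)] PD(4) JP(1) that by blast
  have sumU: "(\<Sum>g\<in>\<Union>J. u g) = (\<Sum>I\<in>J. \<Sum>g\<in>I. u g)" for u :: "'g \<Rightarrow> real"
    using PD(3) JP(1) dj by (subst sum.Union_disjoint) auto
  have piece: "\<bar>\<Sum>g\<in>I. f (\<phi> g z) - c\<bar> \<le> (r + \<omega>) * real (card I)" if I: "I \<in> J" for I
  proof -
    note IP = JP(1)[OF I]
    obtain p where p: "p \<in> L I" "\<forall>g\<in>I. dist (\<phi> g p) (\<phi> g z) \<le> \<epsilon>" using P(2)[OF IP] by blast
    have "\<bar>\<Sum>g\<in>I. f (\<phi> g p) - f (\<phi> g z)\<bar> \<le> (\<Sum>g\<in>I. \<bar>f (\<phi> g p) - f (\<phi> g z)\<bar>)" by (rule sum_abs)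
    also have "\<dots> \<le> (\<Sum>g\<in>I. \<omega>)" using p(2) by (intro sum_mono mod) auto
    finally have "\<bar>(\<Sum>g\<in>I. f (\<phi> g p)) - (\<Sum>g\<in>I. f (\<phi> g z))\<bar> \<le> \<omega> * real (card I)"
      by (simp add: sum_subtractf mult.commute)
    moreover have "\<bar>(\<Sum>g\<in>I. f (\<phi> g p)) - real (card I) * c\<bar> \<le> r * real (card I)"
      by (rule L[OF PD(3,4,5)[OF IP] p(1)])
    ultimately show ?thesis by (simp add: sum_subtractf algebra_simps abs_le_iff)
  qed
  have "\<bar>\<Sum>g\<in>\<Union>J. f (\<phi> g z) - c\<bar> \<le> (\<Sum>I\<in>J. \<bar>\<Sum>g\<in>I. f (\<phi> g z) - c\<bar>)" unfolding sumU by (rule sum_abs)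
  also have "\<dots> \<le> (\<Sum>I\<in>J. (r + \<omega>) * real (card I))" by (intro sum_mono piece)
  also have "\<dots> = (r + \<omega>) * real (card (\<Union>J))"
    using sumU[of "\<lambda>_. 1"] by (simp add: sum_distrib_left)
  also have "\<dots> \<le> (r + \<omega>) * real (card W)" using r card_mono[OF W(1) UJ] by (intro mult_left_mono) auto
  finally have 1: "\<bar>\<Sum>g\<in>\<Union>J. f (\<phi> g z) - c\<bar> \<le> (r + \<omega>) * real (card W)" .
  have b: "\<bar>f (\<phi> g z) - c\<bar> \<le> 2 * B" for g using B(1)[of "\<phi> g z"] B(2) by linarith
  have "\<bar>\<Sum>g\<in>W. f (\<phi> g z) - c\<bar> \<le> \<bar>\<Sum>g\<in>\<Union>J. f (\<phi> g z) - c\<bar> + real (card (W - \<Union>J)) * (2 * B)"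
    by (rule abs_sum_le_part[OF W(1) UJ b])
  moreover have "real (card (W - \<Union>J)) * (2 * B) \<le> \<kappa> * real (card W) * (2 * B)"
    using PD(6)[OF W] B(2) by (intro mult_right_mono) (auto simp: J_def)
  ultimately show ?thesis using 1 by (simp add: sum_subtractf algebra_simps)
qed

end

section \<open>Horseshoes and the approximation theorem\<close>

lemma weak_star_basic_nhd:
  fixes \<mu> :: "'x::topological_space measure"
  assumes U: "weak_star_nhd U \<mu>" and \<mu>: "\<mu> \<in> Borel_probs"
  shows "\<exists>(fs :: ('x \<Rightarrow> real) set) r. finite fs \<and> (\<forall>f\<in>fs. continuous_on UNIV f) \<and> r > 0 \<and>
    (\<forall>\<nu>\<in>Borel_probs. (\<forall>f\<in>fs. \<bar>(\<integral>x. f x \<partial>\<nu>) - (\<integral>x. f x \<partial>\<mu>)\<bar> \<le> r) \<longrightarrow> \<nu> \<in> U)"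
proof -
  let ?S = "{{\<mu> \<in> Borel_probs. (\<integral>x. f x \<partial>\<mu>) \<in> V} | (f :: 'x \<Rightarrow> real) V. continuous_on UNIV f \<and> open V}"
  define N where "N V fs r \<longleftrightarrow> finite fs \<and> (\<forall>f\<in>fs. continuous_on UNIV f) \<and> r > 0 \<and>
    (\<forall>\<nu>\<in>Borel_probs. (\<forall>f\<in>fs. \<bar>(\<integral>x. f x \<partial>\<nu>) - (\<integral>x. f x \<partial>\<mu>)\<bar> \<le> r) \<longrightarrow> \<nu> \<in> V)"
    for V :: "'x measure set" and fs and r :: real
  have mono: "N V fs r \<Longrightarrow> V \<subseteq> V' \<Longrightarrow> N V' fs r" for V V' fs r unfolding N_def by (meson subsetD)
  obtain V where V: "openin weak_star_topology V" "\<mu> \<in> V" "V \<subseteq> U" using U by (auto simp: weak_star_nhd_def)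
  have "generate_topology_on ?S V"
    using V(1) unfolding weak_star_topology_def openin_topology_generated_by_iff .
  then have "\<mu> \<in> V \<longrightarrow> (\<exists>fs r. N V fs r)"
  proof (induction rule: generate_topology_on.induct)
    case Empty
    show ?case by simp
  next
    case (Int A B)
    show ?case
    proof
      assume "\<mu> \<in> A \<inter> B"
      then obtain fs r gs s where 1: "N A fs r" and 2: "N B gs s" using Int.IH by auto
      have "N (A \<inter> B) (fs \<union> gs) (min r s)" using 1 2 unfolding N_def by auto
      then show "\<exists>fs r. N (A \<inter> B) fs r" by (intro exI)
    qed
  next
    case (UN \<A>)
    show ?case
    proof
      assume "\<mu> \<in> \<Union>\<A>"
      then obtain A where A: "A \<in> \<A>" "\<mu> \<in> A" by blast
      then obtain fs r where "N A fs r" using UN.IH[OF A(1)] by auto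
      then have "N (\<Union>\<A>) fs r" by (rule mono) (use A(1) in blast)
      then show "\<exists>fs r. N (\<Union>\<A>) fs r" by (intro exI)
    qed
  next
    case (Basis A)
    then obtain f :: "'x \<Rightarrow> real" and V where A: "A = {\<mu> \<in> Borel_probs. (\<integral>x. f x \<partial>\<mu>) \<in> V}"
      and f: "continuous_on UNIV f" "open V" by blast
    show ?case
    proof
      assume "\<mu> \<in> A"
      then have "(\<integral>x. f x \<partial>\<mu>) \<in> V" using A by blast
      then obtain e where e: "e > 0" "\<And>y. dist y (\<integral>x. f x \<partial>\<mu>) < e \<Longrightarrow> y \<in> V"
        using f(2) unfolding open_dist by blast
      have "N A {f} (e / 2)" using e f(1) by (auto simp: N_def A dist_real_def)
      then show "\<exists>fs r. N A fs r" by (intro exI)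
    qed
  qed
  then obtain fs r where "N V fs r" using V(2) by auto
  then have "N U fs r" by (rule mono[OF _ V(3)])
  then show ?thesis unfolding N_def by (intro exI[of _ fs] exI[of _ r])
qed

context G_system begin

lemma entropy_scale_antimono:
  assumes K: "\<And>n. finite (K n) \<and> K n \<subseteq> carrier G" and e: "0 < \<epsilon>" "\<epsilon> \<le> \<epsilon>'"
  shows "entropy_scale K \<phi> Y \<epsilon>' \<le> entropy_scale K \<phi> Y \<epsilon>"
  unfolding entropy_scale_def
proof (rule Limsup_mono, rule always_eventually, rule allI)
  fix n
  have Kn: "finite (K n)" "K n \<subseteq> carrier G" using K[of n] by auto
  obtain E where E: "E \<subseteq> Y" "finite E" "separated \<phi> (K n) \<epsilon>' E" "card E = sep_card \<phi> Y (K n) \<epsilon>'"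
    using sep_card_attained(1)[OF tds Kn, of \<epsilon>' Y] e by auto
  have "separated \<phi> (K n) \<epsilon> E" using E(3) e(2) unfolding separated_def by (meson le_less_trans)
  then have le: "sep_card \<phi> Y (K n) \<epsilon>' \<le> sep_card \<phi> Y (K n) \<epsilon>"
    using sep_card_attained(2)[OF tds Kn e(1) E(1)] E(4) by simp
  have "ln (real (sep_card \<phi> Y (K n) \<epsilon>')) \<le> ln (real (sep_card \<phi> Y (K n) \<epsilon>))"
  proof (cases "sep_card \<phi> Y (K n) \<epsilon>' = 0")
    case True
    then show ?thesis by (cases "sep_card \<phi> Y (K n) \<epsilon> = 0") auto
  next
    case False
    then show ?thesis using le by simp
  qed
  then show "ereal (1 / real (card (K n)) * ln (real (sep_card \<phi> Y (K n) \<epsilon>'))) \<le>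
      ereal (1 / real (card (K n)) * ln (real (sep_card \<phi> Y (K n) \<epsilon>)))"
    by (simp add: divide_right_mono)
qed

text \<open>The entropy at scale \<open>\<epsilon>\<close> grows as \<open>\<epsilon>\<close> decreases, so its limit at 0 is the supremum.\<close>

lemma entropy_scale_le_top_entropy:
  assumes K: "\<And>n. finite (K n) \<and> K n \<subseteq> carrier G" and e: "0 < \<epsilon>"
  shows "entropy_scale K \<phi> Y \<epsilon> \<le> top_entropy K \<phi> Y"
proof -
  let ?f = "\<lambda>\<epsilon>. entropy_scale K \<phi> Y \<epsilon>"
  define S where "S = (SUP \<epsilon>\<in>{0<..}. ?f \<epsilon>)"
  have up: "?f \<epsilon> \<le> S" if "\<epsilon> > 0" for \<epsilon> unfolding S_def using that by (intro SUP_upper) auto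
  have pos: "\<forall>\<^sub>F \<epsilon> in at_right (0::real). \<epsilon> > 0" by (rule eventually_at_right_less)
  have "(?f \<longlongrightarrow> S) (at_right 0)"
  proof (rule order_tendstoI)
    fix a assume "a < S"
    then obtain \<epsilon>0 where e0: "\<epsilon>0 > 0" "a < ?f \<epsilon>0" unfolding S_def less_SUP_iff by auto
    have "\<forall>\<^sub>F \<epsilon> in at_right 0. \<epsilon> < \<epsilon>0" using e0(1) by (rule eventually_at_right_real[THEN eventually_mono]) auto
    with pos show "\<forall>\<^sub>F \<epsilon> in at_right 0. a < ?f \<epsilon>"
      by eventually_elim (use entropy_scale_antimono[OF K] e0(2) in \<open>force intro: less_le_trans\<close>)
  next
    fix a assume "S < a"
    with pos show "\<forall>\<^sub>F \<epsilon> in at_right 0. ?f \<epsilon> < a"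
      by (auto elim!: eventually_mono intro: le_less_trans[OF up])
  qed
  then have "top_entropy K \<phi> Y = S"
    unfolding top_entropy_def by (intro tendsto_Lim) auto
  then show ?thesis using up[OF e] by simp
qed

text \<open>Discarding labels gives a set of the prescribed exponential size, which is what the upper entropy bound needs.\<close>

lemma good_labels_trim:
  assumes "good_labels \<mu> fs r h \<delta> A E"
  shows "\<exists>E'. good_labels \<mu> fs r h \<delta> A E' \<and> real (card E') \<le> exp (h * real (card A)) + 1"
proof -
  let ?k = "nat \<lceil>exp (h * real (card A))\<rceil>"
  have "?k \<le> card E" using assms by (simp add: good_labels_def nat_le_iff ceiling_le_iff)
  then obtain E' where E': "E' \<subseteq> E" "card E' = ?k" "finite E'"
    using obtain_subset_with_card_n by metis
  have k: "exp (h * real (card A)) \<le> real ?k" "real ?k \<le> exp (h * real (card A)) + 1"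
    using exp_gt_zero[of "h * real (card A)"] by linarith+
  have "separated \<phi> A \<delta> E'" using assms E'(1) unfolding good_labels_def separated_def by blast
  then show ?thesis using assms E' k unfolding good_labels_def by (intro exI[of _ E']) auto
qed

lemma labels_properties:
  assumes E: "\<And>A. finite A \<Longrightarrow> A \<subseteq> carrier G \<Longrightarrow> M0 \<le> card A \<Longrightarrow>
      good_labels \<mu> fs r h \<delta> A (E A) \<and> real (card (E A)) \<le> exp (h * real (card A)) + 1"
    and I: "finite I" "I \<subseteq> carrier G" "M0 \<le> card I" and M0: "M0 \<ge> 1"
  shows "finite (labels E I)" "real (card (labels E I)) \<le> real (card I) * (exp (h * real (card I)) + 1)"
    "\<exists>E'\<subseteq>labels E I. finite E' \<and> separated \<phi> I \<delta> E' \<and> exp (h * real (card I)) \<le> real (card E')"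
    "\<And>p f. p \<in> labels E I \<Longrightarrow> f \<in> fs \<Longrightarrow>
       \<bar>(\<Sum>g\<in>I. f (\<phi> g p)) - real (card I) * (\<integral>x. f x \<partial>\<mu>)\<bar> \<le> r * real (card I)"
proof -
  have shift: "finite (I #> inv b)" "I #> inv b \<subseteq> carrier G" "card (I #> inv b) = card I" if "b \<in> I" for b
  proof -
    have "inv b \<in> carrier G" using that I by auto
    then show "finite (I #> inv b)" "I #> inv b \<subseteq> carrier G" "card (I #> inv b) = card I"
      using finite_r_coset[OF I(1)] r_coset_carrier[OF I(2)] card_r_coset[OF I(2)] by auto
  qed
  have G: "good_labels \<mu> fs r h \<delta> (I #> inv b) (E (I #> inv b))" "real (card (E (I #> inv b))) \<le> exp (h * real (card I)) + 1"
    if "b \<in> I" for b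
    using E[OF shift(1,2)[OF that]] shift(3)[OF that] I(3) by auto
  have fin: "finite (E (I #> inv b))" if "b \<in> I" for b using G(1)[OF that] by (simp add: good_labels_def)
  show "finite (labels E I)" unfolding labels_def using I(1) fin by auto
  have "card (labels E I) \<le> (\<Sum>b\<in>I. card (\<phi> (inv b) ` E (I #> inv b)))"
    unfolding labels_def by (rule card_UN_le[OF I(1)])
  then have "real (card (labels E I)) \<le> (\<Sum>b\<in>I. real (card (\<phi> (inv b) ` E (I #> inv b))))"
    by (simp only: of_nat_sum[symmetric] of_nat_le_iff)
  also have "\<dots> \<le> (\<Sum>b\<in>I. exp (h * real (card I)) + 1)"
  proof (rule sum_mono)
    fix b assume b: "b \<in> I"
    have "real (card (\<phi> (inv b) ` E (I #> inv b))) \<le> real (card (E (I #> inv b)))"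
      using card_image_le[OF fin[OF b]] by (rule of_nat_mono)
    then show "real (card (\<phi> (inv b) ` E (I #> inv b))) \<le> exp (h * real (card I)) + 1" using G(2)[OF b] by simp
  qed
  finally show "real (card (labels E I)) \<le> real (card I) * (exp (h * real (card I)) + 1)" by simp
  have "I \<noteq> {}" using I(3) M0 by auto
  then obtain b where b: "b \<in> I" by blast
  have bc: "b \<in> carrier G" using b I by auto
  have inj: "inj_on (\<phi> (inv b)) (E (I #> inv b))"
    by (rule inj_on_inverseI[of _ "\<phi> b"]) (simp add: act_inv bc)
  have "separated \<phi> I \<delta> (\<phi> (inv b) ` E (I #> inv b))"
    using G(1)[OF b] by (intro separated_shift[OF I(2) bc]) (simp add: good_labels_def)
  moreover have "exp (h * real (card I)) \<le> real (card (\<phi> (inv b) ` E (I #> inv b)))"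
    using G(1)[OF b] shift(3)[OF b] by (simp add: card_image[OF inj] good_labels_def)
  moreover have "\<phi> (inv b) ` E (I #> inv b) \<subseteq> labels E I" using b by (auto simp: labels_def)
  ultimately show "\<exists>E'\<subseteq>labels E I. finite E' \<and> separated \<phi> I \<delta> E' \<and> exp (h * real (card I)) \<le> real (card E')"
    using fin[OF b] by (intro exI[of _ "\<phi> (inv b) ` E (I #> inv b)"]) auto
  fix p f assume p: "p \<in> labels E I" and f: "f \<in> fs"
  then obtain b q where bq: "b \<in> I" "q \<in> E (I #> inv b)" "p = \<phi> (inv b) q" by (auto simp: labels_def)
  have "(\<Sum>g\<in>I. f (\<phi> g p)) = (\<Sum>g\<in>I #> inv b. f (\<phi> g q))"
    unfolding bq(3) using bq(1) I(2) by (intro orbit_sum_shift) auto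
  then show "\<bar>(\<Sum>g\<in>I. f (\<phi> g p)) - real (card I) * (\<integral>x. f x \<partial>\<mu>)\<bar> \<le> r * real (card I)"
    using G(1)[OF bq(1)] shift(3)[OF bq(1)] bq(2) f by (simp add: good_labels_def)
qed

text \<open>By invariance the integral of an orbit sum over \<open>W\<close> is \<open>|W|\<close> times the integral.\<close>

lemma integral_near_of_orbit_sums:
  assumes \<nu>: "\<nu> \<in> inv_probs G \<phi>" "measure \<nu> \<Lambda> = 1" and f: "continuous_on UNIV f"
    and W: "finite W" "W \<subseteq> carrier G" "W \<noteq> {}"
    and near: "\<And>x. x \<in> \<Lambda> \<Longrightarrow> \<bar>(\<Sum>g\<in>W. f (\<phi> g x)) - real (card W) * c\<bar> \<le> r * real (card W)"
  shows "\<bar>(\<integral>x. f x \<partial>\<nu>) - c\<bar> \<le> (r::real)"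
proof -
  interpret prob_space \<nu> by (rule inv_probsD(2)[OF \<nu>(1)])
  have L: "\<Lambda> \<in> events" using \<nu>(2) measure_notin_sets by fastforce
  have ae: "AE x in \<nu>. x \<in> \<Lambda>" using \<nu>(2) L by (simp add: prob_eq_1)
  let ?u = "\<lambda>x. \<Sum>g\<in>W. f (\<phi> g x)"
  have i: "integrable \<nu> ?u" using integral_act(1)[OF \<nu>(1) _ f] W(2) by (intro Bochner_Integration.integrable_sum) auto
  have e: "(\<integral>x. ?u x \<partial>\<nu>) = real (card W) * (\<integral>x. f x \<partial>\<nu>)"
    using integral_act[OF \<nu>(1) _ f] W(2) by (subst Bochner_Integration.integral_sum) (auto simp: subset_iff)
  have "AE x in \<nu>. ?u x \<le> real (card W) * c + r * real (card W)"
    using ae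
  proof eventually_elim
    case (elim x)
    then show ?case using near[OF elim] by linarith
  qed
  then have "(\<integral>x. ?u x \<partial>\<nu>) \<le> (\<integral>x. real (card W) * c + r * real (card W) \<partial>\<nu>)"
    using i by (intro integral_mono_AE) auto
  moreover have "AE x in \<nu>. real (card W) * c - r * real (card W) \<le> ?u x"
    using ae
  proof eventually_elim
    case (elim x)
    then show ?case using near[OF elim] by linarith
  qed
  then have "(\<integral>x. real (card W) * c - r * real (card W) \<partial>\<nu>) \<le> (\<integral>x. ?u x \<partial>\<nu>)"
    using i by (intro integral_mono_AE) auto
  ultimately have "\<bar>real (card W) * ((\<integral>x. f x \<partial>\<nu>) - c)\<bar> \<le> real (card W) * r"
    unfolding e using prob_space by (simp add: abs_le_iff algebra_simps)
  moreover have "real (card W) > 0" using W by (simp add: card_gt_0_iff)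
  ultimately show ?thesis by (simp add: abs_mult)
qed

text \<open>The order in which the parameters are chosen matters. First the tracing scale \<open>\<epsilon>\<close>, then the minimal size \<open>M0\<close> of the pieces
  and the allowed gap density \<open>\<kappa>\<close>, then the separating set \<open>Q\<close>, and last the spread family.\<close>

lemma exists_horseshoe:
  assumes \<mu>: "\<mu> \<in> inv_probs G \<phi>" and spec: "specification_property G \<phi>" and K: "Folner_sequence G K"
    and inf: "infinite (carrier G)" and cnt: "countable (carrier G)"
    and fin: "finite fs" and ct: "\<forall>f\<in>fs. continuous_on UNIV f" and r: "r > 0"
    and h: "h \<ge> 0" and \<beta>: "\<beta> > 0" and \<gamma>: "\<gamma> > 0" and \<delta>: "\<delta> > 0"
    and good: "\<forall>A. finite A \<and> A \<subseteq> carrier G \<and> m \<le> card A \<longrightarrow> (\<exists>E. good_labels \<mu> fs (r / 4) h \<delta> A E)"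
  shows "\<exists>\<Lambda>. \<Lambda> \<noteq> {} \<and> compact \<Lambda> \<and> G_invariant_set G \<phi> \<Lambda> \<and>
    (\<forall>\<nu>\<in>sub_inv_probs G \<phi> \<Lambda>. \<forall>f\<in>fs. \<bar>(\<integral>x. f x \<partial>\<nu>) - (\<integral>x. f x \<partial>\<mu>)\<bar> \<le> r) \<and>
    entropy_scale K \<phi> \<Lambda> \<gamma> \<le> ereal (h + \<beta>) \<and> ereal (h * (1 - \<beta>)) \<le> entropy_scale K \<phi> \<Lambda> (\<delta> / 2)"
proof -
  note fs = fin bspec[OF ct]
  have Kn: "finite (K n)" "K n \<subseteq> carrier G" "K n \<noteq> {}" for n using K by (auto simp: Folner_sequence_def)
  obtain B where B: "B > 0" "\<And>f x. f \<in> fs \<Longrightarrow> \<bar>f x\<bar> \<le> B" using uniform_bound[OF fs] by blast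
  obtain d where d: "d > 0" "\<And>f x y. f \<in> fs \<Longrightarrow> dist x y \<le> d \<Longrightarrow> \<bar>f x - f y\<bar> \<le> r / 4"
    using uniform_modulus[OF fs, of "r / 4"] r by auto
  define \<epsilon> where "\<epsilon> = min (\<delta> / 4) (min (\<gamma> / 2) d)"
  have \<epsilon>: "\<epsilon> > 0" "\<epsilon> \<le> \<delta> / 4" "2 * \<epsilon> \<le> \<gamma>" "\<epsilon> \<le> d" using \<delta> \<gamma> d(1) by (auto simp: \<epsilon>_def)
  have "\<gamma> / 2 > 0" using \<gamma> by simp
  from finite_net[OF this] obtain C where C: "finite C" "C \<noteq> {}" "\<And>x::'x. \<exists>c\<in>C. dist c x < \<gamma> / 2" by blast
  define N where "N = real (card C)"
  have N: "ln N \<ge> 0" using C by (simp add: N_def Suc_le_eq card_gt_0_iff)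
  \<comment> \<open>for \<open>n \<ge> 64 / \<beta>\<^sup>2\<close> the factor \<open>n\<close> from the base points is absorbed by \<open>exp (\<beta> / 4 * n)\<close>\<close>
  define M0 where "M0 = max m (nat \<lceil>64 / \<beta>\<^sup>2\<rceil> + 1)"
  have M0: "M0 \<ge> 1" "m \<le> M0" "64 / \<beta>\<^sup>2 \<le> real M0" unfolding M0_def by linarith+
  define h2 where "h2 = h + \<beta> / 4"
  have grow: "real n * (exp (h * real n) + 1) \<le> exp (h2 * real n)" if n: "M0 \<le> n" for n
  proof -
    define t where "t = \<beta> / 4 * real n"
    have t0: "t \<ge> 0" using \<beta> by (simp add: t_def)
    have "64 / \<beta>\<^sup>2 \<le> real n" using M0(3) n by linarith
    then have "64 \<le> \<beta>\<^sup>2 * real n" using \<beta> by (simp add: field_simps)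
    then have "64 * real n \<le> \<beta>\<^sup>2 * real n * real n" by (intro mult_right_mono) auto
    then have "2 * real n \<le> t\<^sup>2 / 2" by (simp add: t_def power2_eq_square field_simps)
    also have "\<dots> \<le> exp t" using exp_lower_Taylor_quadratic[OF t0] t0 by simp
    finally have "2 * real n \<le> exp t" .
    have "real n * (exp (h * real n) + 1) \<le> real n * (exp (h * real n) + exp (h * real n))"
      using h by (intro mult_left_mono add_left_mono) auto
    also have "\<dots> = exp (h * real n) * (2 * real n)" by simp
    also have "\<dots> \<le> exp (h * real n) * exp t" using \<open>2 * real n \<le> exp t\<close> by (intro mult_left_mono) auto
    also have "\<dots> = exp (h2 * real n)" by (simp add: exp_add[symmetric] h2_def t_def algebra_simps)
    finally show ?thesis .
  qed
  \<comment> \<open>the excess \<open>\<beta>\<close> over \<open>h\<close> is shared by base points, net points, and the two terms from counting sparse sets\<close>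
  define s where "s = min 1 (\<beta> / 4)"
  have s: "0 < s" "s \<le> 1" "s \<le> \<beta> / 4" using \<beta> by (auto simp: s_def)
  define \<kappa> where "\<kappa> = min (min \<beta> (r / (8 * B))) (min (\<beta> / (4 * (ln N + 1))) (\<beta> / (4 * (1 - ln s))))"
  have ls: "ln s \<le> 0" using s by simp
  have \<kappa>: "\<kappa> > 0" "\<kappa> \<le> \<beta>" "\<kappa> \<le> r / (8 * B)" "\<kappa> \<le> \<beta> / (4 * (ln N + 1))" "\<kappa> \<le> \<beta> / (4 * (1 - ln s))"
    using \<beta> r B(1) N ls by (auto simp: \<kappa>_def)
  have k1: "2 * B * \<kappa> \<le> r / 4" using \<kappa>(3) B(1) by (simp add: field_simps)
  have k2: "\<kappa> * ln N \<le> \<beta> / 4"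
  proof -
    have "\<kappa> * (ln N + 1) \<le> \<beta> / 4" using \<kappa>(4) N by (simp add: field_simps)
    then show ?thesis using \<kappa>(1) by (simp add: algebra_simps)
  qed
  have k3: "- (\<kappa> * ln s) \<le> \<beta> / 4"
  proof -
    have "\<kappa> * (1 - ln s) \<le> \<beta> / 4" using \<kappa>(5) ls by (simp add: field_simps)
    then show ?thesis using \<kappa>(1) by (simp add: algebra_simps)
  qed
  obtain Q where Q: "finite Q" "Q \<subseteq> carrier G" "\<one> \<in> Q" "\<forall>k\<in>Q. inv k \<in> Q" "2 * M0 \<le> card Q" and tr: "traceable \<epsilon> Q"
    using symmetric_traceable[OF spec \<epsilon>(1) inf, of "2 * M0"] by blast
  obtain M \<tau> P where M: "finite M" "M \<subseteq> carrier G" "\<tau> > 0" and P: "spread_family Q M0 M \<tau> \<kappa> P"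
    using exists_spread_family[OF cnt K Q(1,2,4,3,5) \<kappa>(1)] by blast
  have "\<exists>E. good_labels \<mu> fs (r / 4) h \<delta> A E \<and> real (card E) \<le> exp (h * real (card A)) + 1"
    if A: "finite A" "A \<subseteq> carrier G" "M0 \<le> card A" for A
  proof -
    have "m \<le> card A" using A(3) M0(2) by simp
    then obtain E where "good_labels \<mu> fs (r / 4) h \<delta> A E" using good A(1,2) by auto
    then show ?thesis by (rule good_labels_trim)
  qed
  then have "\<forall>A. \<exists>E. finite A \<and> A \<subseteq> carrier G \<and> M0 \<le> card A \<longrightarrow>
     good_labels \<mu> fs (r / 4) h \<delta> A E \<and> real (card E) \<le> exp (h * real (card A)) + 1" by blast
  then obtain E where E: "\<And>A. finite A \<Longrightarrow> A \<subseteq> carrier G \<Longrightarrow> M0 \<le> card A \<Longrightarrow>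
     good_labels \<mu> fs (r / 4) h \<delta> A (E A) \<and> real (card (E A)) \<le> exp (h * real (card A)) + 1" by metis
  note LP = labels_properties[OF E _ _ _ M0(1)]
  define Y where "Y = traced_points (spread_family Q M0 M \<tau> \<kappa>) (labels E) \<epsilon>"
  define \<Lambda> where "\<Lambda> = closure Y"
  have comp: "compact \<Lambda>" using compact_Int_closed[OF compact_space closed_closure] by (simp add: \<Lambda>_def)
  have inv\<Lambda>: "G_invariant_set G \<phi> \<Lambda>"
    unfolding \<Lambda>_def Y_def by (rule closure_invariant) (rule traced_points_invariant[OF Q(2) M(2)])
  have evW: "\<forall>\<^sub>F n in sequentially. real (card ((M <#> K n) - K n)) \<le> \<tau> * real (card (K n))"
    by (rule Folner_invariance[OF K M])
  have lower: "\<exists>E'\<subseteq>Y. finite E' \<and> E' \<noteq> {} \<and> separated \<phi> W (\<delta> / 2) E' \<and> exp (h * (1 - \<kappa>) * real (card W)) \<le> real (card E')"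
    if W: "finite W" "W \<subseteq> carrier G" "real (card ((M <#> W) - W)) \<le> \<tau> * real (card W)" for W
    unfolding Y_def
    by (rule exists_separated_traced[OF Q(3) P tr LP(3) h \<delta> \<epsilon>(2) W])
  have upper: "real (sep_card \<phi> \<Lambda> W \<gamma>) \<le> exp (real (card W) * (h + \<beta>))"
    if W: "finite W" "W \<subseteq> carrier G" "real (card ((M <#> W) - W)) \<le> \<tau> * real (card W)" for W
  proof -
    obtain E0 where E0: "E0 \<subseteq> \<Lambda>" "finite E0" "separated \<phi> W \<gamma> E0" "card E0 = sep_card \<phi> \<Lambda> W \<gamma>"
      using sep_card_attained(1)[OF tds W(1,2) \<gamma>, of \<Lambda>] by blast
    obtain E1 where E1: "E1 \<subseteq> Y" "finite E1" "separated \<phi> W \<gamma> E1" "card E1 = card E0"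
      using separated_in_closure[OF W(1,2) E0(2) E0(1)[unfolded \<Lambda>_def] E0(3) \<gamma>] by blast
    have "real (card E1) \<le> exp (real (card W) * (h2 + \<kappa> * ln (real (card C)) + s - \<kappa> * ln s))"
    proof (rule card_separated_traced_le[OF Q(2,4,3) W _ _ \<epsilon>(3) C E1(2,3) E1(1)[unfolded Y_def] s(1,2)])
      show "h2 \<ge> 0" using h \<beta> by (simp add: h2_def)
      fix I assume I: "finite I" "I \<subseteq> carrier G" "M0 \<le> card I"
      have "real (card (labels E I)) \<le> exp (h2 * real (card I))"
        using LP(2)[OF _ _ _ I] grow[OF I(3)] by simp
      then show "finite (labels E I) \<and> real (card (labels E I)) \<le> exp (h2 * real (card I))"
        using LP(1)[OF _ _ _ I] by simp
    qed
    also have "\<dots> \<le> exp (real (card W) * (h + \<beta>))"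
    proof -
      have "h2 + \<kappa> * ln (real (card C)) + s - \<kappa> * ln s \<le> h + \<beta>"
        using k2 k3 s(3) by (simp add: h2_def N_def)
      then show ?thesis by (simp add: mult_left_mono)
    qed
    finally show ?thesis using E1(4) E0(4) by simp
  qed
  have "entropy_scale K \<phi> \<Lambda> \<gamma> \<le> ereal (h + \<beta>)"
    unfolding entropy_scale_def
  proof (rule Limsup_bounded)
    show "\<forall>\<^sub>F n in sequentially. ereal (1 / real (card (K n)) * ln (real (sep_card \<phi> \<Lambda> (K n) \<gamma>))) \<le> ereal (h + \<beta>)"
      using evW
    proof eventually_elim
      case (elim n)
      have pos: "real (card (K n)) > 0" using Kn[of n] by (simp add: card_gt_0_iff)
      have "ln (real (sep_card \<phi> \<Lambda> (K n) \<gamma>)) \<le> real (card (K n)) * (h + \<beta>)"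
      proof (cases "sep_card \<phi> \<Lambda> (K n) \<gamma> = 0")
        case True
        then show ?thesis using h \<beta> by simp
      next
        case False
        then have "ln (real (sep_card \<phi> \<Lambda> (K n) \<gamma>)) \<le> ln (exp (real (card (K n)) * (h + \<beta>)))"
          using upper[OF Kn(1,2) elim] by (subst ln_le_cancel_iff) auto
        then show ?thesis by simp
      qed
      then show ?case using pos by (simp add: field_simps)
    qed
  qed
  moreover have "ereal (h * (1 - \<beta>)) \<le> entropy_scale K \<phi> \<Lambda> (\<delta> / 2)"
    unfolding entropy_scale_def
  proof (rule le_Limsup)
    show "\<forall>\<^sub>F n in sequentially. ereal (h * (1 - \<beta>)) \<le> ereal (1 / real (card (K n)) * ln (real (sep_card \<phi> \<Lambda> (K n) (\<delta> / 2))))"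
      using evW
    proof eventually_elim
      case (elim n)
      have pos: "real (card (K n)) > 0" using Kn[of n] by (simp add: card_gt_0_iff)
      obtain E' where E': "E' \<subseteq> Y" "finite E'" "separated \<phi> (K n) (\<delta> / 2) E'"
        "exp (h * (1 - \<kappa>) * real (card (K n))) \<le> real (card E')" using lower[OF Kn(1,2) elim] by blast
      have "E' \<subseteq> \<Lambda>" using E'(1) closure_subset by (auto simp: \<Lambda>_def)
      moreover have "\<delta> / 2 > 0" using \<delta> by simp
      ultimately have "card E' \<le> sep_card \<phi> \<Lambda> (K n) (\<delta> / 2)"
        using sep_card_attained(2)[OF tds Kn(1) Kn(2) _ _ E'(3)] by blast
      then have "exp (h * (1 - \<kappa>) * real (card (K n))) \<le> real (sep_card \<phi> \<Lambda> (K n) (\<delta> / 2))" using E'(4) by linarith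
      then have "ln (exp (h * (1 - \<kappa>) * real (card (K n)))) \<le> ln (real (sep_card \<phi> \<Lambda> (K n) (\<delta> / 2)))"
        by (intro ln_mono exp_gt_zero)
      then have "h * (1 - \<kappa>) \<le> 1 / real (card (K n)) * ln (real (sep_card \<phi> \<Lambda> (K n) (\<delta> / 2)))"
        using pos by (simp add: field_simps)
      moreover have "h * (1 - \<beta>) \<le> h * (1 - \<kappa>)" using h \<kappa>(2) by (intro mult_left_mono) auto
      ultimately show ?case by simp
    qed
  qed simp
  moreover obtain n where n: "real (card ((M <#> K n) - K n)) \<le> \<tau> * real (card (K n))"
    using eventually_happens'[OF sequentially_bot evW] by blast
  have "\<Lambda> \<noteq> {}" using lower[OF Kn(1,2) n] closure_subset[of Y] by (auto simp: \<Lambda>_def)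
  moreover have "\<bar>(\<integral>x. f x \<partial>\<nu>) - (\<integral>x. f x \<partial>\<mu>)\<bar> \<le> r" if \<nu>: "\<nu> \<in> sub_inv_probs G \<phi> \<Lambda>" and f: "f \<in> fs" for \<nu> f
  proof -
    have \<nu>': "\<nu> \<in> inv_probs G \<phi>" "measure \<nu> \<Lambda> = 1" using \<nu> sub_inv_probs_eq[OF tds comp inv\<Lambda>] by auto
    define c where "c = (\<integral>x. f x \<partial>\<mu>)"
    have cB: "\<bar>c\<bar> \<le> B" unfolding c_def by (rule abs_integral_le[OF \<mu> fs(2)[OF f] B(2)[OF f]])
    have onY: "\<bar>(\<Sum>g\<in>K n. f (\<phi> g z)) - real (card (K n)) * c\<bar> \<le> r * real (card (K n))" if z: "z \<in> Y" for z
    proof -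
      have "\<bar>(\<Sum>g\<in>K n. f (\<phi> g z)) - real (card (K n)) * c\<bar> \<le> (r / 4 + r / 4 + 2 * B * \<kappa>) * real (card (K n))"
      proof (rule traced_orbit_average[OF Q(3) Kn(1,2) n z[unfolded Y_def] _ _ B(2)[OF f] cB])
        show "\<bar>(\<Sum>g\<in>I. f (\<phi> g p)) - real (card I) * c\<bar> \<le> r / 4 * real (card I)"
          if "finite I" "I \<subseteq> carrier G" "M0 \<le> card I" "p \<in> labels E I" for I p
          unfolding c_def by (rule LP(4)[OF _ _ _ that f])
        show "\<bar>f x - f y\<bar> \<le> r / 4" if "dist x y \<le> \<epsilon>" for x y using d(2)[OF f] that \<epsilon>(4) by auto
      qed (use r in auto)
      also have "\<dots> \<le> r * real (card (K n))" using k1 r by (intro mult_right_mono) auto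
      finally show ?thesis .
    qed
    have "\<bar>(\<Sum>g\<in>K n. f (\<phi> g z)) - real (card (K n)) * c\<bar> \<le> r * real (card (K n))" if z: "z \<in> \<Lambda>" for z
    proof -
      let ?S = "{z. \<bar>(\<Sum>g\<in>K n. f (\<phi> g z)) - real (card (K n)) * c\<bar> \<le> r * real (card (K n))}"
      have "continuous_on UNIV (\<lambda>z. f (\<phi> g z))" if "g \<in> K n" for g
        using continuous_on_compose2[OF fs(2)[OF f] continuous_act] Kn(2)[of n] that by blast
      then have "closed ?S" by (intro closed_Collect_le continuous_intros) auto
      then have "closure Y \<subseteq> ?S" using onY by (intro closure_minimal) auto
      then show ?thesis using z by (auto simp: \<Lambda>_def)
    qed
    then show ?thesis
      using integral_near_of_orbit_sums[OF \<nu>' fs(2)[OF f] Kn] unfolding c_def by blast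
  qed
  ultimately show ?thesis using comp inv\<Lambda> by blast
qed

end

theorem theorem1p3:
  fixes G :: "('g, 'b) monoid_scheme"
    and K :: "nat \<Rightarrow> 'g set"
    and \<phi> :: "'g \<Rightarrow> 'x \<Rightarrow> 'x::metric_space"
    and \<mu> :: "'x measure"
  assumes "infinite_countable_amenable_group G"
    and "Folner_sequence G K" and "tempered G K"
    and "G_tds G \<phi>"
    and "specification_property G \<phi>"
    and "\<mu> \<in> inv_probs G \<phi>"
  shows "almost_entropy_approximable G K \<phi> \<mu>"
proof -
  note K = assms(2) and spec = assms(5) and \<mu> = assms(6)
  have grp: "group G" and inf: "infinite (carrier G)" and cnt: "countable (carrier G)"
    using assms(1) by (auto simp: infinite_countable_amenable_group_def)
  interpret group G by (rule grp)
  interpret G_system G \<phi> by unfold_locales (rule assms(4))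
  have Kn: "finite (K n) \<and> K n \<subseteq> carrier G" for n using K by (auto simp: Folner_sequence_def)
  have \<mu>P: "\<mu> \<in> Borel_probs" using \<mu> by (simp add: inv_probs_def)
  have sub: "sub_inv_probs G \<phi> \<Lambda> \<subseteq> Borel_probs" if "compact \<Lambda>" "G_invariant_set G \<phi> \<Lambda>" for \<Lambda>
    using sub_inv_probs_eq[OF assms(4) that] by (auto simp: inv_probs_def)
  show ?thesis
  proof (cases "measure_entropy K \<phi> \<mu> > 0")
    case True
    have "\<exists>\<Lambda> \<gamma>. compact \<Lambda> \<and> G_invariant_set G \<phi> \<Lambda> \<and> 0 < \<gamma> \<and> \<gamma> < \<epsilon> \<and> sub_inv_probs G \<phi> \<Lambda> \<subseteq> U \<and>
        top_entropy K \<phi> \<Lambda> > ereal h \<and> entropy_scale K \<phi> \<Lambda> \<gamma> < ereal (h + \<beta>)"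
      if U: "weak_star_nhd U \<mu>" and h: "0 < h" "ereal h < measure_entropy K \<phi> \<mu>" and \<epsilon>: "0 < \<epsilon>" and \<beta>: "0 < \<beta>"
      for U and h \<epsilon> \<beta> :: real
    proof -
      from weak_star_basic_nhd[OF U \<mu>P]
      obtain fs :: "('x \<Rightarrow> real) set" and r where fin: "finite fs" and ct: "\<forall>f\<in>fs. continuous_on UNIV f" and r: "r > 0"
        and nhd: "\<forall>\<nu>\<in>Borel_probs. (\<forall>f\<in>fs. \<bar>(\<integral>x. f x \<partial>\<nu>) - (\<integral>x. f x \<partial>\<mu>)\<bar> \<le> r) \<longrightarrow> \<nu> \<in> U"
        by (elim exE conjE)
      obtain \<alpha> a where \<alpha>: "finite_Borel_partition \<alpha>" and a: "h < a"
        and aJ: "\<And>J. finite J \<Longrightarrow> J \<subseteq> carrier G \<Longrightarrow> a * real (card J) \<le> fent \<mu> (pname \<alpha> J)"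
        by (rule measure_entropy_gt[OF \<mu> K h(2)]) blast
      \<comment> \<open>the labels are produced at a rate \<open>h1\<close> strictly between \<open>h\<close> and both \<open>a\<close> and \<open>h + \<beta>\<close>\<close>
      define q where "q = min \<beta> (a - h)"
      define h1 where "h1 = h + q / 2"
      have "0 < q" "q \<le> \<beta>" "q \<le> a - h" using a \<beta> by (auto simp: q_def)
      then have h1: "h < h1" "h1 < a" "h1 \<le> h + \<beta> / 2" using a by (auto simp: h1_def)
      have "(a - h1) / 2 > 0" using h1 by simp
      from entropy_floor_of_partition[OF \<mu> \<alpha> this aJ]
      obtain \<delta>1 where \<delta>1: "\<delta>1 > 0" "entropy_floor \<mu> (a - (a - h1) / 2) \<delta>1" by blast
      have "r / 4 > 0" using r by simp
      have "0 \<le> a - (a - h1) / 2" "h1 < a - (a - h1) / 2" using h1 h by (auto simp: field_simps)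
      from typical_orbits[OF \<mu> spec K inf \<delta>1(2,1) this fin ct \<open>r / 4 > 0\<close>]
      obtain \<delta> m where \<delta>: "\<delta> > 0" and good: "\<forall>A. finite A \<and> A \<subseteq> carrier G \<and> m \<le> card A \<longrightarrow> (\<exists>E. good_labels \<mu> fs (r / 4) h1 \<delta> A E)"
        by (elim exE conjE)
      define \<beta>1 where "\<beta>1 = min (\<beta> / 4) ((h1 - h) / (2 * h1))"
      have \<beta>1: "\<beta>1 > 0" "\<beta>1 \<le> \<beta> / 4" "\<beta>1 \<le> (h1 - h) / (2 * h1)" using h1 h \<beta> by (auto simp: \<beta>1_def)
      have "h1 * \<beta>1 \<le> (h1 - h) / 2" using \<beta>1(3) h1 h by (simp add: field_simps)
      then have low: "h < h1 * (1 - \<beta>1)" using h1 by (simp add: algebra_simps)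
      have h10: "h1 \<ge> 0" using h1 h by simp
      have \<gamma>: "\<epsilon> / 2 > 0" using \<epsilon> by simp
      from exists_horseshoe[OF \<mu> spec K inf cnt fin ct r h10 \<beta>1(1) \<gamma> \<delta> good]
      obtain \<Lambda> where \<Lambda>: "compact \<Lambda>" "G_invariant_set G \<phi> \<Lambda>"
        "\<forall>\<nu>\<in>sub_inv_probs G \<phi> \<Lambda>. \<forall>f\<in>fs. \<bar>(\<integral>x. f x \<partial>\<nu>) - (\<integral>x. f x \<partial>\<mu>)\<bar> \<le> r"
        "entropy_scale K \<phi> \<Lambda> (\<epsilon> / 2) \<le> ereal (h1 + \<beta>1)" "ereal (h1 * (1 - \<beta>1)) \<le> entropy_scale K \<phi> \<Lambda> (\<delta> / 2)"
        by (elim exE conjE)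
      have "\<nu> \<in> U" if "\<nu> \<in> sub_inv_probs G \<phi> \<Lambda>" for \<nu>
        using nhd \<Lambda>(3) that subsetD[OF sub[OF \<Lambda>(1,2)] that] by simp
      then have "sub_inv_probs G \<phi> \<Lambda> \<subseteq> U" by (rule subsetI)
      moreover have "ereal h < top_entropy K \<phi> \<Lambda>"
      proof -
        have "ereal h < ereal (h1 * (1 - \<beta>1))" using low by simp
        also have "\<dots> \<le> entropy_scale K \<phi> \<Lambda> (\<delta> / 2)" by (rule \<Lambda>(5))
        also have "\<dots> \<le> top_entropy K \<phi> \<Lambda>" using \<delta> by (intro entropy_scale_le_top_entropy[OF Kn]) simp
        finally show ?thesis .
      qed
      moreover have "entropy_scale K \<phi> \<Lambda> (\<epsilon> / 2) < ereal (h + \<beta>)"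
      proof -
        have "ereal (h1 + \<beta>1) < ereal (h + \<beta>)" using h1(3) \<beta>1(2) \<beta> by simp
        then show ?thesis using \<Lambda>(4) by (rule le_less_trans[rotated])
      qed
      ultimately show ?thesis using \<Lambda>(1,2) \<epsilon> by (intro exI[of _ \<Lambda>] exI[of _ "\<epsilon> / 2"]) auto
    qed
    then show ?thesis using True unfolding almost_entropy_approximable_def by simp
  next
    case False
    have "\<exists>\<Lambda>. \<Lambda> \<noteq> {} \<and> compact \<Lambda> \<and> G_invariant_set G \<phi> \<Lambda> \<and> sub_inv_probs G \<phi> \<Lambda> \<subseteq> U"
      if U: "weak_star_nhd U \<mu>" for U
    proof -
      from weak_star_basic_nhd[OF U \<mu>P]
      obtain fs :: "('x \<Rightarrow> real) set" and r where fin: "finite fs" and ct: "\<forall>f\<in>fs. continuous_on UNIV f" and r: "r > 0"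
        and nhd: "\<forall>\<nu>\<in>Borel_probs. (\<forall>f\<in>fs. \<bar>(\<integral>x. f x \<partial>\<nu>) - (\<integral>x. f x \<partial>\<mu>)\<bar> \<le> r) \<longrightarrow> \<nu> \<in> U"
        by (elim exE conjE)
      have "entropy_floor \<mu> 0 1"
        unfolding entropy_floor_def
        by (auto intro: prob_space.fent_nonneg[OF inv_probsD(2)[OF \<mu>] inv_probsD(3)[OF \<mu>]])
      moreover have "r / 4 > 0" using r by simp
      moreover have "(-1::real) < 0" by simp
      ultimately have "\<exists>\<delta> m. \<delta> > 0 \<and> (\<forall>A. finite A \<and> A \<subseteq> carrier G \<and> m \<le> card A \<longrightarrow>
          (\<exists>E. good_labels \<mu> fs (r / 4) (-1) \<delta> A E))"
        by (intro typical_orbits[OF \<mu> spec K inf _ zero_less_one order_refl _ fin ct])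
      then obtain \<delta> m where \<delta>: "\<delta> > 0" and good0: "\<forall>A. finite A \<and> A \<subseteq> carrier G \<and> m \<le> card A \<longrightarrow>
          (\<exists>E. good_labels \<mu> fs (r / 4) (-1) \<delta> A E)" by (elim exE conjE)
      have good: "\<forall>A. finite A \<and> A \<subseteq> carrier G \<and> m \<le> card A \<longrightarrow> (\<exists>E. good_labels \<mu> fs (r / 4) 0 \<delta> A E)"
      proof (intro allI impI)
        fix A assume A: "finite A \<and> A \<subseteq> carrier G \<and> m \<le> card A"
        obtain E where E: "good_labels \<mu> fs (r / 4) (-1) \<delta> A E" using good0 A by auto
        \<comment> \<open>at the negative rate \<open>-1\<close> the bound only says that there is a label; one label suffices at rate \<open>0\<close>\<close>
        have "0 < real (card E)" using E exp_gt_zero[of "-1 * real (card A)"] unfolding good_labels_def by linarith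
        then have "1 \<le> real (card E)" by simp
        then show "\<exists>E. good_labels \<mu> fs (r / 4) 0 \<delta> A E"
          using E unfolding good_labels_def by (intro exI[of _ E]) simp
      qed
      from exists_horseshoe[OF \<mu> spec K inf cnt fin ct r order_refl zero_less_one zero_less_one \<delta> good]
      obtain \<Lambda> where \<Lambda>: "\<Lambda> \<noteq> {}" "compact \<Lambda>" "G_invariant_set G \<phi> \<Lambda>"
        "\<forall>\<nu>\<in>sub_inv_probs G \<phi> \<Lambda>. \<forall>f\<in>fs. \<bar>(\<integral>x. f x \<partial>\<nu>) - (\<integral>x. f x \<partial>\<mu>)\<bar> \<le> r"
        by (elim exE conjE)
      have "\<nu> \<in> U" if "\<nu> \<in> sub_inv_probs G \<phi> \<Lambda>" for \<nu>
        using nhd \<Lambda>(4) that subsetD[OF sub[OF \<Lambda>(2,3)] that] by simp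
      then show ?thesis using \<Lambda>(1-3) by (intro exI[of _ \<Lambda>]) auto
    qed
    then show ?thesis using False unfolding almost_entropy_approximable_def by simp
  qed
qed

end
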